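(* There is a constant $\overline{\lambda} > 0.2344$ such that for every fixed $\lambda$ with $0 < \lambda \leq \overline{\lambda}$, partial rejection sampling for the hard disks model on $[0,1]^2$ with disk radius $r$ and intensity $\lambda_r = \frac{\lambda}{\pi r^2}$ takes $O(\log(1/r))$ rounds of resampling in expectation as $r \to 0$. That is, if $T = T_{\lambda, r}$ denotes the number of rounds of resampling performed by the algorithm before it terminates, then there exist constants $K > 0$ and $r_0 \in (0,1)$ such that $\mathbb{E}[T_{\lambda,r}] \leq K \log(1/r)$ for all $0 < r < r_0$.
   Context: Hard disks model: for $r>0$ and $\lambda>0$, the centers of disks of radius $r$ are sampled from a Poisson point process of intensity $\lambda_r = \lambda/(\pi r^2)$ on $[0,1]^2$, conditioned on the disks being non-overlapping, i.e. on no two distinct centers being at Euclidean distance less than $2r$. For a finite point set $P \subset [0,1]^2$, let $\mathrm{BadPairs}(P)$ be the set of unordered pairs $\{x,y\} \subset P$ of distinct points with $\|x-y\| < 2r$, and let $\mathrm{BadPoints}(P)$ be the set of all points of $P$ that occur in some bad pair. Let $B_{2r}(x)$ denote the disk of radius $2r$ centered at $x$. Partial rejection sampling for the hard disks model is the following random procedure. (1) Let $P_0$ be a sample from the Poisson point process of intensity $\lambda_r$ on $[0,1]^2$, and set $t=0$. (2) If $\mathrm{BadPairs}(P_t) = \emptyset$, stop and output $P_t$. (3) Otherwise perform a round of resampling: let $S_t = [0,1]^2 \cap \bigcup_{x \in \mathrm{BadPoints}(P_t)} B_{2r}(x)$ be the resampling set, draw a fresh sample $Q_t$ (independent of everything so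 far, given $S_t$) from the Poisson point process of intensity $\lambda_r$ on $S_t$, set $P_{t+1} = (P_t \setminus S_t) \cup Q_t$, increase $t$ by one and return to (2). The number of rounds of resampling is $T = \min\{t \geq 0 : \mathrm{BadPairs}(P_t) = \emptyset\}$. *)

theory Defs
  imports "HOL-Probability.Probability"
begin

section \<open>Finite point configurations in the unit square\<close>

abbreviation unit_square :: "(real ^ 2) set"
  where "unit_square \<equiv> cbox 0 1"

text \<open>
  The usual \<open>\<sigma>\<close>-algebra on point configurations: the one generated by the counting maps
  that send \<open>X\<close> to the number of points of \<open>X\<close> in a Borel set \<open>A\<close>.
\<close>

definition configs :: "(real ^ 2) set measure"
  where "configs = sigma {X. finite X \<and> X \<subseteq> unit_square}
    {{X. finite X \<and> X \<subseteq> unit_square \<and> card (X \<inter> A) = n} | A n. A \<in> sets borel}"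

section \<open>Poisson point processes\<close>

text \<open>The library constant \<open>poisson_pmf\<close> is only specified for a positive rate.\<close>

definition poisson_distribution :: "real \<Rightarrow> nat pmf"
  where "poisson_distribution m = (if m = 0 then return_pmf 0 else poisson_pmf m)"

text \<open>
  \<open>poisson_process c S \<mu>\<close>: \<open>\<mu>\<close> is the law of a Poisson point process of intensity \<open>c\<close> on the
  Borel region \<open>S \<subseteq> unit_square\<close>. The case \<open>A = unit_square - S\<close> of the first clause says that
  almost surely there are no points outside \<open>S\<close>.
\<close>

definition poisson_process :: "real \<Rightarrow> (real ^ 2) set \<Rightarrow> (real ^ 2) set measure \<Rightarrow> bool"
  where "poisson_process c S \<mu> \<longleftrightarrow>
    prob_space \<mu> \<and> sets \<mu> = sets configs \<and>
    (\<forall>A \<in> sets borel. distr \<mu> (count_space UNIV) (\<lambda>X. card (X \<inter> A)) =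
        measure_pmf (poisson_distribution (c * measure lborel (A \<inter> S)))) \<and>
    (\<forall>A :: nat \<Rightarrow> (real ^ 2) set. range A \<subseteq> sets borel \<and> disjoint_family A \<longrightarrow>
        prob_space.indep_vars \<mu> (\<lambda>_. count_space UNIV) (\<lambda>i X. card (X \<inter> A i)) UNIV)"

section \<open>Regular conditional distributions\<close>

text \<open>
  \<open>\<kappa>\<close> is a regular conditional distribution, given the sub-\<open>\<sigma>\<close>-algebra \<open>F\<close> of \<open>M\<close>, of the random
  variable \<open>X\<close> with values in \<open>N\<close>.
\<close>

definition has_cond_distr ::
    "'w measure \<Rightarrow> 'w measure \<Rightarrow> 'c measure \<Rightarrow> ('w \<Rightarrow> 'c) \<Rightarrow> ('w \<Rightarrow> 'c measure) \<Rightarrow> bool"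
  where "has_cond_distr M F N X \<kappa> \<longleftrightarrow>
    \<kappa> \<in> measurable F (prob_algebra N) \<and>
    (\<forall>E \<in> sets F. \<forall>B \<in> sets N.
        emeasure M (E \<inter> (X -` B \<inter> space M)) = (\<integral>\<^sup>+\<omega>\<in>E. emeasure (\<kappa> \<omega>) B \<partial>M))"

section \<open>Partial rejection sampling for hard disks\<close>

definition bad_pairs :: "real \<Rightarrow> (real ^ 2) set \<Rightarrow> (real ^ 2) set set"
  where "bad_pairs r X = {{x, y} | x y. x \<in> X \<and> y \<in> X \<and> x \<noteq> y \<and> dist x y < 2 * r}"

definition bad_points :: "real \<Rightarrow> (real ^ 2) set \<Rightarrow> (real ^ 2) set"
  where "bad_points r X = \<Union> (bad_pairs r X)"

definition resampling_set :: "real \<Rightarrow> (real ^ 2) set \<Rightarrow> (real ^ 2) set"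
  where "resampling_set r X = unit_square \<inter> (\<Union>x \<in> bad_points r X. ball x (2 * r))"

definition disk_intensity :: "real \<Rightarrow> real \<Rightarrow> real"
  where "disk_intensity lam r = lam / (pi * r\<^sup>2)"

text \<open>
  The \<open>\<sigma>\<close>-algebra generated by everything that is known just before \<open>Q t\<close> is drawn, namely
  \<open>P 0, \<dots>, P t\<close> and \<open>Q 0, \<dots>, Q (t - 1)\<close>.
\<close>

definition history ::
    "'w measure \<Rightarrow> (nat \<Rightarrow> 'w \<Rightarrow> (real ^ 2) set) \<Rightarrow> (nat \<Rightarrow> 'w \<Rightarrow> (real ^ 2) set) \<Rightarrow> nat \<Rightarrow> 'w measure"
  where "history M P Q t = sigma (space M)
    ({P s -` B \<inter> space M | s B. s \<le> t \<and> B \<in> sets configs} \<union>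
     {Q s -` B \<inter> space M | s B. s < t \<and> B \<in> sets configs})"

text \<open>
  A run of the procedure on a probability space \<open>M\<close>. After termination the run is continued by
  leaving the configuration unchanged; the resampling set is then empty, so that \<open>Q t\<close> is almost
  surely empty. This has no influence on the number of rounds.
\<close>

locale partial_rejection_sampling = prob_space M
  for M :: "'w measure" and lam r :: real and P Q :: "nat \<Rightarrow> 'w \<Rightarrow> (real ^ 2) set" +
  assumes P_measurable: "\<And>t. P t \<in> measurable M configs"
    and Q_measurable: "\<And>t. Q t \<in> measurable M configs"
    and initial: "poisson_process (disk_intensity lam r) unit_square (distr M configs (P 0))"
    and resample: "\<And>t \<omega>. \<omega> \<in> space M \<Longrightarrow>
      P (Suc t) \<omega> = (if bad_pairs r (P t \<omega>) = {} then P t \<omega>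
                      else (P t \<omega> - resampling_set r (P t \<omega>)) \<union> Q t \<omega>)"
    and fresh: "\<And>t. \<exists>\<kappa>. has_cond_distr M (history M P Q t) configs (Q t) \<kappa> \<and>
      (\<forall>\<omega> \<in> space M. poisson_process (disk_intensity lam r) (resampling_set r (P t \<omega>)) (\<kappa> \<omega>))"

text \<open>The infimum of the empty set in \<open>enat\<close> is \<open>\<infinity>\<close>: this is the case of non-termination.\<close>

definition rounds :: "real \<Rightarrow> (nat \<Rightarrow> 'w \<Rightarrow> (real ^ 2) set) \<Rightarrow> 'w \<Rightarrow> enat"
  where "rounds r P \<omega> = Inf {enat t | t. bad_pairs r (P t \<omega>) = {}}"

end

theory Submission
  imports Defs
begin

text \<open>
  Take the number of bad points as potential. The Mecke equation for the Poisson process shows that,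
  given its bad points, the good points of a Poisson sample form a hard configuration outside the
  resampling set; this property survives each round, so after a round the configuration is a Poisson
  sample conditioned to be hard outside the old resampling set \<open>S\<close>. Write \<open>u = 4 lam\<close> for the
  expected number of points in a disk of radius \<open>2 r\<close>. Conditioning on hardness only thins the
  points outside \<open>S\<close>: a new point inside \<open>S\<close> is bad with probability at most \<open>1 - exp (-u)\<close>,
  and a point outside \<open>S\<close> is bad only if a fresh point falls into the part of its disk that
  lies in \<open>S\<close>. By the Mecke equation each old bad point contributes at most
  \<open>u (1 - exp (-u)) + 1.43 u\<^sup>2 / pi\<close> new ones, where \<open>1.43\<close> bounds a double integral
  over two disks. At \<open>lam = 0.2345\<close> this is below 1, so the expected number of bad points,
  initially of order \<open>1 / r\<^sup>2\<close>, decays geometrically.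
\<close>

section \<open>Measurability on the space of configurations\<close>

text \<open>Hardness off the old resampling set \<open>S\<close> survives conditioning on the new
  bad points for a simple reason: two points closer than \<open>2 * r\<close> are both bad, so
  whether \<open>X - S\<close> is hard can be read off from the bad points of \<open>X\<close>. The
  weight imposed by a round is thus a function of the new bad points, and given these the good
  points have the same law as in a plain Poisson sample. A Poisson process is known here only
  through its counts on disjoint sets. Uniqueness, independence of disjoint regions and the Mecke
  equation are therefore derived from counts, and conditioning on the bad points, an event of
  probability zero, is replaced by identities between integrals. The constant \<open>1.43\<close> is
  twice \<open>143 / 200\<close>: a disk of radius \<open>R\<close> shifted by a distance
  \<open>d\<close> uncovers an area of at most \<open>2 * R * d\<close>, and the mean of
  \<open>d / R\<close> over the disk, exactly \<open>2 / 3\<close>, is replaced by an upper Riemann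
  sum with ten steps.\<close>

lemma space_configs: "space configs = {X. finite X \<and> X \<subseteq> unit_square}"
  unfolding configs_def by (simp add: space_measure_of_conv)

lemma measurable_card_Int:
  assumes "A \<in> sets borel"
  shows "(\<lambda>X. card (X \<inter> A)) \<in> measurable configs (count_space UNIV)"
proof (rule measurableI)
  fix B :: "nat set"
  have "(\<lambda>X. card (X \<inter> A)) -` B \<inter> space configs
      = (\<Union>n\<in>B. {X. finite X \<and> X \<subseteq> unit_square \<and> card (X \<inter> A) = n})"
    by (auto simp: space_configs)
  also have "\<dots> \<in> sets configs"
  proof (rule sets.countable_UN'')
    show "{X. finite X \<and> X \<subseteq> unit_square \<and> card (X \<inter> A) = n} \<in> sets configs" for n
      unfolding configs_def using assms by (intro in_measure_of) auto
  qed auto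
  finally show "(\<lambda>X. card (X \<inter> A)) -` B \<inter> space configs \<in> sets configs" .
qed auto

lemma measurable_configsI:
  assumes "\<And>x. x \<in> space N \<Longrightarrow> finite (g x) \<and> g x \<subseteq> unit_square"
    and "\<And>A. A \<in> sets borel \<Longrightarrow> (\<lambda>x. card (g x \<inter> A)) \<in> measurable N (count_space UNIV)"
  shows "g \<in> measurable N configs"
  unfolding configs_def
proof (rule measurable_measure_of)
  fix B assume "B \<in> {{X. finite X \<and> X \<subseteq> unit_square \<and> card (X \<inter> A) = n} |A n. A \<in> sets borel}"
  then obtain A n where A: "A \<in> sets borel"
    and B: "B = {X. finite X \<and> X \<subseteq> unit_square \<and> card (X \<inter> A) = n}"
    by auto
  have "g -` B \<inter> space N = (\<lambda>x. card (g x \<inter> A)) -` {n} \<inter> space N"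
    using assms(1) by (auto simp: B)
  with assms(2)[OF A] show "g -` B \<inter> space N \<in> sets N"
    by (metis measurable_sets sets_count_space Pow_UNIV UNIV_I)
qed (use assms(1) in auto)

lemma configs_map:
  assumes "g \<in> measurable N configs" "x \<in> space N"
  shows "finite (g x)" "g x \<subseteq> unit_square"
  using measurable_space[OF assms] by (auto simp: space_configs)

text \<open>For a rectangle \<open>A \<times> B\<close> the sum is a multiple of the count of
  \<open>B\<close>, and the \<pi>-\<lambda> theorem does the rest; complements can be subtracted
  because configurations are finite. Most of the later measurability statements about point sets are
  reduced to this one.\<close>

lemma borel_measurable_sum_indicator_config:
  assumes g: "g \<in> measurable N configs" and E: "E \<in> sets (N \<Otimes>\<^sub>M borel)"
  shows "(\<lambda>x. \<Sum>y\<in>g x. indicator E (x, y) :: ennreal) \<in> borel_measurable N"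
proof -
  have card_g: "(\<lambda>x. card (g x \<inter> B)) \<in> measurable N (count_space UNIV)" if "B \<in> sets borel" for B
    by (rule measurable_compose[OF g measurable_card_Int[OF that]])
  let ?G = "{A \<times> B |A B. A \<in> sets N \<and> B \<in> sets (borel :: (real ^ 2) measure)}"
  have "E \<in> sigma_sets (space N \<times> space borel) ?G"
    using E by (simp add: sets_pair_measure)
  then show ?thesis
  proof (induction rule: sigma_sets_induct_disjoint[OF Int_stable_pair_measure_generator
      pair_measure_closed, consumes 1, case_names basic empty compl union])
    case (basic E)
    then obtain A B where AB: "A \<in> sets N" "B \<in> sets borel" "E = A \<times> B" by auto
    have "(\<Sum>y\<in>g x. indicator E (x, y) :: ennreal) = indicator A x * of_nat (card (g x \<inter> B))"
      if "x \<in> space N" for x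
    proof -
      have "(\<Sum>y\<in>g x. indicator E (x, y) :: ennreal) = (\<Sum>y\<in>g x. indicator A x * indicator B y)"
        by (intro sum.cong) (auto simp: AB indicator_def)
      also have "\<dots> = indicator A x * (\<Sum>y\<in>g x. indicator B y)"
        by (simp add: sum_distrib_left)
      also have "(\<Sum>y\<in>g x. indicator B y :: ennreal) = of_nat (card (g x \<inter> B))"
        using configs_map(1)[OF g that] by (simp add: indicator_def sum.If_cases Int_def)
      finally show ?thesis .
    qed
    moreover have "(\<lambda>x. indicator A x * of_nat (card (g x \<inter> B)) :: ennreal) \<in> borel_measurable N"
      using card_g[OF AB(2)] AB(1) by measurable
    ultimately show ?case by (subst measurable_cong) auto
  next
    case empty show ?case by simp
  next
    case (compl E)
    have "(\<Sum>y\<in>g x. indicator (space N \<times> space borel - E) (x, y) :: ennreal)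
      = of_nat (card (g x \<inter> UNIV)) - (\<Sum>y\<in>g x. indicator E (x, y))" if x: "x \<in> space N" for x
    proof -
      have fin: "finite (g x)" by (rule configs_map(1)[OF g x])
      have "of_nat (card (g x \<inter> UNIV)) = (\<Sum>y\<in>g x. (1::ennreal))" by simp
      also have "\<dots> = (\<Sum>y\<in>g x. indicator (space N \<times> space borel - E) (x, y) + indicator E (x, y))"
        using x by (intro sum.cong) (auto simp: indicator_def)
      also have "\<dots> = (\<Sum>y\<in>g x. indicator (space N \<times> space borel - E) (x, y))
          + (\<Sum>y\<in>g x. indicator E (x, y))" by (simp add: sum.distrib)
      finally show ?thesis
        using fin by (simp add: ennreal_add_diff_cancel_right sum_eq_0_iff indicator_def)
    qed
    moreover have "(\<lambda>x. of_nat (card (g x \<inter> UNIV)) - (\<Sum>y\<in>g x. indicator E (x, y)) :: ennreal)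
        \<in> borel_measurable N"
      using card_g[of UNIV] compl by measurable
    ultimately show ?case by (subst measurable_cong) auto
  next
    case (union A)
    have "(\<Sum>y\<in>g x. indicator (\<Union>(range A)) (x, y) :: ennreal)
      = (\<Sum>i. \<Sum>y\<in>g x. indicator (A i) (x, y))" for x
      using union(1) by (subst suminf_sum) (auto simp: suminf_indicator)
    then show ?case using union(3) by simp
  qed
qed

text \<open>The summand may depend on \<open>x\<close> as well as on the point \<open>y\<close>: in
  the Mecke equation \<open>x\<close> is the configuration itself, and the summand sees it with the
  point removed.\<close>

lemma borel_measurable_sum_config:
  fixes F :: "'a \<Rightarrow> real ^ 2 \<Rightarrow> ennreal"
  assumes g: "g \<in> measurable N configs"
    and F: "(\<lambda>(x, y). F x y) \<in> borel_measurable (N \<Otimes>\<^sub>M borel)"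
  shows "(\<lambda>x. \<Sum>y\<in>g x. F x y) \<in> borel_measurable N"
proof -
  define F' where "F' = (\<lambda>(x, y). F x y)"
  have "F' \<in> borel_measurable (N \<Otimes>\<^sub>M borel)" using F by (simp add: F'_def)
  then have "(\<lambda>x. \<Sum>y\<in>g x. F' (x, y)) \<in> borel_measurable N"
  proof (induction rule: borel_measurable_induct)
    case (cong f h)
    have "(\<lambda>x. \<Sum>y\<in>g x. f (x, y)) \<in> borel_measurable N \<longleftrightarrow>
       (\<lambda>x. \<Sum>y\<in>g x. h (x, y)) \<in> borel_measurable N"
      by (intro measurable_cong sum.cong) (use cong in \<open>auto simp: space_pair_measure\<close>)
    then show ?case using cong by blast
  next
    case (set A)
    then show ?case by (rule borel_measurable_sum_indicator_config[OF g])
  next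
    case (mult u c)
    then show ?case by (simp add: sum_distrib_left[symmetric])
  next
    case (add u v)
    then show ?case by (simp add: sum.distrib)
  next
    case (seq U)
    have "(\<Sum>y\<in>g x. (SUP i. U i) (x, y)) = (SUP i. \<Sum>y\<in>g x. U i (x, y))" for x
      using seq(3) by (simp add: SUP_apply image_comp, subst ennreal_SUP_sum)
        (auto simp: incseq_def le_fun_def)
    then show ?case using seq by (simp add: borel_measurable_SUP)
  qed
  then show ?thesis by (simp add: F'_def)
qed

lemma card_filter_eq_sum:
  assumes "finite A"
  shows "of_nat (card {y\<in>A. P y}) = (\<Sum>y\<in>A. of_bool (P y) :: ennreal)"
  using assms by (simp add: of_bool_def sum.If_cases Int_def)

lemma measurable_nat_ennreal:
  assumes "(\<lambda>x. of_nat (f x) :: ennreal) \<in> borel_measurable N"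
  shows "f \<in> measurable N (count_space UNIV)"
proof (rule measurable_count_space_eq2_countable[THEN iffD2]; safe?)
  fix n :: nat
  have "f -` {n} \<inter> space N = (\<lambda>x. of_nat (f x) :: ennreal) -` {of_nat n} \<inter> space N" by auto
  then show "f -` {n} \<inter> space N \<in> sets N" using measurable_sets[OF assms, of "{of_nat n}"] by simp
qed auto

lemma measurable_config_card_filter:
  assumes g: "g \<in> measurable N configs"
    and P: "Measurable.pred (N \<Otimes>\<^sub>M borel) (\<lambda>(x, y). P x y)"
  shows "(\<lambda>x. card {y\<in>g x. P x y}) \<in> measurable N (count_space UNIV)"
proof (rule measurable_nat_ennreal)
  have [measurable]: "Measurable.pred (N \<Otimes>\<^sub>M borel) (\<lambda>p. P (fst p) (snd p))"
    using P by (simp add: case_prod_beta)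
  have "(\<lambda>x. \<Sum>y\<in>g x. of_bool (P x y) :: ennreal) \<in> borel_measurable N"
    by (intro borel_measurable_sum_config[OF g]) measurable
  then show "(\<lambda>x. of_nat (card {y\<in>g x. P x y}) :: ennreal) \<in> borel_measurable N"
    by (subst measurable_cong[OF card_filter_eq_sum]) (auto intro: configs_map[OF g])
qed

lemma measurable_config_filter:
  assumes g: "g \<in> measurable N configs"
    and P: "Measurable.pred (N \<Otimes>\<^sub>M borel) (\<lambda>(x, y). P x y)"
  shows "(\<lambda>x. {y\<in>g x. P x y}) \<in> measurable N configs"
proof (rule measurable_configsI)
  fix A :: "(real ^ 2) set" assume [measurable]: "A \<in> sets borel"
  have [measurable]: "Measurable.pred (N \<Otimes>\<^sub>M borel) (\<lambda>p. P (fst p) (snd p))"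
    using P by (simp add: case_prod_beta)
  have "(\<lambda>x. card {y\<in>g x. P x y \<and> y \<in> A}) \<in> measurable N (count_space UNIV)"
    by (intro measurable_config_card_filter[OF g]) measurable
  then show "(\<lambda>x. card ({y\<in>g x. P x y} \<inter> A)) \<in> measurable N (count_space UNIV)"
    by (simp add: Int_def conj_assoc)
qed (use configs_map[OF g] in auto)

text \<open>A quantifier over the plane ranges over uncountably many points; over the points of a
  configuration it says that a count does not vanish, which is measurable.\<close>

lemma pred_ex_config:
  assumes g: "g \<in> measurable N configs"
    and P: "Measurable.pred (N \<Otimes>\<^sub>M borel) (\<lambda>(x, y). P x y)"
  shows "Measurable.pred N (\<lambda>x. \<exists>y\<in>g x. P x y)"
proof -
  have [measurable]: "(\<lambda>x. card {y\<in>g x. P x y}) \<in> measurable N (count_space UNIV)"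
    by (rule measurable_config_card_filter[OF assms])
  have "Measurable.pred N (\<lambda>x. card {y\<in>g x. P x y} \<noteq> 0)" by measurable
  moreover have "(card {y\<in>g x. P x y} \<noteq> 0) = (\<exists>y\<in>g x. P x y)" if "x \<in> space N" for x
    using configs_map(1)[OF g that] by (auto simp: card_eq_0_iff)
  ultimately show ?thesis by (rule iffD1[OF measurable_cong, rotated 1])
qed

lemma pred_mem_config:
  assumes g: "g \<in> measurable N configs" and f[measurable]: "f \<in> measurable N borel"
  shows "Measurable.pred N (\<lambda>x. f x \<in> g x)"
proof -
  have "Measurable.pred N (\<lambda>x. \<exists>y\<in>g x. y = f x)"
    by (intro pred_ex_config[OF g]) measurable
  then show ?thesis by simp
qed

text \<open>Points common to both configurations must not be counted twice, hence only the points of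
  \<open>h x\<close> outside \<open>g x\<close> are added.\<close>

lemma measurable_config_Un:
  assumes g: "g \<in> measurable N configs" and h: "h \<in> measurable N configs"
  shows "(\<lambda>x. g x \<union> h x) \<in> measurable N configs"
proof (rule measurable_configsI)
  fix A :: "(real ^ 2) set" assume A[measurable]: "A \<in> sets borel"
  have g': "(\<lambda>(x, y). g x) \<in> measurable (N \<Otimes>\<^sub>M borel) configs"
    using g by measurable
  have [measurable]: "Measurable.pred (N \<Otimes>\<^sub>M borel) (\<lambda>(x, y). y \<in> g x)"
    using pred_mem_config[OF g', of snd] by (simp add: case_prod_beta)
  have [measurable]: "(\<lambda>x. card {y\<in>g x. y \<in> A}) \<in> measurable N (count_space UNIV)"
    by (intro measurable_config_card_filter[OF g]) measurable
  have [measurable]: "(\<lambda>x. card {y\<in>h x. y \<in> A \<and> y \<notin> g x}) \<in> measurable N (count_space UNIV)"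
    by (intro measurable_config_card_filter[OF h]) measurable
  have "(\<lambda>x. card {y\<in>g x. y \<in> A} + card {y\<in>h x. y \<in> A \<and> y \<notin> g x}) \<in> measurable N (count_space UNIV)"
    by measurable
  moreover have "card {y\<in>g x. y \<in> A} + card {y\<in>h x. y \<in> A \<and> y \<notin> g x} = card ((g x \<union> h x) \<inter> A)"
    if "x \<in> space N" for x
    using configs_map(1)[OF g that] configs_map(1)[OF h that]
    by (subst card_Un_disjoint[symmetric]) (auto intro: arg_cong[where f=card])
  ultimately show "(\<lambda>x. card ((g x \<union> h x) \<inter> A)) \<in> measurable N (count_space UNIV)"
    by (rule iffD1[OF measurable_cong, rotated 1])
qed (use configs_map[OF g] configs_map[OF h] in auto)

lemma measurable_config_singleton:
  assumes [measurable]: "f \<in> measurable N borel"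
  shows "(\<lambda>x. {f x} \<inter> unit_square) \<in> measurable N configs"
proof (rule measurable_configsI)
  fix A :: "(real ^ 2) set" assume [measurable]: "A \<in> sets borel"
  have "card ({f x} \<inter> unit_square \<inter> A) = (if f x \<in> unit_square \<inter> A then 1 else 0)" for x
    by auto
  then show "(\<lambda>x. card ({f x} \<inter> unit_square \<inter> A)) \<in> measurable N (count_space UNIV)"
    by simp
qed auto

lemma measurable_config_delete [measurable]:
  assumes [measurable]: "f \<in> measurable M borel" and g: "g \<in> measurable M configs"
  shows "(\<lambda>p. g p - {f p}) \<in> measurable M configs"
proof -
  have P: "Measurable.pred (M \<Otimes>\<^sub>M borel) (\<lambda>(p, y). y \<noteq> f p)" by measurable
  show ?thesis using measurable_config_filter[OF g P] by (simp add: set_diff_eq)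
qed

section \<open>Hard configurations, bad points and resampling sets\<close>

definition hard :: "real \<Rightarrow> (real ^ 2) set \<Rightarrow> bool"
  where "hard r X \<longleftrightarrow> bad_pairs r X = {}"

lemma bad_points_eq: "bad_points r X = {x\<in>X. \<exists>y\<in>X. x \<noteq> y \<and> dist x y < 2 * r}"
  unfolding bad_points_def bad_pairs_def by (auto simp: dist_commute) (metis dist_commute)+

lemma hard_iff: "hard r X \<longleftrightarrow> (\<forall>x\<in>X. \<forall>y\<in>X. x \<noteq> y \<longrightarrow> 2 * r \<le> dist x y)"
  unfolding hard_def bad_pairs_def by (auto simp: not_less[symmetric])

lemma hard_iff_bad_points: "hard r X \<longleftrightarrow> bad_points r X = {}"
  unfolding hard_iff bad_points_eq by (auto simp: not_less[symmetric])

lemma measurable_bad_points: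
  assumes g: "g \<in> measurable N configs"
  shows "(\<lambda>x. bad_points r (g x)) \<in> measurable N configs"
  unfolding bad_points_eq
proof (rule measurable_config_filter[OF g])
  have g': "(\<lambda>p. g (fst p)) \<in> measurable (N \<Otimes>\<^sub>M (borel :: (real ^ 2) measure)) configs"
    using g by measurable
  have "Measurable.pred (N \<Otimes>\<^sub>M borel) (\<lambda>p. \<exists>y\<in>g (fst p). snd p \<noteq> y \<and> dist (snd p) y < 2 * r)"
    by (intro pred_ex_config[OF g']) measurable
  then show "Measurable.pred (N \<Otimes>\<^sub>M borel) (\<lambda>(x, y). \<exists>z\<in>g x. y \<noteq> z \<and> dist y z < 2 * r)"
    by (simp add: case_prod_beta)
qed

lemma pred_hard:
  assumes g: "g \<in> measurable N configs"
  shows "Measurable.pred N (\<lambda>x. hard r (g x))"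
proof -
  have "Measurable.pred N (\<lambda>x. \<exists>y\<in>bad_points r (g x). True)"
    by (intro pred_ex_config[OF measurable_bad_points[OF g]]) auto
  then have "Measurable.pred N (\<lambda>x. \<not> (\<exists>y\<in>bad_points r (g x). True))" by measurable
  then show ?thesis by (simp add: hard_iff_bad_points ex_in_conv)
qed

lemma pred_mem_resampling_set:
  assumes g: "g \<in> measurable N configs" and f[measurable]: "f \<in> measurable N borel"
  shows "Measurable.pred N (\<lambda>x. f x \<in> resampling_set r (g x))"
proof -
  have [measurable]: "Measurable.pred N (\<lambda>x. \<exists>y\<in>bad_points r (g x). dist y (f x) < 2 * r)"
    by (intro pred_ex_config[OF measurable_bad_points[OF g]]) measurable
  have "Measurable.pred N (\<lambda>x. f x \<in> unit_square \<and> (\<exists>y\<in>bad_points r (g x). dist y (f x) < 2 * r))"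
    by measurable
  then show ?thesis by (simp add: resampling_set_def)
qed

lemma measurable_config_Int_resampling_set:
  assumes g: "g \<in> measurable N configs" and h: "h \<in> measurable N configs"
  shows "(\<lambda>x. h x \<inter> resampling_set r (g x)) \<in> measurable N configs"
    and "(\<lambda>x. h x - resampling_set r (g x)) \<in> measurable N configs"
proof -
  have g': "(\<lambda>p. g (fst p)) \<in> measurable (N \<Otimes>\<^sub>M (borel :: (real ^ 2) measure)) configs"
    using g by measurable
  have P[measurable]: "Measurable.pred (N \<Otimes>\<^sub>M borel) (\<lambda>(x, y). y \<in> resampling_set r (g x))"
    using pred_mem_resampling_set[OF g', of snd] by (simp add: case_prod_beta)
  then have P': "Measurable.pred (N \<Otimes>\<^sub>M borel) (\<lambda>(x, y). y \<notin> resampling_set r (g x))"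
    by measurable
  show "(\<lambda>x. h x \<inter> resampling_set r (g x)) \<in> measurable N configs"
    using measurable_config_filter[OF h P] by (simp add: Int_def)
  show "(\<lambda>x. h x - resampling_set r (g x)) \<in> measurable N configs"
    using measurable_config_filter[OF h P'] by (simp add: set_diff_eq)
qed

lemma measurable_config_Diff:
  assumes g: "g \<in> measurable N configs" and h: "h \<in> measurable N configs"
  shows "(\<lambda>x. h x - g x) \<in> measurable N configs"
proof -
  have g': "(\<lambda>p. g (fst p)) \<in> measurable (N \<Otimes>\<^sub>M (borel :: (real ^ 2) measure)) configs"
    using g by measurable
  have P[measurable]: "Measurable.pred (N \<Otimes>\<^sub>M borel) (\<lambda>(x, y). y \<in> g x)"
    using pred_mem_config[OF g', of snd] by (simp add: case_prod_beta)
  then have P': "Measurable.pred (N \<Otimes>\<^sub>M borel) (\<lambda>(x, y). y \<notin> g x)"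
    by measurable
  show ?thesis
    using measurable_config_filter[OF h P'] by (simp add: set_diff_eq)
qed

lemma measurable_config_fixed:
  assumes g: "g \<in> measurable N configs" and [measurable]: "S \<in> sets borel"
  shows "(\<lambda>x. g x \<inter> S) \<in> measurable N configs" "(\<lambda>x. g x - S) \<in> measurable N configs"
proof -
  have P: "Measurable.pred (N \<Otimes>\<^sub>M borel) (\<lambda>(x, y). y \<in> S)" "Measurable.pred (N \<Otimes>\<^sub>M borel) (\<lambda>(x, y). y \<notin> S)"
    by measurable
  show "(\<lambda>x. g x \<inter> S) \<in> measurable N configs" "(\<lambda>x. g x - S) \<in> measurable N configs"
    using measurable_config_filter[OF g P(1)] measurable_config_filter[OF g P(2)]
    by (simp_all add: Int_def set_diff_eq)
qed

lemma resampling_set_borel [measurable]: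
  assumes "finite X"
  shows "resampling_set r X \<in> sets borel"
proof -
  have "finite (bad_points r X)" using assms by (simp add: bad_points_eq)
  then show ?thesis unfolding resampling_set_def
    by (intro sets.Int sets.finite_UN) auto
qed

section \<open>Poisson processes: uniqueness and independence\<close>

text \<open>Events about a single count generate \<open>configs\<close> but are not closed under
  intersection; finitely many counts at once give a \<pi>-system. Only the first \<open>k\<close>
  entries of the sequences \<open>A\<close> and \<open>n\<close> matter.\<close>

definition config_events :: "(real ^ 2) set set set"
  where "config_events = {{X\<in>space configs. \<forall>i<k. card (X \<inter> A i) = n i} | (k::nat) A n.
    range A \<subseteq> sets borel}"

lemma config_eventI:
  assumes "\<And>i. A i \<in> sets borel"
  shows "{X\<in>space configs. \<forall>i<(k::nat). card (X \<inter> A i) = n i} \<in> config_events"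
  using assms unfolding config_events_def by blast

lemma config_eventE:
  assumes "G \<in> config_events"
  obtains A and k :: nat and n where "\<And>i. A i \<in> sets borel"
    "G = {X\<in>space configs. \<forall>i<k. card (X \<inter> A i) = n i}"
  using assms unfolding config_events_def by blast

lemma config_events_sets: "config_events \<subseteq> sets configs"
proof
  fix G assume "G \<in> config_events"
  then obtain A and k :: nat and n where A: "\<And>i. A i \<in> sets borel"
    and G: "G = {X\<in>space configs. \<forall>i<k. card (X \<inter> A i) = n i}" by (rule config_eventE) (rule that)
  have [measurable]: "(\<lambda>X. card (X \<inter> A i)) \<in> measurable configs (count_space UNIV)" for i
    by (rule measurable_card_Int[OF A])
  show "G \<in> sets configs" unfolding G by measurable
qed

lemma config_events_Pow: "config_events \<subseteq> Pow (space configs)"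
  using config_events_sets sets.sets_into_space[of _ configs] by blast

lemma space_configs_event: "space configs \<in> config_events"
  using config_eventI[of "\<lambda>_. {}" 0] by simp

lemma Int_stable_config_events: "Int_stable config_events"
proof (rule Int_stableI)
  fix G H assume "G \<in> config_events" "H \<in> config_events"
  obtain A and k :: nat and n where A: "\<And>i. A i \<in> sets borel"
    and G: "G = {X\<in>space configs. \<forall>i<k. card (X \<inter> A i) = n i}"
    by (rule config_eventE[OF \<open>G \<in> config_events\<close>]) (rule that)
  obtain B and l :: nat and m where B: "\<And>i. B i \<in> sets borel"
    and H: "H = {X\<in>space configs. \<forall>i<l. card (X \<inter> B i) = m i}"
    by (rule config_eventE[OF \<open>H \<in> config_events\<close>]) (rule that)
  let ?A = "\<lambda>i. if i < k then A i else B (i - k)" and ?n = "\<lambda>i. if i < k then n i else m (i - k)"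
  have "G \<inter> H = {X\<in>space configs. \<forall>i<k + l. card (X \<inter> ?A i) = ?n i}"
  proof (intro set_eqI iffI)
    fix X assume X: "X \<in> {X\<in>space configs. \<forall>i<k + l. card (X \<inter> ?A i) = ?n i}"
    then have *: "i < k + l \<Longrightarrow> card (X \<inter> ?A i) = ?n i" for i by blast
    have "card (X \<inter> A i) = n i" if "i < k" for i using *[of i] that by simp
    moreover have "card (X \<inter> B i) = m i" if "i < l" for i using *[of "k + i"] that by simp
    ultimately show "X \<in> G \<inter> H" using X by (auto simp: G H)
  qed (auto simp: G H)
  also have "\<dots> \<in> config_events" using A B by (intro config_eventI) auto
  finally show "G \<inter> H \<in> config_events" .
qed

lemma sets_configs_eq: "sets configs = sigma_sets (space configs) config_events"
proof
  have "sets configs = sigma_sets (space configs)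
      {{X. finite X \<and> X \<subseteq> unit_square \<and> card (X \<inter> A) = n} |A n. A \<in> sets borel}"
    unfolding space_configs by (subst configs_def, rule sets_measure_of) auto
  also have "\<dots> \<subseteq> sigma_sets (space configs) config_events"
  proof (rule sigma_sets_mono, clarify)
    fix A :: "(real ^ 2) set" and n assume "A \<in> sets borel"
    then have "{X\<in>space configs. \<forall>i<Suc 0. card (X \<inter> A) = n} \<in> config_events"
      by (intro config_eventI)
    then show "{X. finite X \<and> X \<subseteq> unit_square \<and> card (X \<inter> A) = n}
        \<in> sigma_sets (space configs) config_events"
      by (intro sigma_sets.Basic) (simp add: space_configs conj_assoc)
  qed
  finally show "sets configs \<subseteq> sigma_sets (space configs) config_events" .
  show "sigma_sets (space configs) config_events \<subseteq> sets configs"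
    by (intro sets.sigma_sets_subset config_events_sets)
qed

text \<open>\<open>D\<close> lists the atoms of the Boolean algebra generated by the first
  \<open>k\<close> sets: \<open>D m\<close> consists of the points whose set of indices has the
  binary code \<open>m\<close>. Atoms are needed because \<open>poisson_process\<close> speaks of
  joint counts only for disjoint sets; the count of an overlapping set is a sum of counts of
  atoms.\<close>

lemma finite_family_atoms:
  fixes A :: "nat \<Rightarrow> 'a :: topological_space set"
  assumes "\<And>i. A i \<in> sets borel"
  obtains D :: "nat \<Rightarrow> 'a set" and I where "\<And>m. D m \<in> sets borel" "disjoint_family D"
    "\<And>i. i < k \<Longrightarrow> finite (I i)" "\<And>i. i < k \<Longrightarrow> A i = (\<Union>m\<in>I i. D m)"
proof
  note [measurable] = assms
  let ?D = "\<lambda>m. {x. {i. i < k \<and> x \<in> A i} = set_decode m}"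
  have "?D m = {x\<in>space borel. \<forall>i. (i < k \<and> x \<in> A i) \<longleftrightarrow> i \<in> set_decode m}" for m
    by auto
  also have "\<dots> m \<in> sets borel" for m by measurable
  finally show "?D m \<in> sets borel" for m .
  show "disjoint_family ?D"
  proof (unfold disjoint_family_on_def, safe)
    fix m n x assume "m \<noteq> n" "{i. i < k \<and> x \<in> A i} = set_decode m" "{i. i < k \<and> x \<in> A i} = set_decode n"
    then have "set_encode (set_decode m) = set_encode (set_decode n)" by simp
    then show "x \<in> {}" using \<open>m \<noteq> n\<close> by simp
  qed
  let ?I = "\<lambda>i. set_encode ` {J. J \<subseteq> {..<k} \<and> i \<in> J}"
  show "finite (?I i)" if "i < k" for i
    by (intro finite_imageI finite_subset[of "{J. J \<subseteq> {..<k} \<and> i \<in> J}" "Pow {..<k}"]) auto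
  show "A i = (\<Union>m\<in>?I i. ?D m)" if "i < k" for i
  proof (intro set_eqI iffI)
    fix x assume "x \<in> A i"
    then have "{i. i < k \<and> x \<in> A i} \<in> {J. J \<subseteq> {..<k} \<and> i \<in> J}" using that by auto
    moreover have "x \<in> ?D (set_encode {i. i < k \<and> x \<in> A i})"
      by (simp add: set_encode_inverse)
    ultimately show "x \<in> (\<Union>m\<in>?I i. ?D m)" by blast
  next
    fix x assume "x \<in> (\<Union>m\<in>?I i. ?D m)"
    then obtain J where "J \<subseteq> {..<k}" "i \<in> J" "{i. i < k \<and> x \<in> A i} = set_decode (set_encode J)"
      by auto
    moreover from this(1) have "finite J" by (rule finite_subset) simp
    ultimately show "x \<in> A i" by (simp add: set_encode_inverse) blast
  qed
qed

lemma measurable_card_family: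
  assumes "\<And>i. A i \<in> sets borel"
  shows "(\<lambda>X i. card (X \<inter> A i)) \<in> measurable configs (\<Pi>\<^sub>M i\<in>UNIV. count_space UNIV)"
  by (rule measurable_PiM_single'[OF measurable_card_Int[OF assms]]) simp

lemma card_Int_UN:
  assumes "finite X" "disjoint_family D" "finite I"
  shows "card (X \<inter> (\<Union>m\<in>I. D m)) = (\<Sum>m\<in>I. card (X \<inter> D m))"
  unfolding Int_UN_distrib
  using assms by (intro card_UN_disjoint) (auto simp: disjoint_family_on_def)

context
  fixes c :: real and S :: "(real ^ 2) set" and \<mu> :: "(real ^ 2) set measure"
  assumes poisson: "poisson_process c S \<mu>"
begin

lemma poisson_process_prob_space: "prob_space \<mu>"
  using poisson by (simp add: poisson_process_def)

lemma poisson_process_sets: "sets \<mu> = sets configs"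
  using poisson by (simp add: poisson_process_def)

lemma poisson_process_space: "space \<mu> = space configs"
  by (rule sets_eq_imp_space_eq[OF poisson_process_sets])

lemma poisson_process_measurable_cong: "measurable \<mu> M = measurable configs M"
  by (rule measurable_cong_sets[OF poisson_process_sets refl])

lemma poisson_process_counts:
  assumes D: "\<And>m. D m \<in> sets borel" "disjoint_family D"
  shows "prob_space.indep_vars \<mu> (\<lambda>_. count_space UNIV) (\<lambda>i X. card (X \<inter> D i)) (UNIV :: nat set)"
    and "distr \<mu> (\<Pi>\<^sub>M i\<in>UNIV. count_space UNIV) (\<lambda>X i. card (X \<inter> D i))
      = (\<Pi>\<^sub>M i\<in>UNIV. measure_pmf (poisson_distribution (c * measure lborel (D i \<inter> S))))"
proof -
  interpret prob_space \<mu> by (rule poisson_process_prob_space)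
  show ind: "indep_vars (\<lambda>_. count_space UNIV) (\<lambda>i X. card (X \<inter> D i)) (UNIV :: nat set)"
    using poisson D by (auto simp: poisson_process_def image_subset_iff)
  have "distr \<mu> (\<Pi>\<^sub>M i\<in>UNIV. count_space UNIV) (\<lambda>X. \<lambda>i\<in>UNIV. card (X \<inter> D i))
      = (\<Pi>\<^sub>M i\<in>UNIV. distr \<mu> (count_space UNIV) (\<lambda>X. card (X \<inter> D i)))"
    using ind by (subst (asm) indep_vars_iff_distr_eq_PiM)
      (auto simp: poisson_process_measurable_cong intro: measurable_card_Int D)
  moreover have "distr \<mu> (count_space UNIV) (\<lambda>X. card (X \<inter> D i))
      = measure_pmf (poisson_distribution (c * measure lborel (D i \<inter> S)))" for i
    using poisson D by (auto simp: poisson_process_def)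
  ultimately show "distr \<mu> (\<Pi>\<^sub>M i\<in>UNIV. count_space UNIV) (\<lambda>X i. card (X \<inter> D i))
      = (\<Pi>\<^sub>M i\<in>UNIV. measure_pmf (poisson_distribution (c * measure lborel (D i \<inter> S))))"
    by (simp only: restrict_UNIV)
qed

end

text \<open>After passing to atoms, an event in \<open>config_events\<close> concerns counts of
  disjoint sets, whose joint law is a prescribed product of Poisson laws. In this way a resampling
  kernel that is given only by the predicate can be identified with a concrete law.\<close>

lemma poisson_process_unique:
  assumes \<mu>: "poisson_process c S \<mu>" and \<nu>: "poisson_process c S \<nu>"
  shows "\<mu> = \<nu>"
proof (rule measure_eqI_generator_eq[OF Int_stable_config_events, where \<Omega>="space configs"
      and A="\<lambda>_. space configs"])
  show "config_events \<subseteq> Pow (space configs)"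
    using config_events_sets sets.sets_into_space by auto
  show "sets \<mu> = sigma_sets (space configs) config_events" "sets \<nu> = sigma_sets (space configs) config_events"
    using poisson_process_sets[OF \<mu>] poisson_process_sets[OF \<nu>] sets_configs_eq by simp_all
  show "range (\<lambda>_. space configs) \<subseteq> config_events" using space_configs_event by auto
  interpret prob_space \<mu> by (rule poisson_process_prob_space[OF \<mu>])
  show "emeasure \<mu> (space configs) \<noteq> \<infinity>" by simp
  fix G assume "G \<in> config_events"
  then obtain A and k :: nat and n where A: "\<And>i. A i \<in> sets borel"
    and G: "G = {X\<in>space configs. \<forall>i<k. card (X \<inter> A i) = n i}" by (rule config_eventE) (rule that)
  obtain D :: "nat \<Rightarrow> (real ^ 2) set" and I where D: "\<And>m. D m \<in> sets borel" "disjoint_family D"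
    and I: "\<And>i. i < k \<Longrightarrow> finite (I i)" "\<And>i. i < k \<Longrightarrow> A i = (\<Union>m\<in>I i. D m)"
    by (rule finite_family_atoms[OF A, of k]) (rule that)
  let ?P = "\<Pi>\<^sub>M i\<in>(UNIV :: nat set). count_space (UNIV :: nat set)"
  let ?E = "{v\<in>space ?P. \<forall>i<k. (\<Sum>m\<in>I i. v m) = n i}"
  have E: "?E \<in> sets ?P" by measurable
  have *: "emeasure \<rho> G = emeasure (distr \<rho> ?P (\<lambda>X i. card (X \<inter> D i))) ?E"
    if \<rho>: "poisson_process c S \<rho>" for \<rho>
  proof (subst emeasure_distr[OF _ E])
    show "(\<lambda>X i. card (X \<inter> D i)) \<in> measurable \<rho> ?P"
      unfolding poisson_process_measurable_cong[OF \<rho>] by (rule measurable_card_family[OF D(1)])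
    have "(\<lambda>X i. card (X \<inter> D i)) -` ?E \<inter> space \<rho> = G"
      using I card_Int_UN[OF _ D(2)]
      by (auto simp: G poisson_process_space[OF \<rho>] space_PiM space_configs)
    then show "emeasure \<rho> G = emeasure \<rho> ((\<lambda>X i. card (X \<inter> D i)) -` ?E \<inter> space \<rho>)" by simp
  qed
  show "emeasure \<mu> G = emeasure \<nu> G"
    by (simp only: *[OF \<mu>] *[OF \<nu>] poisson_process_counts(2)[OF \<mu> D] poisson_process_counts(2)[OF \<nu> D])
qed auto

text \<open>Counting \<open>X \<inter> T\<close> in \<open>A\<close> is counting \<open>X\<close> in
  \<open>A \<inter> T\<close>. This produces every fresh sample from one process on the whole
  square.\<close>

lemma poisson_process_restrict:
  assumes \<mu>: "poisson_process c S \<mu>" and T[measurable]: "T \<in> sets borel"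
  shows "poisson_process c (S \<inter> T) (distr \<mu> configs (\<lambda>X. X \<inter> T))"
  unfolding poisson_process_def
proof (intro conjI allI ballI impI)
  interpret prob_space \<mu> by (rule poisson_process_prob_space[OF \<mu>])
  have m: "(\<lambda>X. X \<inter> T) \<in> measurable \<mu> configs"
    by (simp add: poisson_process_measurable_cong[OF \<mu>] measurable_config_fixed(1)[OF measurable_ident_sets])
  show "prob_space (distr \<mu> configs (\<lambda>X. X \<inter> T))" by (rule prob_space_distr[OF m])
  show "sets (distr \<mu> configs (\<lambda>X. X \<inter> T)) = sets configs" by simp
  {
    fix A :: "(real ^ 2) set" assume A: "A \<in> sets borel"
    have "distr (distr \<mu> configs (\<lambda>X. X \<inter> T)) (count_space UNIV) (\<lambda>X. card (X \<inter> A))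
      = distr \<mu> (count_space UNIV) (\<lambda>X. card (X \<inter> (A \<inter> T)))"
      by (subst distr_distr[OF measurable_card_Int[OF A] m]) (simp add: comp_def Int_ac)
    also have "\<dots> = measure_pmf (poisson_distribution (c * measure lborel (A \<inter> T \<inter> S)))"
      using \<mu> A by (simp add: poisson_process_def)
    finally show "distr (distr \<mu> configs (\<lambda>X. X \<inter> T)) (count_space UNIV) (\<lambda>X. card (X \<inter> A))
      = measure_pmf (poisson_distribution (c * measure lborel (A \<inter> (S \<inter> T))))" by (simp add: Int_ac)
  }
  fix A :: "nat \<Rightarrow> (real ^ 2) set" assume A: "range A \<subseteq> sets borel \<and> disjoint_family A"
  then have A': "A i \<in> sets borel" for i by auto
  interpret D: prob_space "distr \<mu> configs (\<lambda>X. X \<inter> T)" by (rule prob_space_distr[OF m])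
  have "distr (distr \<mu> configs (\<lambda>X. X \<inter> T)) (\<Pi>\<^sub>M i\<in>UNIV. count_space UNIV) (\<lambda>X. \<lambda>i\<in>UNIV. card (X \<inter> A i))
    = (\<Pi>\<^sub>M i\<in>UNIV. distr (distr \<mu> configs (\<lambda>X. X \<inter> T)) (count_space UNIV) (\<lambda>X. card (X \<inter> A i)))"
  proof -
    have "(\<lambda>X i. card (X \<inter> A i)) \<in> measurable configs (\<Pi>\<^sub>M i\<in>UNIV. count_space UNIV)"
      by (rule measurable_card_family[OF A'])
    then have "distr (distr \<mu> configs (\<lambda>X. X \<inter> T)) (\<Pi>\<^sub>M i\<in>UNIV. count_space UNIV) (\<lambda>X i. card (X \<inter> A i))
        = distr \<mu> (\<Pi>\<^sub>M i\<in>UNIV. count_space UNIV) (\<lambda>X i. card (X \<inter> (A i \<inter> T)))"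
      by (subst distr_distr[OF _ m]) (simp_all add: comp_def Int_ac)
    also have "\<dots> = (\<Pi>\<^sub>M i\<in>UNIV. measure_pmf (poisson_distribution (c * measure lborel (A i \<inter> T \<inter> S))))"
      by (rule poisson_process_counts(2)[OF \<mu>]) (use A in \<open>auto simp: disjoint_family_on_def\<close>)
    also have "\<dots> = (\<Pi>\<^sub>M i\<in>UNIV. distr (distr \<mu> configs (\<lambda>X. X \<inter> T)) (count_space UNIV) (\<lambda>X. card (X \<inter> A i)))"
    proof (rule PiM_cong[OF refl])
      fix i
      have "distr (distr \<mu> configs (\<lambda>X. X \<inter> T)) (count_space UNIV) (\<lambda>X. card (X \<inter> A i))
        = distr \<mu> (count_space UNIV) (\<lambda>X. card (X \<inter> (A i \<inter> T)))"
        by (subst distr_distr[OF measurable_card_Int[OF A'] m]) (simp add: comp_def Int_ac)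
      also have "\<dots> = measure_pmf (poisson_distribution (c * measure lborel (A i \<inter> T \<inter> S)))"
        using \<mu> A' by (simp add: poisson_process_def)
      finally show "measure_pmf (poisson_distribution (c * measure lborel (A i \<inter> T \<inter> S)))
         = distr (distr \<mu> configs (\<lambda>X. X \<inter> T)) (count_space UNIV) (\<lambda>X. card (X \<inter> A i))" ..
    qed
    finally show ?thesis by (simp only: restrict_UNIV)
  qed
  then show "D.indep_vars (\<lambda>_. count_space UNIV) (\<lambda>i X. card (X \<inter> A i)) UNIV"
    by (subst D.indep_vars_iff_distr_eq_PiM) (auto intro: measurable_card_Int A')
qed

text \<open>Independence is given only for the counts of one disjoint sequence. Atoms cut to
  \<open>T\<close> are put at its even positions and atoms with \<open>T\<close> removed at its odd
  positions, so that the two parts of the configuration depend on disjoint blocks of independent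
  coordinates.\<close>

lemma poisson_process_indep_Int_Diff:
  assumes \<mu>: "poisson_process c S \<mu>" and T[measurable]: "T \<in> sets borel"
  shows "prob_space.indep_var \<mu> configs (\<lambda>X. X \<inter> T) configs (\<lambda>X. X - T)"
proof -
  interpret prob_space \<mu> by (rule poisson_process_prob_space[OF \<mu>])
  have m: "(\<lambda>X. X \<inter> T) \<in> measurable \<mu> configs" "(\<lambda>X. X - T) \<in> measurable \<mu> configs"
    by (simp_all add: poisson_process_measurable_cong[OF \<mu>] measurable_config_fixed[OF measurable_ident_sets])
  have main: "prob ((\<lambda>X. X \<inter> T) -` G \<inter> space \<mu> \<inter> ((\<lambda>X. X - T) -` H \<inter> space \<mu>))
      = prob ((\<lambda>X. X \<inter> T) -` G \<inter> space \<mu>) * prob ((\<lambda>X. X - T) -` H \<inter> space \<mu>)"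
    if GH: "G \<in> config_events" "H \<in> config_events" for G H
  proof -
    obtain A and k :: nat and n where A: "\<And>i. A i \<in> sets borel"
      and G: "G = {X\<in>space configs. \<forall>i<k. card (X \<inter> A i) = n i}"
      by (rule config_eventE[OF GH(1)]) (rule that)
    obtain B and l :: nat and m where B: "\<And>i. B i \<in> sets borel"
      and H: "H = {X\<in>space configs. \<forall>i<l. card (X \<inter> B i) = m i}"
      by (rule config_eventE[OF GH(2)]) (rule that)
    obtain D :: "nat \<Rightarrow> (real ^ 2) set" and I where D: "\<And>m. D m \<in> sets borel" "disjoint_family D"
      and I: "\<And>i. i < k \<Longrightarrow> finite (I i)" "\<And>i. i < k \<Longrightarrow> A i = (\<Union>m\<in>I i. D m)"
      by (rule finite_family_atoms[OF A, of k]) (rule that)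
    obtain D' :: "nat \<Rightarrow> (real ^ 2) set" and I' where D': "\<And>m. D' m \<in> sets borel" "disjoint_family D'"
      and I': "\<And>i. i < l \<Longrightarrow> finite (I' i)" "\<And>i. i < l \<Longrightarrow> B i = (\<Union>m\<in>I' i. D' m)"
      by (rule finite_family_atoms[OF B, of l]) (rule that)
    define E where "E = (\<lambda>i. if even i then D (i div 2) \<inter> T else D' (i div 2) - T)"
    have E: "E i \<in> sets borel" for i using D(1) D'(1) T by (auto simp: E_def)
    have "E i \<inter> E j = {}" if "i \<noteq> j" for i j
    proof (cases "even i = even j")
      case True
      then have "i div 2 \<noteq> j div 2" using that by presburger
      then show ?thesis using True D(2) D'(2) by (auto simp: E_def disjoint_family_on_def) blast+
    qed (auto simp: E_def)
    then have E': "disjoint_family E" by (auto simp: disjoint_family_on_def)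
    let ?ev = "Collect even :: nat set" and ?od = "Collect odd :: nat set"
    let ?P = "\<lambda>J. \<Pi>\<^sub>M i\<in>J. count_space (UNIV :: nat set)"
    let ?f = "\<lambda>J X. restrict (\<lambda>i. card (X \<inter> E i)) J"
    let ?U = "{v\<in>space (?P ?ev). \<forall>i<k. (\<Sum>m\<in>I i. v (2 * m)) = n i}"
    let ?V = "{v\<in>space (?P ?od). \<forall>i<l. (\<Sum>m\<in>I' i. v (2 * m + 1)) = m i}"
    have ind: "indep_var (?P ?ev) (?f ?ev) (?P ?od) (?f ?od)"
      by (rule indep_var_restrict[OF poisson_process_counts(1)[OF \<mu> E E']]) auto
    have [measurable]: "(\<lambda>v. v (2 * i)) \<in> measurable (?P ?ev) (count_space UNIV)"
       "(\<lambda>v. v (2 * i + 1)) \<in> measurable (?P ?od) (count_space UNIV)" for i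
      by (auto intro: measurable_component_singleton)
    have "?U \<in> sets (?P ?ev)" "?V \<in> sets (?P ?od)" by measurable
    note prod = indep_varD[OF ind this]
    have XT: "X \<inter> T \<inter> (\<Union>m\<in>J. D m) = X \<inter> (\<Union>m\<in>J. E (2 * m))"
      "(X - T) \<inter> (\<Union>m\<in>J. D' m) = X \<inter> (\<Union>m\<in>J. E (2 * m + 1))" for X J
      by (auto simp: E_def)
    have inj: "disjoint_family (\<lambda>m. E (2 * m))" "disjoint_family (\<lambda>m. E (2 * m + 1))"
      using E' by (auto simp: disjoint_family_on_def)
    have U: "?f ?ev -` ?U \<inter> space \<mu> = (\<lambda>X. X \<inter> T) -` G \<inter> space \<mu>"
      using I card_Int_UN[OF _ inj(1)]
      by (auto simp: G poisson_process_space[OF \<mu>] space_PiM space_configs XT)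
    have V: "?f ?od -` ?V \<inter> space \<mu> = (\<lambda>X. X - T) -` H \<inter> space \<mu>"
      using I' card_Int_UN[OF _ inj(2)]
      by (auto simp: H poisson_process_space[OF \<mu>] space_PiM space_configs XT)
    have "(\<lambda>X. (?f ?ev X, ?f ?od X)) -` (?U \<times> ?V) \<inter> space \<mu>
       = (?f ?ev -` ?U \<inter> space \<mu>) \<inter> (?f ?od -` ?V \<inter> space \<mu>)" by auto
    with prod show ?thesis by (simp only: U V)
  qed
  show ?thesis
    unfolding indep_var_def
  proof (subst indep_vars_finite[where E="\<lambda>_. config_events"])
    show "\<forall>A\<in>UNIV \<rightarrow> config_events. prob (\<Inter>j. case_bool (\<lambda>X. X \<inter> T) (\<lambda>X. X - T) j -` A j \<inter> space \<mu>)
      = (\<Prod>j\<in>UNIV. prob (case_bool (\<lambda>X. X \<inter> T) (\<lambda>X. X - T) j -` A j \<inter> space \<mu>))"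
    proof
      fix A :: "bool \<Rightarrow> (real ^ 2) set set" assume "A \<in> UNIV \<rightarrow> config_events"
      then have "A True \<in> config_events" "A False \<in> config_events" by auto
      from main[OF this] show "prob (\<Inter>j. case_bool (\<lambda>X. X \<inter> T) (\<lambda>X. X - T) j -` A j \<inter> space \<mu>)
        = (\<Prod>j\<in>UNIV. prob (case_bool (\<lambda>X. X \<inter> T) (\<lambda>X. X - T) j -` A j \<inter> space \<mu>))"
        by (simp add: UNIV_bool Int_commute mult.commute)
    qed
    have "sets (case_bool configs configs i) = sets configs"
      "space (case_bool configs configs i) = space configs" for i
      by (simp_all split: bool.split)
    then show "sets (case_bool configs configs i)
        = sigma_sets (space (case_bool configs configs i)) config_events"
       "space (case_bool configs configs i) \<in> config_events"
       "config_events \<subseteq> Pow (space (case_bool configs configs i))" for i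
      using sets_configs_eq space_configs_event config_events_Pow by simp_all
  qed (use m in \<open>auto simp: Int_stable_config_events split: bool.split\<close>)
qed

text \<open>Independence of \<open>X \<inter> T\<close> and \<open>X - T\<close> in integrated form:
  the two parts may be taken from independent copies \<open>Y\<close> and \<open>X\<close> of the
  process. Later factorizations of integrals rest on it.\<close>

lemma nn_integral_poisson_process_split:
  fixes g :: "(real ^ 2) set \<times> (real ^ 2) set \<Rightarrow> ennreal"
  assumes \<mu>: "poisson_process c S \<mu>" and T: "T \<in> sets borel"
    and g: "g \<in> borel_measurable (configs \<Otimes>\<^sub>M configs)"
  shows "(\<integral>\<^sup>+X. g (X \<inter> T, X - T) \<partial>\<mu>) = (\<integral>\<^sup>+Y. \<integral>\<^sup>+X. g (Y \<inter> T, X - T) \<partial>\<mu> \<partial>\<mu>)"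
proof -
  interpret prob_space \<mu> by (rule poisson_process_prob_space[OF \<mu>])
  have m: "(\<lambda>X. X \<inter> T) \<in> measurable \<mu> configs" "(\<lambda>X. X - T) \<in> measurable \<mu> configs"
    using T by (simp_all add: poisson_process_measurable_cong[OF \<mu>] measurable_config_fixed[OF measurable_ident_sets])
  have "distr \<mu> (configs \<Otimes>\<^sub>M configs) (\<lambda>X. (X \<inter> T, X - T))
      = distr \<mu> configs (\<lambda>X. X \<inter> T) \<Otimes>\<^sub>M distr \<mu> configs (\<lambda>X. X - T)"
    using poisson_process_indep_Int_Diff[OF \<mu> T] by (simp add: indep_var_distribution_eq)
  moreover have "(\<integral>\<^sup>+X. g (X \<inter> T, X - T) \<partial>\<mu>)
      = (\<integral>\<^sup>+p. g p \<partial>distr \<mu> (configs \<Otimes>\<^sub>M configs) (\<lambda>X. (X \<inter> T, X - T)))"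
    by (subst nn_integral_distr) (use m g in auto)
  ultimately have "(\<integral>\<^sup>+X. g (X \<inter> T, X - T) \<partial>\<mu>)
      = (\<integral>\<^sup>+p. g p \<partial>(distr \<mu> configs (\<lambda>X. X \<inter> T) \<Otimes>\<^sub>M distr \<mu> configs (\<lambda>X. X - T)))"
    by simp
  also have "\<dots> = (\<integral>\<^sup>+Y. \<integral>\<^sup>+X. g (Y, X) \<partial>distr \<mu> configs (\<lambda>X. X - T) \<partial>distr \<mu> configs (\<lambda>X. X \<inter> T))"
  proof (rule sigma_finite_measure.nn_integral_fst[symmetric])
    show "sigma_finite_measure (distr \<mu> configs (\<lambda>X. X - T))"
      using prob_space_distr[OF m(2)] prob_space_imp_sigma_finite by blast
    show "g \<in> borel_measurable (distr \<mu> configs (\<lambda>X. X \<inter> T) \<Otimes>\<^sub>M distr \<mu> configs (\<lambda>X. X - T))"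
      using g by (simp cong: measurable_cong_sets)
  qed
  also have "\<dots> = (\<integral>\<^sup>+Y. \<integral>\<^sup>+X. g (Y, X - T) \<partial>\<mu> \<partial>distr \<mu> configs (\<lambda>X. X \<inter> T))"
    by (intro nn_integral_cong nn_integral_distr) (use m g in auto)
  also have "\<dots> = (\<integral>\<^sup>+Y. \<integral>\<^sup>+X. g (Y \<inter> T, X - T) \<partial>\<mu> \<partial>\<mu>)"
  proof (rule nn_integral_distr[OF m(1)])
    have "(\<lambda>p. g (fst p, snd p - T)) \<in> borel_measurable (configs \<Otimes>\<^sub>M \<mu>)"
      using g m by measurable
    then show "(\<lambda>Y. \<integral>\<^sup>+X. g (Y, X - T) \<partial>\<mu>) \<in> borel_measurable (distr \<mu> configs (\<lambda>X. X \<inter> T))"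
      using borel_measurable_nn_integral_fst by simp
  qed
  finally show ?thesis .
qed

section \<open>The Mecke equation\<close>

lemma pmf_poisson_distribution:
  assumes "0 \<le> m"
  shows "pmf (poisson_distribution m) k = m ^ k / fact k * exp (- m)"
  using assms by (auto simp: poisson_distribution_def power_0_left)

text \<open>The one-dimensional case of the Mecke equation: biasing a Poisson variable by its size
  shifts it by one.\<close>

lemma pmf_poisson_distribution_Suc:
  assumes "0 \<le> m"
  shows "pmf (poisson_distribution m) (Suc k) * real (Suc k) = m * pmf (poisson_distribution m) k"
proof -
  have "m ^ Suc k / fact (Suc k) * exp (- m) * real (Suc k)
      = m * m ^ k / (real (Suc k) * fact k) * exp (- m) * real (Suc k)"
    by (simp only: power_Suc fact_Suc)
  also have "\<dots> = m * (m ^ k / fact k * exp (- m))"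
    by (simp del: of_nat_Suc)
  finally show ?thesis using assms by (simp only: pmf_poisson_distribution)
qed

locale poisson_square =
  fixes c :: real and N :: "(real ^ 2) set measure"
  assumes c_pos: "0 < c" and poisson: "poisson_process c unit_square N"
begin

sublocale prob_space N
  by (rule poisson_process_prob_space[OF poisson])

lemma sets_N [measurable_cong]: "sets N = sets configs"
  by (rule poisson_process_sets[OF poisson])

lemma space_N: "space N = space configs"
  by (rule poisson_process_space[OF poisson])

lemma space_N_D:
  assumes "X \<in> space N" shows "finite X" "X \<subseteq> unit_square"
  using assms by (auto simp: space_N space_configs)

definition area :: "(real ^ 2) set \<Rightarrow> real"
  where "area A = measure lborel (A \<inter> unit_square)"

lemma area_nonneg: "0 \<le> area A" by (simp add: area_def)

lemma emeasure_area:
  assumes "A \<in> sets borel"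
  shows "emeasure lborel (A \<inter> unit_square) = ennreal (area A)"
proof -
  have "emeasure lborel (A \<inter> unit_square) \<le> emeasure lborel unit_square"
    using assms by (intro emeasure_mono) auto
  also have "\<dots> < \<infinity>" by (rule emeasure_lborel_cbox_finite)
  finally have "emeasure lborel (A \<inter> unit_square) < \<infinity>" .
  then show ?thesis unfolding area_def by (intro emeasure_eq_ennreal_measure) auto
qed

lemma nn_integral_card:
  fixes \<phi> :: "nat \<Rightarrow> ennreal"
  assumes A: "A \<in> sets borel"
  shows "(\<integral>\<^sup>+X. \<phi> (card (X \<inter> A)) \<partial>N) = (\<Sum>j. ennreal (pmf (poisson_distribution (c * area A)) j) * \<phi> j)"
proof -
  have "(\<integral>\<^sup>+X. \<phi> (card (X \<inter> A)) \<partial>N) = (\<integral>\<^sup>+j. \<phi> j \<partial>distr N (count_space UNIV) (\<lambda>X. card (X \<inter> A)))"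
    by (subst nn_integral_distr)
      (auto simp: poisson_process_measurable_cong[OF poisson] intro: measurable_card_Int A)
  also have "distr N (count_space UNIV) (\<lambda>X. card (X \<inter> A)) = measure_pmf (poisson_distribution (c * area A))"
    using poisson A by (simp add: poisson_process_def area_def)
  also have "(\<integral>\<^sup>+j. \<phi> j \<partial>measure_pmf (poisson_distribution (c * area A)))
      = (\<integral>\<^sup>+j. ennreal (pmf (poisson_distribution (c * area A)) j) * \<phi> j \<partial>count_space UNIV)"
    by (subst measure_pmf_eq_density, subst nn_integral_density) auto
  finally show ?thesis by (simp add: nn_integral_count_space_nat)
qed

lemma void_probability:
  assumes A[measurable]: "A \<in> sets borel"
  shows "emeasure N {X\<in>space N. X \<inter> A = {}} = ennreal (exp (- (c * area A)))"
proof -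
  note [measurable] = measurable_card_Int[OF A]
  have "{X\<in>space N. X \<inter> A = {}} = {X\<in>space N. card (X \<inter> A) = 0}"
    using space_N_D by (auto simp: card_eq_0_iff)
  then have "emeasure N {X\<in>space N. X \<inter> A = {}} = (\<integral>\<^sup>+X. indicator {X\<in>space N. card (X \<inter> A) = 0} X \<partial>N)"
    by (subst nn_integral_indicator) auto
  also have "\<dots> = (\<integral>\<^sup>+X. indicator {0} (card (X \<inter> A)) \<partial>N)"
    by (intro nn_integral_cong) (auto simp: indicator_def)
  also have "\<dots> = (\<Sum>j. ennreal (pmf (poisson_distribution (c * area A)) j) * indicator {0} j)"
    by (rule nn_integral_card[OF A])
  also have "\<dots> = (\<Sum>j\<in>{0}. ennreal (pmf (poisson_distribution (c * area A)) j) * indicator {0} j)"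
    by (rule suminf_finite) auto
  finally show ?thesis
    using c_pos by (simp add: pmf_poisson_distribution area_nonneg)
qed

text \<open>Since \<open>B\<close> lies inside or outside each \<open>A i\<close>, removing a point
  of \<open>B\<close> changes the counts in a known way: the event for \<open>X - {x}\<close>
  depends only on the number of points in \<open>B\<close>, lowered by one, and on the independent
  part \<open>X - B\<close>. The recursion for the Poisson weights then absorbs the shift.\<close>

lemma mecke_basic:
  fixes A :: "nat \<Rightarrow> (real ^ 2) set" and n :: "nat \<Rightarrow> nat"
  assumes B[measurable]: "B \<in> sets borel" and A: "\<And>i. A i \<in> sets borel"
    and AB: "\<And>i. i < k \<Longrightarrow> B \<subseteq> A i \<or> B \<inter> A i = {}"
  defines "G \<equiv> {X\<in>space configs. \<forall>i<k. card (X \<inter> A i) = n i}"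
  shows "(\<integral>\<^sup>+X. (\<Sum>x\<in>X. indicator B x * indicator G (X - {x})) \<partial>N)
    = ennreal (c * area B) * emeasure N G"
proof -
  have mA[measurable]: "(\<lambda>X. card (X \<inter> A i)) \<in> measurable configs (count_space UNIV)" for i
    by (rule measurable_card_Int[OF A])
  have mB[measurable]: "(\<lambda>X. card (X \<inter> B)) \<in> measurable configs (count_space UNIV)"
    by (rule measurable_card_Int[OF B])
  define \<epsilon> where "\<epsilon> i = (if B \<subseteq> A i then 1 else 0 :: nat)" for i
  \<comment> \<open>\<open>h j W\<close> tells whether \<open>G\<close> holds for \<open>j\<close>
    points in \<open>B\<close> together with \<open>W\<close> outside \<open>B\<close>.\<close>
  define h :: "nat \<Rightarrow> (real ^ 2) set \<Rightarrow> ennreal"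
    where "h j W = of_bool (\<forall>i<k. \<epsilon> i * j + card (W \<inter> A i) = n i)" for j W
  have card_split: "card (X \<inter> A i) = \<epsilon> i * card (X \<inter> B) + card ((X - B) \<inter> A i)"
    if "finite X" "i < k" for X i
  proof -
    have "card (X \<inter> A i) = card (X \<inter> A i \<inter> B) + card (X \<inter> A i - B)"
      using that by (subst card_Un_disjoint[symmetric]) (auto intro: arg_cong[where f=card])
    also have "X \<inter> A i - B = (X - B) \<inter> A i" by auto
    also have "card (X \<inter> A i \<inter> B) = \<epsilon> i * card (X \<inter> B)"
    proof (cases "B \<subseteq> A i")
      case True
      then have "X \<inter> A i \<inter> B = X \<inter> B" by auto
      then show ?thesis using True by (simp add: \<epsilon>_def)
    next
      case False
      then have "X \<inter> A i \<inter> B = {}" using AB[OF that(2)] by auto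
      then show ?thesis using False by (simp add: \<epsilon>_def)
    qed
    finally show ?thesis .
  qed
  have indG: "indicator G X = h (card (X \<inter> B)) (X - B)" if "X \<in> space configs" for X
    using card_split[of X] that by (auto simp: G_def h_def space_configs indicator_def)
  have sum_eq: "(\<Sum>x\<in>X. indicator B x * indicator G (X - {x}))
     = of_nat (card (X \<inter> B)) * h (card (X \<inter> B) - 1) (X - B)" if X: "X \<in> space configs" for X
  proof -
    have fin: "finite X" using X by (simp add: space_configs)
    have "(\<Sum>x\<in>X. indicator B x * indicator G (X - {x}) :: ennreal)
        = (\<Sum>x\<in>X \<inter> B. indicator G (X - {x}))"
      by (subst sum.inter_restrict[OF fin], rule sum.cong) (simp_all split: split_indicator)
    also have "\<dots> = (\<Sum>x\<in>X \<inter> B. h (card (X \<inter> B) - 1) (X - B))"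
    proof (rule sum.cong[OF refl])
      fix x assume x: "x \<in> X \<inter> B"
      then have "X - {x} \<in> space configs" using X by (auto simp: space_configs)
      from indG[OF this] have "indicator G (X - {x}) = h (card ((X - {x}) \<inter> B)) (X - {x} - B)" .
      moreover have "(X - {x}) \<inter> B = X \<inter> B - {x}" "X - {x} - B = X - B" using x by auto
      ultimately show "indicator G (X - {x}) = h (card (X \<inter> B) - 1) (X - B)"
        using x fin by simp
    qed
    finally show ?thesis by simp
  qed
  define q where "q j = (\<integral>\<^sup>+X. h j (X - B) \<partial>N)" for j
  \<comment> \<open>Kept general in \<open>\<psi>\<close> and \<open>\<theta>\<close>: with the
    factor \<open>j\<close> and the shift \<open>j - 1\<close> it treats the left side, with
    \<open>1\<close> and \<open>j\<close> the right side.\<close>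
  have split: "(\<integral>\<^sup>+X. \<psi> (card (X \<inter> B)) * h (\<theta> (card (X \<inter> B))) (X - B) \<partial>N)
      = (\<Sum>j. ennreal (pmf (poisson_distribution (c * area B)) j) * (\<psi> j * q (\<theta> j)))"
    for \<psi> :: "nat \<Rightarrow> ennreal" and \<theta> :: "nat \<Rightarrow> nat"
  proof -
    let ?g = "\<lambda>p. \<psi> (card (fst p \<inter> B)) * h (\<theta> (card (fst p \<inter> B))) (snd p)"
    have mh[measurable]: "(\<lambda>W. h j W) \<in> borel_measurable configs" for j unfolding h_def by measurable
    have "(\<lambda>p. h (\<theta> (card (fst p \<inter> B))) (snd p)) \<in> borel_measurable (configs \<Otimes>\<^sub>M configs)"
      unfolding h_def by measurable
    then have "?g \<in> borel_measurable (configs \<Otimes>\<^sub>M configs)" by measurable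
    from nn_integral_poisson_process_split[OF poisson B this]
    have "(\<integral>\<^sup>+X. \<psi> (card (X \<inter> B)) * h (\<theta> (card (X \<inter> B))) (X - B) \<partial>N)
       = (\<integral>\<^sup>+Y. \<integral>\<^sup>+X. \<psi> (card (Y \<inter> B)) * h (\<theta> (card (Y \<inter> B))) (X - B) \<partial>N \<partial>N)"
      by (simp add: Int_assoc)
    also have "\<dots> = (\<integral>\<^sup>+Y. \<psi> (card (Y \<inter> B)) * q (\<theta> (card (Y \<inter> B))) \<partial>N)"
    proof (intro nn_integral_cong)
      have [measurable]: "(\<lambda>X. X - B) \<in> measurable N configs"
        by (rule measurable_config_fixed(2)[OF measurable_ident_sets[OF sets_N] B])
      show "(\<integral>\<^sup>+X. \<psi> (card (Y \<inter> B)) * h (\<theta> (card (Y \<inter> B))) (X - B) \<partial>N)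
        = \<psi> (card (Y \<inter> B)) * q (\<theta> (card (Y \<inter> B)))" for Y
        unfolding q_def by (rule nn_integral_cmult) measurable
    qed
    also have "\<dots> = (\<Sum>j. ennreal (pmf (poisson_distribution (c * area B)) j) * (\<psi> j * q (\<theta> j)))"
      by (rule nn_integral_card[OF B, of "\<lambda>j. \<psi> j * q (\<theta> j)"])
    finally show ?thesis .
  qed
  let ?p = "pmf (poisson_distribution (c * area B))"
  have m0: "0 \<le> c * area B" using c_pos area_nonneg by simp
  have "(\<integral>\<^sup>+X. (\<Sum>x\<in>X. indicator B x * indicator G (X - {x})) \<partial>N)
      = (\<integral>\<^sup>+X. of_nat (card (X \<inter> B)) * h (card (X \<inter> B) - 1) (X - B) \<partial>N)"
    by (intro nn_integral_cong) (simp add: sum_eq space_N)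
  also have "\<dots> = (\<Sum>j. ennreal (?p j) * (of_nat j * q (j - 1)))"
    by (rule split)
  \<comment> \<open>The term for \<open>j = 0\<close> vanishes through its factor \<open>j\<close>,
    so the truncated \<open>j - 1\<close> does no harm.\<close>
  also have "\<dots> = (\<Sum>j. ennreal (?p (Suc j)) * (of_nat (Suc j) * q (Suc j - 1)))"
    by (subst suminf_offset[of _ 1]) auto
  also have "\<dots> = (\<Sum>j. ennreal (c * area B) * (ennreal (?p j) * q j))"
  proof (intro suminf_cong)
    fix j
    have "ennreal (?p (Suc j)) * (of_nat (Suc j) * q (Suc j - 1)) = ennreal (?p (Suc j) * real (Suc j)) * q j"
      by (simp add: ennreal_mult ennreal_of_nat_eq_real_of_nat mult.assoc del: of_nat_Suc)
    also have "\<dots> = ennreal (c * area B) * (ennreal (?p j) * q j)"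
      unfolding pmf_poisson_distribution_Suc[OF m0] ennreal_mult[OF m0 pmf_nonneg] by (rule mult.assoc)
    finally show "ennreal (?p (Suc j)) * (of_nat (Suc j) * q (Suc j - 1))
      = ennreal (c * area B) * (ennreal (?p j) * q j)" .
  qed
  also have "\<dots> = ennreal (c * area B) * (\<Sum>j. ennreal (?p j) * q j)"
    by (rule ennreal_suminf_cmult)
  also have "(\<Sum>j. ennreal (?p j) * q j) = (\<integral>\<^sup>+X. h (card (X \<inter> B)) (X - B) \<partial>N)"
    using split[of "\<lambda>_. 1" "\<lambda>j. j"] by simp
  also have "\<dots> = (\<integral>\<^sup>+X. indicator G X \<partial>N)"
    by (intro nn_integral_cong) (simp add: indG space_N)
  also have "\<dots> = emeasure N G"
    by (rule nn_integral_indicator) (simp add: sets_N G_def, measurable)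
  finally show ?thesis .
qed

abbreviation (input) "Lam \<equiv> density lborel (\<lambda>x. ennreal c * indicator unit_square x)"

lemma emeasure_Lam: "A \<in> sets borel \<Longrightarrow> emeasure Lam A = ennreal (c * area A)"
proof -
  assume A[measurable]: "A \<in> sets borel"
  have "emeasure Lam A = (\<integral>\<^sup>+x. ennreal c * indicator (A \<inter> unit_square) x \<partial>lborel)"
    by (subst emeasure_density) (auto intro!: nn_integral_cong simp: indicator_def)
  also have "\<dots> = ennreal c * ennreal (area A)"
    by (subst nn_integral_cmult) (auto simp: emeasure_area)
  finally show ?thesis using c_pos area_nonneg by (simp add: ennreal_mult)
qed

lemma finite_measure_Lam: "finite_measure Lam"
  by (rule finite_measureI) (simp add: emeasure_Lam)

lemma measurable_sum_delete:
  assumes F[measurable]: "F \<in> borel_measurable (borel \<Otimes>\<^sub>M configs)"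
  shows "(\<lambda>X. \<Sum>x\<in>X. F (x, X - {x}) :: ennreal) \<in> borel_measurable N"
proof (rule borel_measurable_sum_config)
  show "(\<lambda>X. X) \<in> measurable N configs" by (rule measurable_ident_sets[OF sets_N])
  have [measurable]: "fst \<in> measurable (N \<Otimes>\<^sub>M (borel :: (real ^ 2) measure)) configs"
    by (subst measurable_cong_sets[OF refl sets_N[symmetric]]) (rule measurable_fst)
  show "(\<lambda>(X, x). F (x, X - {x})) \<in> borel_measurable (N \<Otimes>\<^sub>M borel)"
    unfolding case_prod_beta by measurable
qed

text \<open>\<open>B\<close> need not respect the sets that define \<open>G\<close>, but both sides
  are additive in \<open>B\<close>, so it can be cut along these sets one after the other. In the
  induction the sets with index below \<open>l\<close> are those that \<open>B\<close> may still
  cut.\<close>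

lemma mecke_product:
  assumes B: "B \<in> sets borel" and G: "G \<in> config_events"
  shows "(\<integral>\<^sup>+X. (\<Sum>x\<in>X. indicator B x * indicator G (X - {x})) \<partial>N) = ennreal (c * area B) * emeasure N G"
proof -
  obtain A and k :: nat and n where A: "\<And>i. A i \<in> sets borel"
    and G_eq: "G = {X\<in>space configs. \<forall>i<k. card (X \<inter> A i) = n i}"
    by (rule config_eventE[OF G]) (rule that)
  have Gs[measurable]: "G \<in> sets configs" using G config_events_sets by blast
  have main: "(\<integral>\<^sup>+X. (\<Sum>x\<in>X. indicator B x * indicator G (X - {x})) \<partial>N) = ennreal (c * area B) * emeasure N G"
    if "B \<in> sets borel" "\<And>i. l \<le> i \<Longrightarrow> i < k \<Longrightarrow> B \<subseteq> A i \<or> B \<inter> A i = {}" for B l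
    using that
  proof (induction l arbitrary: B)
    case 0
    then show ?case unfolding G_eq by (intro mecke_basic) (auto intro: A)
  next
    case (Suc l)
    note [measurable] = Suc.prems(1) A[of l]
    have IH: "(\<integral>\<^sup>+X. (\<Sum>x\<in>X. indicator C x * indicator G (X - {x})) \<partial>N) = ennreal (c * area C) * emeasure N G"
      if "C = B \<inter> A l \<or> C = B - A l" for C
    proof (rule Suc.IH)
      show "C \<in> sets borel" using that by auto
      fix i assume "l \<le> i" "i < k"
      show "C \<subseteq> A i \<or> C \<inter> A i = {}"
      proof (cases "i = l")
        case True then show ?thesis using that by auto
      next
        case False
        then have "B \<subseteq> A i \<or> B \<inter> A i = {}" using Suc.prems(2)[of i] \<open>l \<le> i\<close> \<open>i < k\<close> by auto
        then show ?thesis using that by auto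
      qed
    qed
    let ?I = "\<lambda>C. (\<integral>\<^sup>+X. (\<Sum>x\<in>X. indicator C x * indicator G (X - {x})) \<partial>N)"
    have m: "(\<lambda>X. (\<Sum>x\<in>X. indicator C x * indicator G (X - {x})) :: ennreal) \<in> borel_measurable N"
      if [measurable]: "C \<in> sets borel" for C
      using measurable_sum_delete[of "\<lambda>p. indicator C (fst p) * indicator G (snd p)"] by simp
    have "?I B = (\<integral>\<^sup>+X. (\<Sum>x\<in>X. indicator (B \<inter> A l) x * indicator G (X - {x}))
        + (\<Sum>x\<in>X. indicator (B - A l) x * indicator G (X - {x})) \<partial>N)"
      by (intro nn_integral_cong) (auto simp: sum.distrib[symmetric] indicator_def intro!: sum.cong)
    also have "\<dots> = ?I (B \<inter> A l) + ?I (B - A l)"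
      by (intro nn_integral_add m) auto
    also have "\<dots> = (emeasure Lam (B \<inter> A l) + emeasure Lam (B - A l)) * emeasure N G"
      by (simp add: IH emeasure_Lam distrib_right)
    also have "emeasure Lam (B \<inter> A l) + emeasure Lam (B - A l) = emeasure Lam B"
      by (subst plus_emeasure) (auto intro: arg_cong[where f="emeasure Lam"])
    finally show ?case using Suc.prems(1) by (simp add: emeasure_Lam)
  qed
  show ?thesis by (rule main[OF B, of k]) auto
qed

text \<open>As functions of \<open>E\<close> both sides are countably additive and agree on the
  \<pi>-system of products; finite total mass allows the step to complements.\<close>

lemma mecke_sets:
  assumes E: "E \<in> sets (borel \<Otimes>\<^sub>M configs)"
  shows "(\<integral>\<^sup>+X. (\<Sum>x\<in>X. indicator E (x, X - {x})) \<partial>N) = emeasure (Lam \<Otimes>\<^sub>M N) E"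
proof -
  interpret L: finite_measure Lam by (rule finite_measure_Lam)
  interpret LN: pair_sigma_finite Lam N ..
  have sets_LN: "sets (Lam \<Otimes>\<^sub>M N) = sets (borel \<Otimes>\<^sub>M configs)"
    by (intro sets_pair_measure_cong) (auto simp: sets_N)
  let ?E = "{a \<times> b |a b. a \<in> sets (borel :: (real ^ 2) measure) \<and> b \<in> config_events}"
  let ?\<Omega> = "space borel \<times> space configs :: ((real ^ 2) \<times> (real ^ 2) set) set"
  have ce: "b \<in> config_events \<Longrightarrow> b \<subseteq> space configs" for b
    using config_events_Pow by blast
  have "sets (borel \<Otimes>\<^sub>M configs) = sets (sigma ?\<Omega> ?E)"
    by (rule sets_pair_eq[where Ca="{UNIV}" and Cb="{space configs}"])
      (auto simp: sets_configs_eq[symmetric] space_configs_event sets.sigma_sets_eq[of borel, simplified]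
         dest: ce)
  also have "\<dots> = sigma_sets ?\<Omega> ?E"
    by (rule sets_measure_of) (auto dest: ce)
  finally have sets_eq: "sets (borel \<Otimes>\<^sub>M configs) = sigma_sets ?\<Omega> ?E" .
  have stable: "Int_stable ?E"
  proof (rule Int_stableI, clarify)
    fix a b a' b' assume "a \<in> sets (borel :: (real ^ 2) measure)" "b \<in> config_events"
      "a' \<in> sets (borel :: (real ^ 2) measure)" "b' \<in> config_events"
    then have "a \<inter> a' \<in> sets borel" "b \<inter> b' \<in> config_events"
      using Int_stable_config_events by (auto simp: Int_stable_def)
    then show "\<exists>aa ba. a \<times> b \<inter> a' \<times> b' = aa \<times> ba \<and> aa \<in> sets borel \<and> ba \<in> config_events"
      by (intro exI[of _ "a \<inter> a'"] exI[of _ "b \<inter> b'"]) auto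
  qed
  have sub: "?E \<subseteq> Pow ?\<Omega>" by (auto dest: ce)
  have prod: "(\<integral>\<^sup>+X. (\<Sum>x\<in>X. indicator (a \<times> b) (x, X - {x})) \<partial>N) = emeasure (Lam \<Otimes>\<^sub>M N) (a \<times> b)"
    if "a \<in> sets borel" "b \<in> config_events" for a b
  proof -
    have b: "b \<in> sets configs" using that config_events_sets by blast
    have "(\<integral>\<^sup>+X. (\<Sum>x\<in>X. indicator (a \<times> b) (x, X - {x})) \<partial>N)
        = (\<integral>\<^sup>+X. (\<Sum>x\<in>X. indicator a x * indicator b (X - {x})) \<partial>N)"
      by (simp add: indicator_times)
    also have "\<dots> = ennreal (c * area a) * emeasure N b" by (rule mecke_product[OF that])
    also have "\<dots> = emeasure Lam a * emeasure N b" using that by (simp add: emeasure_Lam)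
    also have "\<dots> = emeasure (Lam \<Otimes>\<^sub>M N) (a \<times> b)"
      using that b by (intro emeasure_pair_measure_Times[symmetric]) (auto simp: sets_N)
    finally show ?thesis .
  qed
  have m: "(\<lambda>X. (\<Sum>x\<in>X. indicator E (x, X - {x})) :: ennreal) \<in> borel_measurable N"
    if "E \<in> sigma_sets ?\<Omega> ?E" for E
    using that by (intro measurable_sum_delete borel_measurable_indicator) (simp only: sets_eq)
  have total: "(\<integral>\<^sup>+X. (\<Sum>x\<in>X. indicator ?\<Omega> (x, X - {x})) \<partial>N) = emeasure (Lam \<Otimes>\<^sub>M N) ?\<Omega>"
    by (intro prod) (auto intro: space_configs_event)
  have fin: "emeasure (Lam \<Otimes>\<^sub>M N) A < \<infinity>" for A
  proof -
    have "emeasure (Lam \<Otimes>\<^sub>M N) A \<le> emeasure (Lam \<Otimes>\<^sub>M N) (space (Lam \<Otimes>\<^sub>M N))"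
      by (rule emeasure_space)
    also have "\<dots> = emeasure Lam (space Lam) * emeasure N (space N)"
      unfolding space_pair_measure by (rule emeasure_pair_measure_Times) auto
    also have "\<dots> < \<infinity>" by (simp add: emeasure_Lam emeasure_space_1)
    finally show ?thesis .
  qed
  from E have "E \<in> sigma_sets ?\<Omega> ?E" by (simp add: sets_eq)
  from stable sub this show ?thesis
  proof (induction rule: sigma_sets_induct_disjoint)
    case (basic A)
    then show ?case using prod by blast
  next
    case empty show ?case by simp
  next
    case (compl A)
    have "(\<integral>\<^sup>+X. (\<Sum>x\<in>X. indicator (?\<Omega> - A) (x, X - {x})) \<partial>N) + emeasure (Lam \<Otimes>\<^sub>M N) A
       = (\<integral>\<^sup>+X. (\<Sum>x\<in>X. indicator (?\<Omega> - A) (x, X - {x})) + (\<Sum>x\<in>X. indicator A (x, X - {x})) \<partial>N)"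
      unfolding compl.IH[symmetric]
      by (rule nn_integral_add[symmetric]) (intro m compl sigma_sets.Compl)+
    also have "\<dots> = (\<integral>\<^sup>+X. (\<Sum>x\<in>X. indicator ?\<Omega> (x, X - {x})) \<partial>N)"
      using sigma_sets_into_sp[OF sub compl(1)]
      by (intro nn_integral_cong) (auto simp: sum.distrib[symmetric] indicator_def intro!: sum.cong)
    also have "\<dots> = emeasure (Lam \<Otimes>\<^sub>M N) (?\<Omega> - A) + emeasure (Lam \<Otimes>\<^sub>M N) A"
    proof (subst plus_emeasure)
      show "?\<Omega> - A \<in> sets (Lam \<Otimes>\<^sub>M N)" "A \<in> sets (Lam \<Otimes>\<^sub>M N)"
        unfolding sets_LN sets_eq using compl(1) by (auto intro: sigma_sets.Compl)
      have "?\<Omega> - A \<union> A = ?\<Omega>" using sigma_sets_into_sp[OF sub compl(1)] by auto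
      then show "(\<integral>\<^sup>+X. (\<Sum>x\<in>X. indicator ?\<Omega> (x, X - {x})) \<partial>N) = emeasure (Lam \<Otimes>\<^sub>M N) (?\<Omega> - A \<union> A)"
        by (simp only: total)
    qed auto
    finally show ?case using fin[of A] by (auto simp: ennreal_add_left_cancel add.commute[of _ "emeasure (Lam \<Otimes>\<^sub>M N) A"])
  next
    case (union A)
    have "(\<integral>\<^sup>+X. (\<Sum>x\<in>X. indicator (\<Union>(range A)) (x, X - {x})) \<partial>N)
      = (\<integral>\<^sup>+X. (\<Sum>i. \<Sum>x\<in>X. indicator (A i) (x, X - {x})) \<partial>N)"
      using union(1) by (subst suminf_sum) (auto simp: suminf_indicator)
    also have "\<dots> = (\<Sum>i. \<integral>\<^sup>+X. (\<Sum>x\<in>X. indicator (A i) (x, X - {x})) \<partial>N)"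
      using union(2) by (intro nn_integral_suminf m) auto
    also have "\<dots> = (\<Sum>i. emeasure (Lam \<Otimes>\<^sub>M N) (A i))" by (simp add: union.IH)
    also have "\<dots> = emeasure (Lam \<Otimes>\<^sub>M N) (\<Union>(range A))"
    proof (rule suminf_emeasure)
      show "range A \<subseteq> sets (Lam \<Otimes>\<^sub>M N)" unfolding sets_LN sets_eq by (rule union(2))
    qed (rule union(1))
    finally show ?case .
  qed
qed

text \<open>In the language of Palm theory: seen from a typical point, the remaining points form the
  same Poisson process. It serves to pick out the bad points one by one, and later to count the new
  bad points.\<close>

lemma mecke:
  fixes F :: "(real ^ 2) \<times> (real ^ 2) set \<Rightarrow> ennreal"
  assumes F: "F \<in> borel_measurable (borel \<Otimes>\<^sub>M configs)"
  shows "(\<integral>\<^sup>+X. (\<Sum>x\<in>X. F (x, X - {x})) \<partial>N)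
    = ennreal c * (\<integral>\<^sup>+x\<in>unit_square. (\<integral>\<^sup>+Y. F (x, Y) \<partial>N) \<partial>lborel)"
proof -
  have "(\<integral>\<^sup>+X. (\<Sum>x\<in>X. F (x, X - {x})) \<partial>N) = (\<integral>\<^sup>+p. F p \<partial>(Lam \<Otimes>\<^sub>M N))"
    using F
  proof (induction rule: borel_measurable_induct)
    case (cong f h)
    have "(\<integral>\<^sup>+X. (\<Sum>x\<in>X. f (x, X - {x})) \<partial>N) = (\<integral>\<^sup>+X. (\<Sum>x\<in>X. h (x, X - {x})) \<partial>N)"
      by (intro nn_integral_cong sum.cong refl cong)
        (auto simp: space_pair_measure space_N space_configs)
    moreover have "(\<integral>\<^sup>+p. f p \<partial>(Lam \<Otimes>\<^sub>M N)) = (\<integral>\<^sup>+p. h p \<partial>(Lam \<Otimes>\<^sub>M N))"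
      by (intro nn_integral_cong cong) (auto simp: space_pair_measure space_N)
    ultimately show ?case using cong by simp
  next
    case (set A)
    then show ?case by (simp add: mecke_sets sets_N cong: sets_pair_measure_cong)
  next
    case (mult u d)
    have "(\<integral>\<^sup>+p. d * u p \<partial>(Lam \<Otimes>\<^sub>M N)) = d * (\<integral>\<^sup>+p. u p \<partial>(Lam \<Otimes>\<^sub>M N))"
      using mult by (intro nn_integral_cmult) (simp cong: measurable_cong_sets add: sets_N)
    then show ?case using mult
      by (simp add: sum_distrib_left[symmetric] nn_integral_cmult measurable_sum_delete)
  next
    case (add u v)
    have "(\<integral>\<^sup>+p. v p + u p \<partial>(Lam \<Otimes>\<^sub>M N)) = (\<integral>\<^sup>+p. v p \<partial>(Lam \<Otimes>\<^sub>M N)) + (\<integral>\<^sup>+p. u p \<partial>(Lam \<Otimes>\<^sub>M N))"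
      using add by (intro nn_integral_add) (simp_all cong: measurable_cong_sets add: sets_N)
    then show ?case using add
      by (simp add: sum.distrib nn_integral_add measurable_sum_delete)
  next
    case (seq U)
    have "(\<integral>\<^sup>+X. (\<Sum>x\<in>X. (SUP i. U i) (x, X - {x})) \<partial>N) = (\<integral>\<^sup>+X. (SUP i. \<Sum>x\<in>X. U i (x, X - {x})) \<partial>N)"
      using seq(3) by (intro nn_integral_cong) (simp add: SUP_apply image_comp, subst ennreal_SUP_sum,
          auto simp: incseq_def le_fun_def)
    also have "\<dots> = (SUP i. \<integral>\<^sup>+X. (\<Sum>x\<in>X. U i (x, X - {x})) \<partial>N)"
      using seq by (intro nn_integral_monotone_convergence_SUP measurable_sum_delete)
        (auto simp: incseq_def le_fun_def intro!: sum_mono)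
    also have "\<dots> = (SUP i. \<integral>\<^sup>+p. U i p \<partial>(Lam \<Otimes>\<^sub>M N))" by (simp add: seq)
    also have "\<dots> = (\<integral>\<^sup>+p. (SUP i. U i) p \<partial>(Lam \<Otimes>\<^sub>M N))"
      unfolding SUP_apply using seq
      by (intro nn_integral_monotone_convergence_SUP[symmetric]) (simp_all cong: measurable_cong_sets add: sets_N)
    finally show ?case .
  qed
  also have "\<dots> = (\<integral>\<^sup>+x. \<integral>\<^sup>+Y. F (x, Y) \<partial>N \<partial>Lam)"
    using F by (intro nn_integral_fst[symmetric]) (simp cong: measurable_cong_sets add: sets_N)
  also have "\<dots> = (\<integral>\<^sup>+x. (ennreal c * indicator unit_square x) * (\<integral>\<^sup>+Y. F (x, Y) \<partial>N) \<partial>lborel)"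
    using F by (intro nn_integral_density borel_measurable_nn_integral_fst)
      (auto cong: measurable_cong_sets simp: sets_N)
  also have "\<dots> = ennreal c * (\<integral>\<^sup>+x\<in>unit_square. (\<integral>\<^sup>+Y. F (x, Y) \<partial>N) \<partial>lborel)"
    using borel_measurable_nn_integral_fst[of F borel] F
    by (subst nn_integral_cmult[symmetric])
      (auto cong: measurable_cong_sets simp: sets_N mult_ac intro!: borel_measurable_times)
  finally show ?thesis .
qed

end

section \<open>Bad and good points of a Poisson process\<close>

lemma bad_points_subset: "bad_points r X \<subseteq> X"
  by (auto simp: bad_points_eq)

lemma bad_points_bad_points [simp]: "bad_points r (bad_points r X) = bad_points r X"
  unfolding bad_points_eq by (auto simp: dist_commute) (metis dist_commute)

lemma resampling_set_bad_points [simp]: "resampling_set r (bad_points r X) = resampling_set r X"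
  by (simp add: resampling_set_def)

text \<open>A point of \<open>X\<close> within \<open>2 * r\<close> of a bad point is itself bad, so
  resampling removes the bad points and no others.\<close>

lemma Int_resampling_set:
  assumes "X \<subseteq> unit_square" "0 < r"
  shows "X \<inter> resampling_set r X = bad_points r X" "X - resampling_set r X = X - bad_points r X"
proof -
  show "X \<inter> resampling_set r X = bad_points r X"
  proof (intro set_eqI iffI)
    fix y assume "y \<in> X \<inter> resampling_set r X"
    then obtain x where "y \<in> X" "x \<in> bad_points r X" "dist x y < 2 * r"
      by (auto simp: resampling_set_def)
    then show "y \<in> bad_points r X"
      by (cases "x = y") (auto simp: bad_points_eq dist_commute)
  next
    fix y assume "y \<in> bad_points r X"
    then show "y \<in> X \<inter> resampling_set r X"
      using assms bad_points_subset[of r X] by (auto simp: resampling_set_def intro!: bexI[of _ y])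
  qed
  then show "X - resampling_set r X = X - bad_points r X" by auto
qed

lemma hard_subset: "hard r X \<Longrightarrow> Y \<subseteq> X \<Longrightarrow> hard r Y"
  unfolding hard_iff by blast

text \<open>Of the three conditions on the right one concerns \<open>b\<close> alone, and the other
  two say that \<open>Y\<close> is hard and avoids a region determined by \<open>b\<close>. This
  separation is why the good points, given the bad ones, carry no information beyond being a hard
  configuration off the resampling set.\<close>

lemma bad_points_Un_eq_iff:
  assumes "b \<union> Y \<subseteq> unit_square" "b \<inter> Y = {}" "0 < r"
  shows "bad_points r (b \<union> Y) = b \<longleftrightarrow> b \<subseteq> bad_points r b \<and> hard r Y \<and> Y \<inter> resampling_set r b = {}"
proof (intro iffI conjI)
  assume eq: "bad_points r (b \<union> Y) = b"
  then have bad: "x \<in> b \<union> Y \<Longrightarrow> z \<in> b \<union> Y \<Longrightarrow> x \<noteq> z \<Longrightarrow> dist x z < 2 * r \<Longrightarrow> x \<in> b" for x z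
    by (auto simp: bad_points_eq)
  show "b \<subseteq> bad_points r b"
  proof
    fix x assume "x \<in> b"
    with eq have "x \<in> bad_points r (b \<union> Y)" by simp
    then obtain z where "z \<in> b \<union> Y" "x \<noteq> z" "dist x z < 2 * r" by (auto simp: bad_points_eq)
    moreover have "z \<in> b" using bad[of z x] calculation \<open>x \<in> b\<close> by (auto simp: dist_commute)
    ultimately show "x \<in> bad_points r b" using \<open>x \<in> b\<close> by (auto simp: bad_points_eq)
  qed
  show "hard r Y"
    unfolding hard_iff using bad assms(2) by (auto simp: not_less[symmetric])
  show "Y \<inter> resampling_set r b = {}"
  proof (rule ccontr)
    assume "Y \<inter> resampling_set r b \<noteq> {}"
    then obtain x y where "y \<in> Y" "x \<in> bad_points r b" "dist x y < 2 * r"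
      by (auto simp: resampling_set_def)
    then have "y \<in> Y" "x \<in> b" "dist x y < 2 * r"
      using bad_points_subset[of r b] by auto
    then show False using bad[of y x] assms(2) by (auto simp: dist_commute)
  qed
next
  assume *: "b \<subseteq> bad_points r b \<and> hard r Y \<and> Y \<inter> resampling_set r b = {}"
  then have far: "2 * r \<le> dist x y" if "x \<in> b" "y \<in> Y" for x y
    using that assms(1) by (force simp: resampling_set_def not_less[symmetric])
  show "bad_points r (b \<union> Y) = b"
  proof (intro set_eqI iffI)
    fix x assume "x \<in> b"
    then show "x \<in> bad_points r (b \<union> Y)" using * by (auto simp: bad_points_eq)
  next
    fix x assume "x \<in> bad_points r (b \<union> Y)"
    then obtain z where "x \<in> b \<union> Y" "z \<in> b \<union> Y" "x \<noteq> z" "dist x z < 2 * r"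
      by (auto simp: bad_points_eq)
    then show "x \<in> b" using far[of x z] far[of z x] *
      by (force simp: hard_iff dist_commute)
  qed
qed

text \<open>\<open>tuple_sum F n a X\<close> sums \<open>F (a \<union> {x\<^sub>1, \<dots>, x\<^sub>n}) (X - {x\<^sub>1, \<dots>, x\<^sub>n})\<close> over the ordered
  \<open>n\<close>-tuples of distinct points of \<open>X\<close>. Cutting the new point down to \<open>unit_square\<close>
  only serves to keep the function within the measurable space \<open>configs\<close>.\<close>

fun tuple_sum :: "((real ^ 2) set \<Rightarrow> (real ^ 2) set \<Rightarrow> ennreal) \<Rightarrow> nat \<Rightarrow> (real ^ 2) set \<Rightarrow> (real ^ 2) set \<Rightarrow> ennreal"
  where
    "tuple_sum F 0 a X = F a X"
  | "tuple_sum F (Suc n) a X = (\<Sum>x\<in>X. tuple_sum F n (a \<union> ({x} \<inter> unit_square)) (X - {x}))"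

lemma measurable_config_insert [measurable]:
  assumes "f \<in> measurable M borel" "g \<in> measurable M configs"
  shows "(\<lambda>p. g p \<union> ({f p} \<inter> unit_square)) \<in> measurable M configs"
  by (intro measurable_config_Un measurable_config_singleton assms)

lemma measurable_tuple_sum:
  assumes F: "(\<lambda>(b, Y). F b Y) \<in> borel_measurable (configs \<Otimes>\<^sub>M configs)"
  shows "(\<lambda>(a, X). tuple_sum F n a X) \<in> borel_measurable (configs \<Otimes>\<^sub>M configs)"
proof (induction n)
  case 0
  then show ?case using F by simp
next
  case (Suc n)
  have "(\<lambda>p. \<Sum>x\<in>snd p. tuple_sum F n (fst p \<union> ({x} \<inter> unit_square)) (snd p - {x}))
      \<in> borel_measurable (configs \<Otimes>\<^sub>M configs)"
  proof (rule borel_measurable_sum_config)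
    have "(\<lambda>q. (fst (fst q) \<union> ({snd q} \<inter> unit_square), snd (fst q) - {snd q}))
        \<in> measurable ((configs \<Otimes>\<^sub>M configs) \<Otimes>\<^sub>M borel) (configs \<Otimes>\<^sub>M configs)"
      by measurable
    from measurable_compose[OF this Suc]
    show "(\<lambda>(p, x). tuple_sum F n (fst p \<union> ({x} \<inter> unit_square)) (snd p - {x}))
        \<in> borel_measurable ((configs \<Otimes>\<^sub>M configs) \<Otimes>\<^sub>M borel)"
      by (simp add: case_prod_beta)
  qed measurable
  then show ?case by (simp add: case_prod_beta)
qed

text \<open>The support condition kills every tuple that does not complete \<open>a\<close> to the
  full set of bad points; the surviving tuples are the \<open>fact n\<close> orderings of the bad
  points still missing from \<open>a\<close>.\<close>

lemma tuple_sum_bad_points: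
  assumes supp: "\<And>b Y. F b Y \<noteq> 0 \<Longrightarrow> b \<union> Y \<subseteq> unit_square \<Longrightarrow> b \<inter> Y = {} \<Longrightarrow> bad_points r (b \<union> Y) = b"
    and "finite Z" "Z \<subseteq> unit_square"
  shows "a \<union> X = Z \<Longrightarrow> a \<inter> X = {} \<Longrightarrow> tuple_sum F n a X
    = (if a \<subseteq> bad_points r Z \<and> card (bad_points r Z - a) = n
       then fact n * F (bad_points r Z) (Z - bad_points r Z) else 0)"
proof (induction n arbitrary: a X)
  case 0
  let ?B = "bad_points r Z"
  have fin: "finite ?B" by (rule finite_subset[OF bad_points_subset assms(2)])
  show ?case
  proof (cases "a \<subseteq> ?B \<and> card (?B - a) = 0")
    case True
    then have "a = ?B" using fin by auto
    moreover have "X = Z - a" using 0 by auto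
    ultimately show ?thesis by simp
  next
    case False
    then have "F a X = 0" using supp[of a X] 0 assms(3) by auto
    then show ?thesis using False by auto
  qed
next
  case (Suc n)
  let ?B = "bad_points r Z"
  have fin: "finite ?B" "finite X"
    using finite_subset[OF bad_points_subset assms(2)] assms(2) Suc.prems by auto
  let ?c = "fact n * F ?B (Z - ?B)"
  have "tuple_sum F (Suc n) a X = (\<Sum>x\<in>X. tuple_sum F n (insert x a) (X - {x}))"
    using Suc.prems assms(3) by (auto intro!: sum.cong simp: insert_absorb)
  also have "\<dots> = (\<Sum>x\<in>X. if insert x a \<subseteq> ?B \<and> card (?B - insert x a) = n then ?c else 0)"
    using Suc.prems by (intro sum.cong refl Suc.IH) auto
  also have "\<dots> = (\<Sum>x\<in>X. if x \<in> ?B - a \<and> a \<subseteq> ?B \<and> card (?B - a) = Suc n then ?c else 0)"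
  proof (intro sum.cong refl)
    fix x assume x: "x \<in> X"
    have card_B: "card (?B - a) = Suc (card (?B - insert x a))" if "x \<in> ?B"
    proof -
      have "x \<in> ?B - a" using that x Suc.prems by auto
      then have "card (?B - a) = Suc (card (?B - a - {x}))"
        using fin by (intro card.remove) auto
      moreover have "?B - insert x a = ?B - a - {x}" by auto
      ultimately show ?thesis by (simp only:)
    qed
    have "card (?B - insert x a) = n \<longleftrightarrow> card (?B - a) = Suc n" if "x \<in> ?B"
      unfolding card_B[OF that] nat.inject ..
    then have "insert x a \<subseteq> ?B \<and> card (?B - insert x a) = n
        \<longleftrightarrow> x \<in> ?B - a \<and> a \<subseteq> ?B \<and> card (?B - a) = Suc n"
      using x Suc.prems(2) by blast
    then show "(if insert x a \<subseteq> ?B \<and> card (?B - insert x a) = n then ?c else 0)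
      = (if x \<in> ?B - a \<and> a \<subseteq> ?B \<and> card (?B - a) = Suc n then ?c else 0)"
      by (simp only:)
  qed
  also have "\<dots> = (if a \<subseteq> ?B \<and> card (?B - a) = Suc n then \<Sum>x\<in>X \<inter> (?B - a). ?c else 0)"
    unfolding sum.inter_restrict[OF fin(2)]
    by (cases "a \<subseteq> ?B \<and> card (?B - a) = Suc n") (simp_all, intro sum.neutral, auto)
  also have "X \<inter> (?B - a) = ?B - a" using Suc.prems bad_points_subset[of r Z] by auto
  finally show ?case by (simp add: mult_ac)
qed

context poisson_square
begin

lemma measurable_N_iff: "measurable N M = measurable configs M"
  by (rule measurable_cong_sets[OF sets_N refl])

text \<open>This is the split along the complement of \<open>S\<close>, read backwards. It turns a
  configuration that was refilled inside \<open>S\<close> into a single Poisson sample.\<close>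

lemma superposition:
  assumes S: "S \<in> sets borel" and g[measurable]: "g \<in> borel_measurable configs"
  shows "(\<integral>\<^sup>+Y. \<integral>\<^sup>+X. g ((Y - S) \<union> (X \<inter> S)) \<partial>N \<partial>N) = (\<integral>\<^sup>+X. g X \<partial>N :: ennreal)"
proof -
  have "(\<lambda>p. fst p \<union> snd p) \<in> measurable (configs \<Otimes>\<^sub>M configs) configs"
    by (intro measurable_config_Un) auto
  then have "(\<lambda>p. g (fst p \<union> snd p)) \<in> borel_measurable (configs \<Otimes>\<^sub>M configs)"
    by measurable
  from nn_integral_poisson_process_split[OF poisson _ this, of "- S"] S show ?thesis
    by (simp add: Diff_eq[symmetric] Un_Int_distrib[symmetric] Un_Diff_Int Diff_Compl)
qed

text \<open>Applying the Mecke equation \<open>n\<close> times integrates the chosen points over the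
  square and leaves a full Poisson sample as second argument, so \<open>F\<close> matters only
  through its average over that argument.\<close>

lemma tuple_sum_integral_cong:
  assumes F: "(\<lambda>(b, Y). F b Y) \<in> borel_measurable (configs \<Otimes>\<^sub>M configs)"
    and G: "(\<lambda>(b, Y). G b Y) \<in> borel_measurable (configs \<Otimes>\<^sub>M configs)"
    and eq: "\<And>b. b \<in> space configs \<Longrightarrow> (\<integral>\<^sup>+Y. F b Y \<partial>N) = (\<integral>\<^sup>+Y. G b Y \<partial>N)"
  shows "a \<in> space configs \<Longrightarrow> (\<integral>\<^sup>+X. tuple_sum F n a X \<partial>N) = (\<integral>\<^sup>+X. tuple_sum G n a X \<partial>N)"
proof (induction n arbitrary: a)
  case 0
  then show ?case by (simp add: eq)
next
  case (Suc n)
  have step: "(\<integral>\<^sup>+X. tuple_sum H (Suc n) a X \<partial>N)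
      = ennreal c * (\<integral>\<^sup>+x\<in>unit_square. (\<integral>\<^sup>+Y. tuple_sum H n (a \<union> ({x} \<inter> unit_square)) Y \<partial>N) \<partial>lborel)"
    if H: "(\<lambda>(b, Y). H b Y) \<in> borel_measurable (configs \<Otimes>\<^sub>M configs)" for H
  proof -
    have a: "(\<lambda>p :: (real ^ 2) \<times> (real ^ 2) set. a) \<in> measurable (borel \<Otimes>\<^sub>M configs) configs"
      using Suc.prems by simp
    have "(\<lambda>p. (a \<union> ({fst p} \<inter> unit_square), snd p)) \<in> measurable (borel \<Otimes>\<^sub>M configs) (configs \<Otimes>\<^sub>M configs)"
      by (intro measurable_Pair measurable_config_insert a) measurable
    from measurable_compose[OF this measurable_tuple_sum[OF H]]
    have "(\<lambda>p. tuple_sum H n (a \<union> ({fst p} \<inter> unit_square)) (snd p)) \<in> borel_measurable (borel \<Otimes>\<^sub>M configs)"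
      by (simp add: case_prod_beta)
    from mecke[OF this] show ?thesis by simp
  qed
  have "a \<union> ({x} \<inter> unit_square) \<in> space configs" for x
    using Suc.prems by (auto simp: space_configs)
  then show ?case unfolding step[OF F] step[OF G] by (simp add: Suc.IH)
qed

end

section \<open>The law of the good points given the bad points\<close>

locale hard_disks = poisson_square +
  fixes r :: real
  assumes r_pos: "0 < r"
begin

definition partition_function :: "(real ^ 2) set \<Rightarrow> ennreal"
  where "partition_function b = (\<integral>\<^sup>+X. of_bool (hard r (X - resampling_set r b)) \<partial>N)"

text \<open>The mean of \<open>h (b, Y)\<close> for \<open>Y\<close> a Poisson process outside the
  resampling set of \<open>b\<close>, conditioned to be hard. It turns out to be the conditional
  expectation of \<open>h\<close> given that the bad points are \<open>b\<close>.\<close>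

definition hard_expectation :: "((real ^ 2) set \<times> (real ^ 2) set \<Rightarrow> ennreal) \<Rightarrow> (real ^ 2) set \<Rightarrow> ennreal"
  where "hard_expectation h b = (\<integral>\<^sup>+X. of_bool (hard r (X - resampling_set r b))
    * h (b, X - resampling_set r b) \<partial>N) / partition_function b"

lemma measurable_hard_Diff [measurable]:
  assumes "f \<in> measurable M configs" "g \<in> measurable M configs"
  shows "Measurable.pred M (\<lambda>p. hard r (f p - resampling_set r (g p)))"
  by (intro pred_hard measurable_config_Int_resampling_set assms)

lemma measurable_partition_function [measurable]: "partition_function \<in> borel_measurable configs"
proof -
  have [measurable]: "snd \<in> measurable (configs \<Otimes>\<^sub>M N) configs"
    by (subst measurable_cong_sets[OF refl sets_N[symmetric]]) (rule measurable_snd)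
  show ?thesis unfolding partition_function_def by measurable
qed

lemma measurable_hard_expectation [measurable]:
  assumes [measurable]: "h \<in> borel_measurable (configs \<Otimes>\<^sub>M configs)"
  shows "hard_expectation h \<in> borel_measurable configs"
proof -
  have [measurable]: "snd \<in> measurable (configs \<Otimes>\<^sub>M N) configs"
    by (subst measurable_cong_sets[OF refl sets_N[symmetric]]) (rule measurable_snd)
  have [measurable]: "(\<lambda>p. snd p - resampling_set r (fst p)) \<in> measurable (configs \<Otimes>\<^sub>M N) configs"
    by (rule measurable_config_Int_resampling_set) measurable
  show ?thesis unfolding hard_expectation_def by measurable
qed

text \<open>The empty configuration is hard and has positive probability.\<close>

lemma partition_function_pos:
  assumes "b \<in> space configs"
  shows "partition_function b \<noteq> 0"
proof -
  have "0 < emeasure N {X\<in>space N. X \<inter> UNIV = {}}" by (subst void_probability) auto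
  also have "\<dots> = (\<integral>\<^sup>+X. indicator {X\<in>space N. X \<inter> UNIV = {}} X \<partial>N)"
  proof (rule nn_integral_indicator[symmetric])
    have "{X\<in>space N. card (X \<inter> UNIV) = 0} \<in> sets N"
      using measurable_card_Int[of UNIV] unfolding measurable_N_iff[symmetric] by measurable
    moreover have "{X\<in>space N. card (X \<inter> UNIV) = 0} = {X\<in>space N. X \<inter> UNIV = {}}"
      using space_N_D by (auto simp: card_eq_0_iff)
    ultimately show "{X\<in>space N. X \<inter> UNIV = {}} \<in> sets N" by simp
  qed
  also have "\<dots> \<le> partition_function b"
    unfolding partition_function_def
    by (intro nn_integral_mono) (auto simp: indicator_def hard_iff)
  finally show ?thesis by simp
qed

lemma partition_function_le_1: "partition_function b \<le> 1"
proof -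
  have "partition_function b \<le> (\<integral>\<^sup>+X. 1 \<partial>N)"
    unfolding partition_function_def by (intro nn_integral_mono) auto
  then show ?thesis by (simp add: emeasure_space_1)
qed

lemma hard_expectation_mult:
  assumes b: "b \<in> space configs"
  shows "hard_expectation h b * partition_function b
    = (\<integral>\<^sup>+X. of_bool (hard r (X - resampling_set r b)) * h (b, X - resampling_set r b) \<partial>N)"
proof -
  have "partition_function b \<noteq> \<top>" using partition_function_le_1[of b] by (auto simp: top_unique)
  then show ?thesis unfolding hard_expectation_def
    using partition_function_pos[OF b] by (simp add: ennreal_divide_times less_top)
qed

lemma configs_resampling_borel: "b \<in> space configs \<Longrightarrow> resampling_set r b \<in> sets borel"
  by (intro resampling_set_borel) (simp add: space_configs)

text \<open>Both integrals are cut by the number \<open>n\<close> of bad points. On each level the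
  iterated Mecke equation treats the bad points as free integration variables, and for fixed
  \<open>b\<close> the function \<open>h\<close> and its mean \<open>hard_expectation h b\<close>
  have the same integral over the remaining points.\<close>

lemma bad_good_decomposition:
  assumes h[measurable]: "h \<in> borel_measurable (configs \<Otimes>\<^sub>M configs)"
  shows "(\<integral>\<^sup>+X. h (bad_points r X, X - bad_points r X) \<partial>N) = (\<integral>\<^sup>+X. hard_expectation h (bad_points r X) \<partial>N)"
proof -
  \<comment> \<open>\<open>adm\<close> marks the pairs that arise as the bad and good points of
    their union; it encodes the right side of \<open>bad_points_Un_eq_iff\<close>.\<close>
  define adm :: "(real ^ 2) set \<Rightarrow> (real ^ 2) set \<Rightarrow> ennreal" where
    "adm b Y = of_bool (b \<subseteq> bad_points r b \<and> hard r Y \<and> Y \<inter> resampling_set r b = {})" for b Y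
  define F where "F b Y = adm b Y * h (b, Y)" for b Y
  define G where "G b Y = adm b Y * hard_expectation h b" for b Y
  have cc[measurable]: "fst \<in> measurable (configs \<Otimes>\<^sub>M configs) configs" "snd \<in> measurable (configs \<Otimes>\<^sub>M configs) configs"
    by auto
  have pred1: "Measurable.pred (configs \<Otimes>\<^sub>M configs) (\<lambda>p. fst p \<subseteq> bad_points r (fst p))"
  proof -
    have ff: "(\<lambda>q. bad_points r (fst (fst q))) \<in> measurable ((configs \<Otimes>\<^sub>M configs) \<Otimes>\<^sub>M borel) configs"
      by (rule measurable_bad_points) measurable
    have "Measurable.pred ((configs \<Otimes>\<^sub>M configs) \<Otimes>\<^sub>M borel) (\<lambda>q. snd q \<in> bad_points r (fst (fst q)))"
      by (rule pred_mem_config[OF ff]) measurable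
    then have "Measurable.pred ((configs \<Otimes>\<^sub>M configs) \<Otimes>\<^sub>M borel) (\<lambda>q. \<not> snd q \<in> bad_points r (fst (fst q)))"
      by measurable
    then have "Measurable.pred (configs \<Otimes>\<^sub>M configs) (\<lambda>p. \<exists>x\<in>fst p. \<not> x \<in> bad_points r (fst p))"
      by (intro pred_ex_config) (simp_all add: case_prod_beta)
    then have "Measurable.pred (configs \<Otimes>\<^sub>M configs) (\<lambda>p. \<not> (\<exists>x\<in>fst p. \<not> x \<in> bad_points r (fst p)))"
      by measurable
    then show ?thesis by (simp add: subset_eq)
  qed
  have pred2: "Measurable.pred (configs \<Otimes>\<^sub>M configs) (\<lambda>p. snd p \<inter> resampling_set r (fst p) = {})"
  proof -
    have "Measurable.pred (configs \<Otimes>\<^sub>M configs) (\<lambda>p. \<exists>x\<in>snd p \<inter> resampling_set r (fst p). True)"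
      by (intro pred_ex_config measurable_config_Int_resampling_set) measurable
    then have "Measurable.pred (configs \<Otimes>\<^sub>M configs) (\<lambda>p. \<not> (\<exists>x\<in>snd p \<inter> resampling_set r (fst p). True))"
      by measurable
    moreover have "(\<not> (\<exists>x\<in>A. True)) = (A = {})" for A :: "(real ^ 2) set" by auto
    ultimately show ?thesis by (simp only:)
  qed
  have pred3: "Measurable.pred (configs \<Otimes>\<^sub>M configs) (\<lambda>p. hard r (snd p))"
    by (rule pred_hard) measurable
  have adm[measurable]: "(\<lambda>p. adm (fst p) (snd p)) \<in> borel_measurable (configs \<Otimes>\<^sub>M configs)"
    unfolding adm_def using pred1 pred2 pred3 by measurable
  have Fm: "(\<lambda>(b, Y). F b Y) \<in> borel_measurable (configs \<Otimes>\<^sub>M configs)"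
    and Gm: "(\<lambda>(b, Y). G b Y) \<in> borel_measurable (configs \<Otimes>\<^sub>M configs)"
    unfolding F_def G_def case_prod_beta by measurable
  have adm0: "bad_points r (b \<union> Y) = b" if "adm b Y \<noteq> 0" "b \<union> Y \<subseteq> unit_square" "b \<inter> Y = {}" for b Y
    using that bad_points_Un_eq_iff[OF that(2,3) r_pos] by (auto simp: adm_def)
  have adm1: "adm (bad_points r X) (X - bad_points r X) = 1" if "X \<in> space configs" for X
  proof -
    have "bad_points r X \<union> (X - bad_points r X) = X" using bad_points_subset[of r X] by auto
    then show ?thesis
      using that bad_points_Un_eq_iff[of "bad_points r X" "X - bad_points r X" r] r_pos
      by (auto simp: adm_def space_configs)
  qed
  \<comment> \<open>Splitting at the resampling set of \<open>b\<close>: being empty there is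
    independent of what happens outside, so it contributes a factor that is the same for every
    \<open>k\<close>.\<close>
  have void: "(\<integral>\<^sup>+Y. adm b Y * k (b, Y) \<partial>N) = of_bool (b \<subseteq> bad_points r b)
      * (\<integral>\<^sup>+Y. of_bool (Y \<inter> resampling_set r b = {}) \<partial>N)
      * (\<integral>\<^sup>+Y. of_bool (hard r (Y - resampling_set r b)) * k (b, Y - resampling_set r b) \<partial>N)"
    if b: "b \<in> space configs" and k[measurable]: "k \<in> borel_measurable (configs \<Otimes>\<^sub>M configs)" for b k
  proof -
    let ?S = "resampling_set r b"
    have S[measurable]: "?S \<in> sets borel" by (rule configs_resampling_borel[OF b])
    have Pm: "Measurable.pred configs (\<lambda>Y. Y = {})"
    proof -
      have "Measurable.pred configs (\<lambda>Y. \<not> (\<exists>y\<in>Y. True))"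
        by (intro pred_intros_logic pred_ex_config) auto
      then show ?thesis by (simp add: ex_in_conv)
    qed
    have [measurable]: "Measurable.pred configs (\<lambda>Y. hard r Y)" by (rule pred_hard) simp
    have [measurable]: "(\<lambda>Y. k (b, Y)) \<in> borel_measurable configs"
      using b by measurable
    have g: "(\<lambda>p. of_bool (fst p = {}) * (of_bool (hard r (snd p)) * k (b, snd p)) :: ennreal)
        \<in> borel_measurable (configs \<Otimes>\<^sub>M configs)"
      using Pm by measurable
    have NS[measurable]: "(\<lambda>Y. Y - ?S) \<in> measurable N configs" "(\<lambda>Y. Y \<inter> ?S) \<in> measurable N configs"
      by (auto intro!: measurable_config_fixed measurable_ident_sets sets_N)
    have "(\<integral>\<^sup>+Y. adm b Y * k (b, Y) \<partial>N) = (\<integral>\<^sup>+Y. of_bool (b \<subseteq> bad_points r b) *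
        (of_bool (Y \<inter> ?S = {}) * (of_bool (hard r (Y - ?S)) * k (b, Y - ?S))) \<partial>N)"
      by (intro nn_integral_cong) (auto simp: adm_def Diff_triv)
    also have "\<dots> = of_bool (b \<subseteq> bad_points r b) *
        (\<integral>\<^sup>+Y. of_bool (Y \<inter> ?S = {}) * (of_bool (hard r (Y - ?S)) * k (b, Y - ?S)) \<partial>N)"
      by (cases "b \<subseteq> bad_points r b") auto
    also have "(\<integral>\<^sup>+Y. of_bool (Y \<inter> ?S = {}) * (of_bool (hard r (Y - ?S)) * k (b, Y - ?S)) \<partial>N)
      = (\<integral>\<^sup>+Y. \<integral>\<^sup>+X. of_bool (Y \<inter> ?S = {}) * (of_bool (hard r (X - ?S)) * k (b, X - ?S)) \<partial>N \<partial>N)"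
      using nn_integral_poisson_process_split[OF poisson S g] by simp
    also have "\<dots> = (\<integral>\<^sup>+Y. of_bool (Y \<inter> ?S = {}) * (\<integral>\<^sup>+X. of_bool (hard r (X - ?S)) * k (b, X - ?S) \<partial>N) \<partial>N)"
    proof (intro nn_integral_cong nn_integral_cmult)
      have "(\<lambda>X. of_bool (hard r X) * k (b, X)) \<in> borel_measurable configs" by measurable
      then show "(\<lambda>X. of_bool (hard r (X - ?S)) * k (b, X - ?S)) \<in> borel_measurable N"
        by (rule measurable_compose[OF NS(1)])
    qed
    also have "\<dots> = (\<integral>\<^sup>+Y. of_bool (Y \<inter> ?S = {}) \<partial>N) * (\<integral>\<^sup>+X. of_bool (hard r (X - ?S)) * k (b, X - ?S) \<partial>N)"
    proof (rule nn_integral_multc)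
      have "(\<lambda>Y. of_bool (Y = {}) :: ennreal) \<in> borel_measurable configs" using Pm by measurable
      then show "(\<lambda>Y. of_bool (Y \<inter> ?S = {}) :: ennreal) \<in> borel_measurable N"
        by (rule measurable_compose[OF NS(2)])
    qed
    finally show ?thesis by (simp add: mult.assoc)
  qed
  have eq: "(\<integral>\<^sup>+Y. F b Y \<partial>N) = (\<integral>\<^sup>+Y. G b Y \<partial>N)" if b: "b \<in> space configs" for b
  proof -
    have [measurable]: "(\<lambda>p. hard_expectation h (fst p)) \<in> borel_measurable (configs \<Otimes>\<^sub>M configs)"
      by measurable
    have S[measurable]: "resampling_set r b \<in> sets borel" by (rule configs_resampling_borel[OF b])
    have NS: "(\<lambda>Y. Y - resampling_set r b) \<in> measurable N configs"
      by (auto intro!: measurable_config_fixed measurable_ident_sets sets_N)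
    have "(\<lambda>Y. of_bool (hard r (Y - resampling_set r b)) :: ennreal) \<in> borel_measurable N"
      using pred_hard[OF NS, of r] by measurable
    then have "(\<integral>\<^sup>+Y. of_bool (hard r (Y - resampling_set r b)) * hard_expectation h b \<partial>N)
        = hard_expectation h b * partition_function b"
      by (subst nn_integral_multc) (auto simp: partition_function_def mult.commute)
    then have "(\<integral>\<^sup>+Y. of_bool (hard r (Y - resampling_set r b)) * hard_expectation h b \<partial>N)
        = (\<integral>\<^sup>+X. of_bool (hard r (X - resampling_set r b)) * h (b, X - resampling_set r b) \<partial>N)"
      by (simp add: hard_expectation_mult[OF b])
    then show ?thesis unfolding F_def G_def
      using void[OF b h] void[OF b, of "\<lambda>p. hard_expectation h (fst p)"] by simp
  qed
  have sum_eq: "tuple_sum H n {} X = fact n * (of_bool (card (bad_points r X) = n) * H (bad_points r X) (X - bad_points r X))"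
    if "X \<in> space configs" "\<And>b Y. H b Y \<noteq> 0 \<Longrightarrow> adm b Y \<noteq> 0" for H X n
  proof -
    have "bad_points r (b \<union> Y) = b" if "H b Y \<noteq> 0" "b \<union> Y \<subseteq> unit_square" "b \<inter> Y = {}" for b Y
      using adm0[of b Y] that \<open>\<And>b Y. H b Y \<noteq> 0 \<Longrightarrow> adm b Y \<noteq> 0\<close> by blast
    then show ?thesis
      using that(1) by (subst tuple_sum_bad_points[of H r X "{}" X n]) (simp_all add: space_configs)
  qed
  have badm[measurable]: "(\<lambda>X. bad_points r X) \<in> measurable N configs"
    by (intro measurable_bad_points measurable_ident_sets sets_N)
  have goodm[measurable]: "(\<lambda>X. X - bad_points r X) \<in> measurable N configs"
    by (intro measurable_config_Diff measurable_bad_points measurable_ident_sets sets_N)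
  have [measurable]: "(\<lambda>X. card (bad_points r X)) \<in> measurable N (count_space UNIV)"
    using measurable_compose[OF badm measurable_card_Int[of UNIV]] by simp
  have hm: "(\<lambda>X. h (bad_points r X, X - bad_points r X)) \<in> borel_measurable N"
    and em: "(\<lambda>X. hard_expectation h (bad_points r X)) \<in> borel_measurable N"
    by measurable
  have cmult: "(\<integral>\<^sup>+X. fact n * (of_bool (card (bad_points r X) = n) * g X) \<partial>N)
      = fact n * (\<integral>\<^sup>+X. of_bool (card (bad_points r X) = n) * g X \<partial>N)"
    if [measurable]: "g \<in> borel_measurable N" for n and g :: "(real ^ 2) set \<Rightarrow> ennreal"
    by (rule nn_integral_cmult) measurable
  have level: "(\<integral>\<^sup>+X. of_bool (card (bad_points r X) = n) * h (bad_points r X, X - bad_points r X) \<partial>N)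
    = (\<integral>\<^sup>+X. of_bool (card (bad_points r X) = n) * hard_expectation h (bad_points r X) \<partial>N)" for n
  proof -
    have "(\<integral>\<^sup>+X. tuple_sum F n {} X \<partial>N) = (\<integral>\<^sup>+X. tuple_sum G n {} X \<partial>N)"
      by (rule tuple_sum_integral_cong[OF Fm Gm eq]) (auto simp: space_configs)
    also have "(\<integral>\<^sup>+X. tuple_sum F n {} X \<partial>N)
        = (\<integral>\<^sup>+X. fact n * (of_bool (card (bad_points r X) = n) * h (bad_points r X, X - bad_points r X)) \<partial>N)"
      by (intro nn_integral_cong, subst sum_eq) (auto simp: F_def adm1 space_N)
    also have "(\<integral>\<^sup>+X. tuple_sum G n {} X \<partial>N)
        = (\<integral>\<^sup>+X. fact n * (of_bool (card (bad_points r X) = n) * hard_expectation h (bad_points r X)) \<partial>N)"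
      by (intro nn_integral_cong, subst sum_eq) (auto simp: G_def adm1 space_N)
    finally have "fact n * (\<integral>\<^sup>+X. of_bool (card (bad_points r X) = n) * h (bad_points r X, X - bad_points r X) \<partial>N)
       = fact n * (\<integral>\<^sup>+X. of_bool (card (bad_points r X) = n) * hard_expectation h (bad_points r X) \<partial>N)"
      by (simp only: cmult[OF hm] cmult[OF em])
    moreover have fact_eq: "(fact n :: ennreal) = of_nat (fact n)" by simp
    have "(fact n :: ennreal) \<noteq> \<top>" "(fact n :: ennreal) \<noteq> 0"
      unfolding fact_eq by (simp_all del: of_nat_fact)
    ultimately show ?thesis by (simp add: ennreal_mult_cancel_left)
  qed
  have decomp: "(\<integral>\<^sup>+X. g X \<partial>N) = (\<Sum>n. \<integral>\<^sup>+X. of_bool (card (bad_points r X) = n) * g X \<partial>N)"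
    if [measurable]: "g \<in> borel_measurable N" for g :: "(real ^ 2) set \<Rightarrow> ennreal"
  proof -
    have "g X = (\<Sum>n. of_bool (card (bad_points r X) = n) * g X)" for X
      by (subst suminf_finite[of "{card (bad_points r X)}"]) auto
    then have "(\<integral>\<^sup>+X. g X \<partial>N) = (\<integral>\<^sup>+X. (\<Sum>n. of_bool (card (bad_points r X) = n) * g X) \<partial>N)"
      by (rule nn_integral_cong)
    also have "\<dots> = (\<Sum>n. \<integral>\<^sup>+X. of_bool (card (bad_points r X) = n) * g X \<partial>N)"
      by (rule nn_integral_suminf) measurable
    finally show ?thesis .
  qed
  show ?thesis
    unfolding decomp[OF hm] decomp[OF em] level ..
qed

end

section \<open>Areas of overlapping disks\<close>

lemma measure_lborel_ball: "0 \<le> R \<Longrightarrow> measure lborel (ball z R :: (real ^ 2) set) = pi * R\<^sup>2"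
  by (simp add: content_ball unit_ball_vol_2 mult.commute)

lemma emeasure_lborel_ball: "0 \<le> R \<Longrightarrow> emeasure lborel (ball z R :: (real ^ 2) set) = ennreal (pi * R\<^sup>2)"
  by (simp add: emeasure_ball unit_ball_vol_2)

lemma measure_translate_lborel:
  fixes S :: "'a :: euclidean_space set"
  assumes "S \<in> sets borel" "(+) a ` S \<in> sets borel"
  shows "measure lborel ((+) a ` S) = measure lborel S"
  using measure_translation[of a S] assms by simp

text \<open>Translates by multiples of an axis vector \<open>a\<close>: by convexity of the disk the sets
  \<open>k a + (ball 0 R - ball a R)\<close> are disjoint, and the first \<open>n\<close> of them lie in a box of area
  \<open>(n \<bar>a\<bar> + 2 R) 2 R\<close>.\<close>

lemma ball_Diff_ball_axis:
  fixes R \<rho> :: real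
  assumes R: "0 < R" and \<rho>: "0 < \<rho>"
  shows "measure lborel (ball 0 R - ball (axis 1 \<rho>) R :: (real ^ 2) set) \<le> 2 * R * \<rho>"
proof -
  define a :: "real ^ 2" where "a = axis 1 \<rho>"
  define E where "E k = ball (real k *\<^sub>R a) R - ball (real (Suc k) *\<^sub>R a) R" for k
  have Eb: "E k \<in> sets borel" for k by (auto simp: E_def)
  have Ef: "E k \<in> fmeasurable lborel" for k
  proof (rule fmeasurableI2)
    show "ball (real k *\<^sub>R a) R \<in> fmeasurable lborel"
      using R by (intro fmeasurableI) (auto simp: emeasure_lborel_ball)
  qed (use Eb in \<open>auto simp: E_def\<close>)
  have E0: "measure lborel (E k) = measure lborel (E 0)" for k
  proof -
    have "(+) (real k *\<^sub>R a) ` E 0 = E k"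
    proof (intro set_eqI iffI)
      fix x assume "x \<in> (+) (real k *\<^sub>R a) ` E 0"
      then show "x \<in> E k" by (auto simp: E_def dist_norm algebra_simps)
    next
      fix x assume "x \<in> E k"
      then have "x - real k *\<^sub>R a \<in> E 0" by (auto simp: E_def dist_norm algebra_simps)
      then show "x \<in> (+) (real k *\<^sub>R a) ` E 0" by (intro image_eqI[of _ _ "x - real k *\<^sub>R a"]) auto
    qed
    then show ?thesis using measure_translate_lborel[OF Eb, of "real k *\<^sub>R a" 0] Eb by simp
  qed
  have disj: "E j \<inter> E k = {}" if "j < k" for j k
  proof (rule ccontr)
    assume "E j \<inter> E k \<noteq> {}"
    then obtain x where x: "x \<in> ball (real j *\<^sub>R a) R" "x \<notin> ball (real (Suc j) *\<^sub>R a) R"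
      "x \<in> ball (real k *\<^sub>R a) R" by (auto simp: E_def)
    \<comment> \<open>The weight \<open>t\<close> puts the convex combination of the centers
      numbered \<open>j\<close> and \<open>k\<close> exactly at center \<open>j + 1\<close>: a point
      within \<open>R\<close> of the two outer centers is within \<open>R\<close> of this
      one.\<close>
    define t where "t = 1 / (real k - real j)"
    have t: "0 \<le> t" "t \<le> 1" "t * (real k - real j) = 1" using that by (auto simp: t_def field_simps)
    have "(1 - t) * real j + t * real k = real (Suc j)" using t(3) by (simp add: algebra_simps)
    then have "(1 - t) *\<^sub>R real j *\<^sub>R a + t *\<^sub>R real k *\<^sub>R a = real (Suc j) *\<^sub>R a"
      by (metis scaleR_left.add scaleR_scaleR)
    moreover have "(1 - t) *\<^sub>R real j *\<^sub>R a + t *\<^sub>R real k *\<^sub>R a \<in> ball x R"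
      using convexD_alt[OF convex_ball, of "real j *\<^sub>R a" x R "real k *\<^sub>R a" t] x t
      by (auto simp: dist_commute)
    ultimately show False using x by (simp add: dist_commute)
  qed
  have bound: "real n * measure lborel (E 0) \<le> (real n * \<rho> + 2 * R) * (2 * R)" for n
  proof -
    let ?b = "cbox (vector [- R, - R]) (vector [real n * \<rho> + R, R]) :: (real ^ 2) set"
    have "(\<Sum>k<n. measure lborel (E k)) = (\<Sum>k<n. measure lborel (E 0))"
      by (intro sum.cong refl E0)
    then have "real n * measure lborel (E 0) = (\<Sum>k<n. measure lborel (E k))"
      by simp
    also have "\<dots> = measure lborel (\<Union>k<n. E k)"
    proof (rule measure_finite_Union[symmetric])
      show "disjoint_family_on E {..<n}"
        unfolding disjoint_family_on_def
      proof (intro ballI impI)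
        fix j k :: nat assume "j \<noteq> k"
        then show "E j \<inter> E k = {}"
          using disj[of j k] disj[of k j] by (cases "j < k") auto
      qed
      show "emeasure lborel (E k) \<noteq> \<infinity>" for k
        using Ef[of k] by (simp add: fmeasurable_def less_top)
    qed (use Eb in auto)
    also have "\<dots> \<le> measure lborel ?b"
    proof (rule measure_mono_fmeasurable)
      show "(\<Union>k<n. E k) \<subseteq> ?b"
      proof (clarify)
        fix x k assume "k < n" "x \<in> E k"
        then have d: "norm (real k *\<^sub>R a - x) < R" by (auto simp: E_def dist_norm)
        have "\<bar>(real k *\<^sub>R a - x) $ 1\<bar> < R" "\<bar>(real k *\<^sub>R a - x) $ 2\<bar> < R"
          using component_le_norm_cart[of "real k *\<^sub>R a - x"] d by (meson le_less_trans)+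
        then have "\<bar>real k * \<rho> - x $ 1\<bar> < R" "\<bar>x $ 2\<bar> < R" by (auto simp: a_def axis_def)
        moreover have "0 \<le> real k * \<rho>" "real k * \<rho> \<le> real n * \<rho>" using \<open>k < n\<close> \<rho> by auto
        ultimately show "x \<in> ?b" by (auto simp: mem_box_cart forall_2)
      qed
      show "(\<Union>k<n. E k) \<in> sets lborel" using Eb by auto
      show "?b \<in> fmeasurable lborel"
        by (intro fmeasurableI emeasure_lborel_cbox_finite) auto
    qed
    also have "\<dots> \<le> (real n * \<rho> + 2 * R) * (2 * R)"
      using R \<rho> by (auto simp: content_cbox_if_cart prod_2 algebra_simps UNIV_2)
    finally show ?thesis .
  qed
  have "measure lborel (E 0) \<le> 2 * R * \<rho> + e" if "0 < e" for e
  proof -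
    \<comment> \<open>The bound for \<open>n\<close> pieces carries a fixed boundary term
      \<open>4 * R\<^sup>2\<close>; for this \<open>n\<close> its share per piece is at most
      \<open>e\<close>.\<close>
    obtain n where n: "4 * R\<^sup>2 / e < real n" using reals_Archimedean2 by blast
    have "0 < real n" using n R that by (smt (verit) divide_pos_pos zero_less_power)
    have "4 * R\<^sup>2 \<le> real n * e" using n that by (simp add: field_simps)
    then have "real n * measure lborel (E 0) \<le> real n * (2 * R * \<rho> + e)"
      using bound[of n] by (simp add: algebra_simps power2_eq_square)
    then show ?thesis using \<open>0 < real n\<close> by simp
  qed
  then have "measure lborel (E 0) \<le> 2 * R * \<rho>" by (rule field_le_epsilon)
  then show ?thesis by (simp add: E_def a_def)
qed

text \<open>Rotation and translation bring the two centers to the axis position. The factor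
  \<open>2 * R\<close> is the diameter, the width of the strip swept by the moving disk.\<close>

lemma ball_Diff_ball_measure:
  fixes y z :: "real ^ 2"
  assumes R: "0 < R"
  shows "measure lborel (ball y R - ball z R) \<le> 2 * R * dist y z"
proof (cases "y = z")
  case False
  define \<rho> where "\<rho> = norm (z - y)"
  have \<rho>: "0 < \<rho>" using False by (simp add: \<rho>_def)
  have "(axis 1 \<rho> :: real ^ 2) = \<rho> *\<^sub>R axis 1 (1 :: real)" by (simp add: axis_def vec_eq_iff)
  then have "norm (axis 1 \<rho> :: real ^ 2) = \<rho>" using \<rho> by simp
  then have "norm (axis 1 \<rho> :: real ^ 2) = norm (z - y)" by (simp only: \<rho>_def)
  then obtain f where f: "orthogonal_transformation f" "f (axis 1 \<rho> :: real ^ 2) = z - y"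
    by (rule orthogonal_transformation_exists)
  have fm: "ball 0 R - ball (axis 1 \<rho> :: real ^ 2) R \<in> lmeasurable"
    by (intro fmeasurable.Diff) auto
  have "f ` (ball 0 R - ball (axis 1 \<rho>) R) = ball 0 R - ball (z - y) R"
    using f by (simp add: image_set_diff[OF orthogonal_transformation_inj[OF f(1)]]
       image_orthogonal_transformation_ball linear_0[OF orthogonal_transformation_linear[OF f(1)]])
  then have "measure lebesgue (ball 0 R - ball (z - y) R) = measure lebesgue (ball 0 R - ball (axis 1 \<rho> :: real ^ 2) R)"
    using measure_orthogonal_image[OF f(1) fm] by simp
  then have "measure lborel (ball 0 R - ball (z - y) R) \<le> 2 * R * \<rho>"
    using ball_Diff_ball_axis[OF R \<rho>] by simp
  moreover have "ball y R - ball z R = (+) y ` (ball 0 R - ball (z - y) R)"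
  proof (intro set_eqI iffI)
    fix x assume "x \<in> ball y R - ball z R"
    then show "x \<in> (+) y ` (ball 0 R - ball (z - y) R)"
      by (intro image_eqI[of _ _ "x - y"]) (auto simp: dist_norm algebra_simps norm_minus_commute)
  qed (auto simp: dist_norm algebra_simps norm_minus_commute)
  moreover have "ball y R - ball z R \<in> sets borel" by auto
  ultimately show ?thesis
    using measure_translate_lborel[of "ball 0 R - ball (z - y) R" y]
    by (simp add: \<rho>_def dist_norm norm_minus_commute)
qed simp

text \<open>The right side rounds the distance up to the next multiple of \<open>R / 10\<close>: if
  \<open>m\<close> full steps fit, the indices from \<open>0\<close> to \<open>m\<close> contribute.
  It replaces integration in polar coordinates by areas of annuli.\<close>

lemma dist_le_annuli:
  fixes x z :: "'a :: metric_space"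
  assumes R: "0 < R" and d: "dist z x < R"
  shows "dist z x \<le> R / 10 * (\<Sum>k<10::nat. of_bool (real k * R / 10 \<le> dist z x))"
proof -
  define m where "m = nat \<lfloor>10 * dist z x / R\<rfloor>"
  have "0 \<le> 10 * dist z x / R" using R by simp
  then have m: "real m \<le> 10 * dist z x / R" "10 * dist z x / R < real m + 1"
    by (auto simp: m_def)
  have "10 * dist z x / R < 10" using d R by (simp add: field_simps)
  then have "m < 10" using m by linarith
  have "real k * R / 10 \<le> dist z x" if "k \<le> m" for k
  proof -
    have "real k \<le> 10 * dist z x / R" using m(1) that by linarith
    then show ?thesis using R by (simp add: field_simps)
  qed
  then have "(\<Sum>k<Suc m. 1 :: real) \<le> (\<Sum>k<Suc m. of_bool (real k * R / 10 \<le> dist z x))"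
    by (intro sum_mono) auto
  also have "\<dots> \<le> (\<Sum>k<10::nat. of_bool (real k * R / 10 \<le> dist z x))"
    using \<open>m < 10\<close> by (intro sum_mono2) auto
  finally have "10 * dist z x / R \<le> (\<Sum>k<10::nat. of_bool (real k * R / 10 \<le> dist z x))"
    using m(2) by simp
  then show ?thesis using R by (simp add: field_simps)
qed

text \<open>An upper Riemann sum over ten annuli. The constant is the mean of
  \<open>1 - k\<^sup>2 / 100\<close> over \<open>k < 10\<close>, that is
  \<open>1 - 285 / 1000\<close>, where the exact integral has \<open>2 / 3\<close>.\<close>

lemma nn_integral_dist_ball:
  fixes z :: "real ^ 2"
  assumes R: "0 < R"
  shows "(\<integral>\<^sup>+x\<in>ball z R. ennreal (dist z x) \<partial>lborel) \<le> ennreal (143 / 200 * pi * R ^ 3)"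
proof -
  have [measurable]: "ball u s \<in> sets borel" for u :: "real ^ 2" and s by simp
  let ?A = "\<lambda>k :: nat. ball z R - ball z (real k * R / 10)"
  have "(\<integral>\<^sup>+x\<in>ball z R. ennreal (dist z x) \<partial>lborel)
      \<le> (\<integral>\<^sup>+x. (\<Sum>k<10. ennreal (R / 10) * indicator (?A k) x) \<partial>lborel)"
  proof (intro nn_integral_mono)
    fix x
    show "ennreal (dist z x) * indicator (ball z R) x \<le> (\<Sum>k<10. ennreal (R / 10) * indicator (?A k) x)"
    proof (cases "x \<in> ball z R")
      case True
      then have "ennreal (dist z x) \<le> ennreal (R / 10 * (\<Sum>k<10::nat. of_bool (real k * R / 10 \<le> dist z x)))"
        by (intro ennreal_leI dist_le_annuli[OF R]) simp
      also have "\<dots> = (\<Sum>k<10::nat. ennreal (R / 10 * of_bool (real k * R / 10 \<le> dist z x)))"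
        unfolding sum_distrib_left using R by (intro sum_ennreal[symmetric]) auto
      also have "\<dots> = (\<Sum>k<10. ennreal (R / 10) * indicator (?A k) x)"
        using True by (intro sum.cong) (auto simp: indicator_def)
      finally show ?thesis using True by simp
    qed simp
  qed
  also have "\<dots> = (\<Sum>k<10. ennreal (R / 10) * emeasure lborel (?A k))"
    by (subst nn_integral_sum) (measurable, auto simp: nn_integral_cmult)
  also have "\<dots> = (\<Sum>k<10::nat. ennreal (R / 10 * (pi * R\<^sup>2 - pi * (real k * R / 10)\<^sup>2)))"
  proof (intro sum.cong refl)
    fix k :: nat assume "k \<in> {..<10}"
    then have k: "real k * R / 10 \<le> R" using R by auto
    have "emeasure lborel (?A k) = emeasure lborel (ball z R) - emeasure lborel (ball z (real k * R / 10))"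
      using k R by (intro emeasure_Diff) (auto simp: emeasure_lborel_ball subset_ball)
    also have "\<dots> = ennreal (pi * R\<^sup>2 - pi * (real k * R / 10)\<^sup>2)"
      using R by (simp add: emeasure_lborel_ball ennreal_minus)
    finally have eq: "emeasure lborel (?A k) = ennreal (pi * R\<^sup>2 - pi * (real k * R / 10)\<^sup>2)" .
    show "ennreal (R / 10) * emeasure lborel (?A k)
       = ennreal (R / 10 * (pi * R\<^sup>2 - pi * (real k * R / 10)\<^sup>2))"
      unfolding eq by (rule ennreal_mult'[symmetric]) (use R in simp)
  qed
  also have "\<dots> = ennreal (\<Sum>k<10::nat. R / 10 * (pi * R\<^sup>2 - pi * (real k * R / 10)\<^sup>2))"
  proof (rule sum_ennreal)
    fix k :: nat assume "k \<in> {..<10}"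
    then have "(real k * R / 10)\<^sup>2 \<le> R\<^sup>2" using R by (intro power_mono) auto
    then show "0 \<le> R / 10 * (pi * R\<^sup>2 - pi * (real k * R / 10)\<^sup>2)"
      using R by (intro mult_nonneg_nonneg) (auto simp: right_diff_distrib[symmetric])
  qed
  also have "(\<Sum>k<10::nat. R / 10 * (pi * R\<^sup>2 - pi * (real k * R / 10)\<^sup>2)) = 143 / 200 * pi * R ^ 3"
    by (simp add: eval_nat_numeral lessThan_Suc field_simps)
  finally show ?thesis .
qed

text \<open>Tonelli exchanges the roles: for fixed \<open>y\<close> in \<open>ball z R\<close> the
  points \<open>x\<close> range over \<open>ball y R - ball z R\<close>, a set of area at most
  \<open>2 * R * dist z y\<close>. What remains is the integral of the distance over the
  disk.\<close>

lemma nn_integral_lens_outside: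
  fixes z :: "real ^ 2"
  assumes R: "0 < R"
  shows "(\<integral>\<^sup>+x\<in>- ball z R. emeasure lborel (ball x R \<inter> ball z R) \<partial>lborel) \<le> ennreal (143 / 100 * pi * R ^ 4)"
proof -
  have [measurable]: "ball u s \<in> sets borel" for u :: "real ^ 2" and s by simp
  have ind: "(\<integral>\<^sup>+y. indicator A y * s \<partial>lborel) = emeasure lborel A * s" if "A \<in> sets borel"
    for A :: "(real ^ 2) set" and s :: ennreal
    using that by (simp add: nn_integral_multc)
  have m: "(\<lambda>(x, y). of_bool (dist z y < R) * of_bool (R \<le> dist z x) * of_bool (dist x y < R) :: ennreal)
      \<in> borel_measurable (lborel \<Otimes>\<^sub>M lborel)"
  proof -
    have "(\<lambda>(x, y). of_bool (dist z y < R) * of_bool (R \<le> dist z x) * of_bool (dist x y < R) :: ennreal)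
      \<in> borel_measurable (borel \<Otimes>\<^sub>M borel)" by measurable
    then show ?thesis by (simp cong: measurable_cong_sets)
  qed
  have "(\<integral>\<^sup>+x\<in>- ball z R. emeasure lborel (ball x R \<inter> ball z R) \<partial>lborel)
      = (\<integral>\<^sup>+x. \<integral>\<^sup>+y. of_bool (dist z y < R) * of_bool (R \<le> dist z x) * of_bool (dist x y < R) \<partial>lborel \<partial>lborel)"
  proof (intro nn_integral_cong)
    fix x
    have "emeasure lborel (ball x R \<inter> ball z R) * indicator (- ball z R) x
        = (\<integral>\<^sup>+y. indicator (ball x R \<inter> ball z R) y * indicator (- ball z R) x \<partial>lborel)"
      by (rule ind[symmetric]) measurable
    also have "\<dots> = (\<integral>\<^sup>+y. of_bool (dist z y < R) * of_bool (R \<le> dist z x) * of_bool (dist x y < R) \<partial>lborel)"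
      by (intro nn_integral_cong) (auto simp: indicator_def)
    finally show "emeasure lborel (ball x R \<inter> ball z R) * indicator (- ball z R) x
        = (\<integral>\<^sup>+y. of_bool (dist z y < R) * of_bool (R \<le> dist z x) * of_bool (dist x y < R) \<partial>lborel)" .
  qed
  also have "\<dots> = (\<integral>\<^sup>+y. \<integral>\<^sup>+x. of_bool (dist z y < R) * of_bool (R \<le> dist z x) * of_bool (dist x y < R) \<partial>lborel \<partial>lborel)"
    by (rule lborel_pair.Fubini'[OF m, symmetric])
  also have "\<dots> = (\<integral>\<^sup>+y\<in>ball z R. emeasure lborel (ball y R - ball z R) \<partial>lborel)"
  proof (intro nn_integral_cong)
    fix y
    have "emeasure lborel (ball y R - ball z R) * indicator (ball z R) y
        = (\<integral>\<^sup>+x. indicator (ball y R - ball z R) x * indicator (ball z R) y \<partial>lborel)"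
      by (rule ind[symmetric]) measurable
    also have "\<dots> = (\<integral>\<^sup>+x. of_bool (dist z y < R) * of_bool (R \<le> dist z x) * of_bool (dist x y < R) \<partial>lborel)"
      by (intro nn_integral_cong) (auto simp: indicator_def dist_commute)
    finally show "(\<integral>\<^sup>+x. of_bool (dist z y < R) * of_bool (R \<le> dist z x) * of_bool (dist x y < R) \<partial>lborel)
      = emeasure lborel (ball y R - ball z R) * indicator (ball z R) y" ..
  qed
  also have "\<dots> \<le> (\<integral>\<^sup>+y. ennreal (2 * R) * (ennreal (dist z y) * indicator (ball z R) y) \<partial>lborel)"
  proof (intro nn_integral_mono)
    fix y
    have "emeasure lborel (ball y R - ball z R) \<le> emeasure lborel (ball y R)"
      by (intro emeasure_mono) auto
    also have "\<dots> < \<infinity>" using R by (simp add: emeasure_lborel_ball)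
    finally have "emeasure lborel (ball y R - ball z R) = ennreal (measure lborel (ball y R - ball z R))"
      by (intro emeasure_eq_ennreal_measure) auto
    also have "\<dots> \<le> ennreal (2 * R * dist z y)"
      using ball_Diff_ball_measure[OF R, of y z] by (intro ennreal_leI) (simp add: dist_commute)
    also have "\<dots> = ennreal (2 * R) * ennreal (dist z y)" using R by (intro ennreal_mult) auto
    finally show "emeasure lborel (ball y R - ball z R) * indicator (ball z R) y
      \<le> ennreal (2 * R) * (ennreal (dist z y) * indicator (ball z R) y)"
      by (cases "y \<in> ball z R") auto
  qed
  also have "\<dots> = ennreal (2 * R) * (\<integral>\<^sup>+y\<in>ball z R. ennreal (dist z y) \<partial>lborel)"
    by (rule nn_integral_cmult) measurable
  also have "\<dots> \<le> ennreal (2 * R) * ennreal (143 / 200 * pi * R ^ 3)"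
    by (intro mult_left_mono nn_integral_dist_ball[OF R]) simp
  also have "\<dots> = ennreal (143 / 100 * pi * R ^ 4)"
    using R by (subst ennreal_mult[symmetric]) (auto simp: power4_eq_xxxx power3_eq_cube field_simps)
  finally show ?thesis .
qed

section \<open>The expected number of bad points after a round\<close>

lemma borel_measurable_lens_area:
  fixes z :: "real ^ 2"
  shows "(\<lambda>x. emeasure lborel (ball x R \<inter> ball z R)) \<in> borel_measurable borel"
proof -
  have "emeasure lborel (ball x R \<inter> ball z R) = (\<integral>\<^sup>+y. of_bool (dist x y < R \<and> dist z y < R) \<partial>lborel)"
    for x
  proof -
    have "emeasure lborel (ball x R \<inter> ball z R) = (\<integral>\<^sup>+y. indicator (ball x R \<inter> ball z R) y \<partial>lborel)"
      by (intro nn_integral_indicator[symmetric]) (simp add: sets.Int)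
    then show ?thesis by (simp add: indicator_def of_bool_def)
  qed
  moreover have "(\<lambda>x. \<integral>\<^sup>+y. of_bool (dist x y < R \<and> dist z y < R) \<partial>lborel) \<in> borel_measurable borel"
    by measurable
  ultimately show ?thesis by simp
qed

context hard_disks
begin

lemma measurable_hard_Diff_fixed:
  assumes S: "S \<in> sets borel"
  shows "Measurable.pred N (\<lambda>Y. hard r (Y - S))"
  by (intro pred_hard measurable_config_fixed measurable_ident_sets sets_N S)

lemma pred_config_empty: "Measurable.pred configs (\<lambda>Y. Y = {})"
proof -
  have "Measurable.pred configs (\<lambda>Y. \<not> (\<exists>y\<in>Y. True))"
    by (intro pred_intros_logic pred_ex_config) auto
  then show ?thesis by (simp add: ex_in_conv)
qed

lemma pred_void:
  assumes S: "S \<in> sets borel"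
  shows "Measurable.pred N (\<lambda>Y. Y \<inter> S = {})"
proof -
  have "(\<lambda>Y. Y \<inter> S) \<in> measurable N configs"
    by (intro measurable_config_fixed measurable_ident_sets sets_N S)
  from measurable_compose[OF this pred_config_empty] show ?thesis by simp
qed

lemma nn_integral_void:
  assumes D: "D \<in> sets borel"
  shows "(\<integral>\<^sup>+Y. of_bool (Y \<inter> D = {}) \<partial>N) = ennreal (exp (- (c * area D)))"
proof -
  note [measurable] = pred_void[OF D]
  have "(\<integral>\<^sup>+Y. of_bool (Y \<inter> D = {}) \<partial>N) = (\<integral>\<^sup>+Y. indicator {Y\<in>space N. Y \<inter> D = {}} Y \<partial>N)"
    by (intro nn_integral_cong) (auto simp: indicator_def)
  also have "\<dots> = emeasure N {Y\<in>space N. Y \<inter> D = {}}"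
    by (intro nn_integral_indicator) measurable
  finally show ?thesis by (simp add: void_probability[OF D])
qed

text \<open>Passes from a lower bound for the complementary event to an upper bound for the event;
  the total \<open>Z\<close> must be finite to subtract in \<open>ennreal\<close>.\<close>

lemma ennreal_le_of_add_le:
  fixes A Z :: ennreal
  assumes "A + B = Z" "ennreal p * Z \<le> B" "0 \<le> p" "p \<le> 1" "Z \<noteq> \<top>"
  shows "A \<le> ennreal (1 - p) * Z"
proof -
  have fin: "ennreal p * Z \<noteq> \<top>" using assms(5) by (simp add: ennreal_mult_eq_top_iff)
  have "A + ennreal p * Z \<le> Z" using assms(1,2) by (metis add_left_mono)
  also have "Z = ennreal (1 - p) * Z + ennreal p * Z"
    using assms(3,4) by (simp add: distrib_right[symmetric] ennreal_plus[symmetric] del: ennreal_plus)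
  finally show ?thesis
    using fin by (simp add: add.commute[of _ "ennreal p * Z"] ennreal_add_left_cancel_le)
qed

text \<open>Emptying \<open>D\<close> can only help the configuration to be hard, hence the hard configuration leaves
  \<open>D\<close> empty with at least the Poisson probability.\<close>

lemma hard_hit_inside:
  assumes S: "S \<in> sets borel" and D: "D \<in> sets borel"
  shows "(\<integral>\<^sup>+Y. of_bool (hard r (Y - S)) * of_bool (Y \<inter> D \<noteq> {}) \<partial>N)
    \<le> ennreal (1 - exp (- (c * area D))) * (\<integral>\<^sup>+Y. of_bool (hard r (Y - S)) \<partial>N)"
proof (rule ennreal_le_of_add_le)
  have [measurable]: "Measurable.pred N (\<lambda>Y. hard r (Y - S))" "Measurable.pred N (\<lambda>Y. Y \<inter> D = {})"
    by (rule measurable_hard_Diff_fixed[OF S], rule pred_void[OF D])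
  let ?B = "\<integral>\<^sup>+Y. of_bool (Y \<inter> D = {}) * of_bool (hard r (Y - S)) \<partial>N"
  show "(\<integral>\<^sup>+Y. of_bool (hard r (Y - S)) * of_bool (Y \<inter> D \<noteq> {}) \<partial>N) + ?B
      = (\<integral>\<^sup>+Y. of_bool (hard r (Y - S)) \<partial>N)"
    by (subst nn_integral_add[symmetric]) (measurable, intro nn_integral_cong, auto)
  have pm: "Measurable.pred configs (\<lambda>Y. hard r (Y - S))"
    by (intro pred_hard measurable_config_fixed measurable_ident_sets[OF refl] S)
  have g: "(\<lambda>p. of_bool (fst p = {}) * of_bool (hard r (snd p - S)) :: ennreal)
      \<in> borel_measurable (configs \<Otimes>\<^sub>M configs)"
    using pred_config_empty pm by measurable
  \<comment> \<open>Where \<open>Y\<close> misses \<open>D\<close>, deleting \<open>D\<close>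
    changes nothing, and the hardness of \<open>Y - D - S\<close> is independent of the points in
    \<open>D\<close>.\<close>
  have "?B = (\<integral>\<^sup>+Y. of_bool (Y \<inter> D = {}) * of_bool (hard r (Y - D - S)) \<partial>N)"
    by (intro nn_integral_cong) (auto simp: Diff_triv)
  also have "\<dots> = (\<integral>\<^sup>+Y. \<integral>\<^sup>+X. of_bool (Y \<inter> D = {}) * of_bool (hard r (X - D - S)) \<partial>N \<partial>N)"
    using nn_integral_poisson_process_split[OF poisson D g] by simp
  also have "\<dots> = (\<integral>\<^sup>+Y. of_bool (Y \<inter> D = {}) * (\<integral>\<^sup>+X. of_bool (hard r (X - D - S)) \<partial>N) \<partial>N)"
  proof (intro nn_integral_cong nn_integral_cmult)
    have "(\<lambda>X. X - D) \<in> measurable N configs"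
      by (intro measurable_config_fixed measurable_ident_sets sets_N D)
    from measurable_compose[OF this pm]
    show "(\<lambda>X. of_bool (hard r (X - D - S)) :: ennreal) \<in> borel_measurable N" by measurable
  qed
  also have "\<dots> = ennreal (exp (- (c * area D))) * (\<integral>\<^sup>+X. of_bool (hard r (X - D - S)) \<partial>N)"
    by (subst nn_integral_multc) (measurable, simp add: nn_integral_void[OF D])
  finally have B: "?B = ennreal (exp (- (c * area D))) * (\<integral>\<^sup>+X. of_bool (hard r (X - D - S)) \<partial>N)" .
  have "(\<integral>\<^sup>+Y. of_bool (hard r (Y - S)) \<partial>N) \<le> (\<integral>\<^sup>+X. of_bool (hard r (X - D - S)) \<partial>N :: ennreal)"
  proof (intro nn_integral_mono)
    fix X
    have "X - D - S \<subseteq> X - S" by auto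
    then show "of_bool (hard r (X - S)) \<le> (of_bool (hard r (X - D - S)) :: ennreal)"
      using hard_subset by (cases "hard r (X - S)") auto
  qed
  then show "ennreal (exp (- (c * area D))) * (\<integral>\<^sup>+Y. of_bool (hard r (Y - S)) \<partial>N) \<le> ?B"
    unfolding B by (intro mult_left_mono) auto
  show "exp (- (c * area D)) \<le> 1" using c_pos area_nonneg by simp
  have "(\<integral>\<^sup>+Y. of_bool (hard r (Y - S)) \<partial>N) \<le> (\<integral>\<^sup>+Y. 1 \<partial>N :: ennreal)"
    by (intro nn_integral_mono) auto
  then show "(\<integral>\<^sup>+Y. of_bool (hard r (Y - S)) \<partial>N :: ennreal) \<noteq> \<top>"
    by (auto simp: emeasure_space_1 top_unique)
qed simp

text \<open>Points inside \<open>S\<close> are independent of the condition on \<open>Y - S\<close>,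
  so \<open>D\<close> is hit with the unconditioned Poisson probability. This is weakened to the
  expected number of points in \<open>D\<close>, which is proportional to an area and can be
  integrated over lenses.\<close>

lemma hard_hit_outside:
  assumes S: "S \<in> sets borel" and D: "D \<in> sets borel" "D \<subseteq> S"
  shows "(\<integral>\<^sup>+Y. of_bool (hard r (Y - S)) * of_bool (Y \<inter> D \<noteq> {}) \<partial>N)
    \<le> ennreal (c * area D) * (\<integral>\<^sup>+Y. of_bool (hard r (Y - S)) \<partial>N)"
proof -
  note [measurable] = pred_void[OF D(1)] measurable_hard_Diff_fixed[OF S]
  have pm: "Measurable.pred configs (\<lambda>Y. Y \<inter> D = {})"
    using pred_void[OF D(1)] by (simp add: measurable_N_iff)
  have ph: "Measurable.pred configs (\<lambda>Y. hard r Y)" by (rule pred_hard) simp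
  have g: "(\<lambda>p. of_bool (fst p \<inter> D \<noteq> {}) * of_bool (hard r (snd p)) :: ennreal)
      \<in> borel_measurable (configs \<Otimes>\<^sub>M configs)"
    using pm ph by measurable
  have int: "Y \<inter> S \<inter> D = Y \<inter> D" for Y using D(2) by auto
  have "(\<integral>\<^sup>+Y. of_bool (hard r (Y - S)) * of_bool (Y \<inter> D \<noteq> {}) \<partial>N)
      = (\<integral>\<^sup>+Y. of_bool (Y \<inter> S \<inter> D \<noteq> {}) * of_bool (hard r (Y - S)) \<partial>N)"
    by (simp add: int mult.commute)
  also have "\<dots> = (\<integral>\<^sup>+Y. \<integral>\<^sup>+X. of_bool (Y \<inter> D \<noteq> {}) * of_bool (hard r (X - S)) \<partial>N \<partial>N)"
    using nn_integral_poisson_process_split[OF poisson S g] by (simp add: int)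
  also have "\<dots> = (\<integral>\<^sup>+Y. of_bool (Y \<inter> D \<noteq> {}) * (\<integral>\<^sup>+X. of_bool (hard r (X - S)) \<partial>N) \<partial>N)"
    by (intro nn_integral_cong nn_integral_cmult) measurable
  also have "\<dots> = (\<integral>\<^sup>+Y. of_bool (Y \<inter> D \<noteq> {}) \<partial>N) * (\<integral>\<^sup>+X. of_bool (hard r (X - S)) \<partial>N)"
    by (rule nn_integral_multc) measurable
  also have "(\<integral>\<^sup>+Y. of_bool (Y \<inter> D \<noteq> {}) \<partial>N) \<le> ennreal (c * area D)"
  proof -
    \<comment> \<open>With \<open>UNIV\<close> in place of \<open>S\<close> the hardness condition
      is vacuous, and the bound becomes the plain Poisson hitting probability.\<close>
    have "(\<integral>\<^sup>+Y. of_bool (hard r (Y - UNIV)) * of_bool (Y \<inter> D \<noteq> {}) \<partial>N)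
      \<le> ennreal (1 - exp (- (c * area D))) * (\<integral>\<^sup>+Y. of_bool (hard r (Y - UNIV)) \<partial>N)"
      by (rule hard_hit_inside) (use D in auto)
    then have "(\<integral>\<^sup>+Y. of_bool (Y \<inter> D \<noteq> {}) \<partial>N) \<le> ennreal (1 - exp (- (c * area D)))"
      by (simp add: hard_iff emeasure_space_1)
    also have "\<dots> \<le> ennreal (c * area D)"
      using exp_ge_add_one_self[of "- (c * area D)"] by (intro ennreal_leI) simp
    finally show ?thesis .
  qed
  finally show ?thesis by (simp add: mult_right_mono)
qed

text \<open>The two summands are the contributions of one bad point \<open>z\<close> to the expected number of new bad
  points inside and outside \<open>ball z (2 * r)\<close>.\<close>

definition contraction_factor :: real
  where "contraction_factor = c * pi * (2 * r)\<^sup>2 * (1 - exp (- (c * pi * (2 * r)\<^sup>2)))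
    + 143 / 100 * c\<^sup>2 * pi * (2 * r) ^ 4"

text \<open>The Mecke equation writes the expectation as an integral over the location
  \<open>x\<close> of a point added to a sample \<open>Y\<close>. The integrand is bounded by a sum
  over the old bad points \<open>z\<close>: if \<open>x\<close> lies in the resampling set, the term
  of one \<open>z\<close> with \<open>x\<close> in its disk suffices; otherwise the part of the
  resampling set near \<open>x\<close> is covered by lenses, one for each \<open>z\<close>. The
  factor \<open>partition_function b\<close> on the right is the weight still to be divided
  out.\<close>

lemma expected_bad_points_le:
  assumes b: "b \<in> space configs"
  shows "(\<integral>\<^sup>+X. of_bool (hard r (X - resampling_set r b)) * of_nat (card (bad_points r X)) \<partial>N)
    \<le> ennreal contraction_factor * of_nat (card (bad_points r b)) * partition_function b"
proof -
  let ?S = "resampling_set r b" and ?R = "2 * r" and ?bb = "bad_points r b"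
  let ?Z = "partition_function b"
  let ?u = "c * pi * ?R\<^sup>2"
  have R: "0 < ?R" using r_pos by simp
  have S[measurable]: "?S \<in> sets borel" by (rule configs_resampling_borel[OF b])
  have fin: "finite ?bb" using b bad_points_subset[of r b] by (auto simp: space_configs intro: finite_subset)
  have ball_b[measurable]: "ball u s \<in> sets borel" for u :: "real ^ 2" and s by simp
  \<comment> \<open>\<open>F (x, Y)\<close> says that \<open>Y\<close> with \<open>x\<close> added
    is hard off \<open>?S\<close>, and that \<open>Y\<close> contains another point close to
    \<open>x\<close>, which makes \<open>x\<close> bad.\<close>
  define F :: "(real ^ 2) \<times> (real ^ 2) set \<Rightarrow> ennreal" where
    "F = (\<lambda>p. of_bool (hard r ((snd p \<union> ({fst p} \<inter> unit_square)) - ?S))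
      * of_bool (\<exists>y\<in>snd p. y \<noteq> fst p \<and> dist (fst p) y < ?R))"
  have Fm: "F \<in> borel_measurable (borel \<Otimes>\<^sub>M configs)"
  proof -
    have "(\<lambda>p. snd p \<union> ({fst p} \<inter> unit_square)) \<in> measurable (borel \<Otimes>\<^sub>M configs) configs"
      by (intro measurable_config_insert) auto
    then have [measurable]: "Measurable.pred (borel \<Otimes>\<^sub>M configs) (\<lambda>p. hard r ((snd p \<union> ({fst p} \<inter> unit_square)) - ?S))"
      by (intro pred_hard measurable_config_fixed S)
    have [measurable]: "Measurable.pred (borel \<Otimes>\<^sub>M configs) (\<lambda>p. \<exists>y\<in>snd p. y \<noteq> fst p \<and> dist (fst p) y < ?R)"
      by (rule pred_ex_config) measurable
    show ?thesis unfolding F_def by measurable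
  qed
  have "of_bool (hard r (X - ?S)) * of_nat (card (bad_points r X)) = (\<Sum>x\<in>X. F (x, X - {x}))"
    if X: "X \<in> space configs" for X
  proof -
    have "F (x, X - {x}) = of_bool (hard r (X - ?S)) * of_bool (\<exists>y\<in>X. x \<noteq> y \<and> dist x y < ?R)" if "x \<in> X" for x
    proof -
      have "X - {x} \<union> ({x} \<inter> unit_square) = X" using X that by (auto simp: space_configs)
      then show ?thesis by (auto simp: F_def)
    qed
    moreover have "(of_nat (card (bad_points r X)) :: ennreal) = (\<Sum>x\<in>X. of_bool (\<exists>y\<in>X. x \<noteq> y \<and> dist x y < ?R))"
      unfolding bad_points_eq using X by (intro card_filter_eq_sum) (simp add: space_configs)
    ultimately show ?thesis by (simp add: sum_distrib_left)
  qed
  then have "(\<integral>\<^sup>+X. of_bool (hard r (X - ?S)) * of_nat (card (bad_points r X)) \<partial>N)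
      = (\<integral>\<^sup>+X. (\<Sum>x\<in>X. F (x, X - {x})) \<partial>N)"
    by (intro nn_integral_cong) (simp add: space_N)
  also have "\<dots> = ennreal c * (\<integral>\<^sup>+x\<in>unit_square. (\<integral>\<^sup>+Y. F (x, Y) \<partial>N) \<partial>lborel)"
    by (rule mecke[OF Fm])
  also have "\<dots> \<le> ennreal c * (\<integral>\<^sup>+x. ?Z * (\<Sum>z\<in>?bb. ennreal (1 - exp (- ?u)) * indicator (ball z ?R) x
      + ennreal c * (emeasure lborel (ball x ?R \<inter> ball z ?R) * indicator (- ball z ?R) x)) \<partial>lborel)"
  proof (intro mult_left_mono nn_integral_mono)
    fix x :: "real ^ 2"
    let ?f = "\<lambda>z. ennreal (1 - exp (- ?u)) * indicator (ball z ?R) x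
      + ennreal c * (emeasure lborel (ball x ?R \<inter> ball z ?R) * indicator (- ball z ?R) x)"
    show "(\<integral>\<^sup>+Y. F (x, Y) \<partial>N) * indicator unit_square x \<le> ?Z * (\<Sum>z\<in>?bb. ?f z)"
    proof (cases "x \<in> unit_square")
      case sq: True
      show ?thesis
      proof (cases "x \<in> ?S")
        case True
        then obtain z where z: "z \<in> ?bb" "x \<in> ball z ?R" by (auto simp: resampling_set_def)
        have "(\<integral>\<^sup>+Y. F (x, Y) \<partial>N) \<le> (\<integral>\<^sup>+Y. of_bool (hard r (Y - ?S)) * of_bool (Y \<inter> ball x ?R \<noteq> {}) \<partial>N)"
        proof (intro nn_integral_mono)
          fix Y
          have "Y \<union> ({x} \<inter> unit_square) - ?S = Y - ?S" using True by auto
          then show "F (x, Y) \<le> of_bool (hard r (Y - ?S)) * of_bool (Y \<inter> ball x ?R \<noteq> {})"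
            by (auto simp: F_def)
        qed
        also have "\<dots> \<le> ennreal (1 - exp (- (c * area (ball x ?R)))) * ?Z"
          unfolding partition_function_def by (rule hard_hit_inside) (use S in auto)
        also have "\<dots> \<le> ennreal (1 - exp (- ?u)) * ?Z"
        proof (intro mult_right_mono ennreal_leI)
          have "area (ball x ?R) \<le> measure lborel (ball x ?R)"
            unfolding area_def
          proof (rule measure_mono_fmeasurable)
            show "ball x ?R \<in> fmeasurable lborel"
              using R by (intro fmeasurableI) (auto simp: emeasure_lborel_ball)
          qed auto
          also have "\<dots> = pi * ?R\<^sup>2" using R by (intro measure_lborel_ball) simp
          finally show "1 - exp (- (c * area (ball x ?R))) \<le> 1 - exp (- ?u)"
            using c_pos by simp
        qed simp
        also have "ennreal (1 - exp (- ?u)) \<le> ?f z" using z by simp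
        also have "?f z \<le> (\<Sum>z\<in>?bb. ?f z)" using z fin by (intro member_le_sum) auto
        finally have "(\<integral>\<^sup>+Y. F (x, Y) \<partial>N) \<le> (\<Sum>z\<in>?bb. ?f z) * ?Z"
          by (simp only: mult_right_mono zero_le)
        then show ?thesis using sq by (simp only: mult.commute[of ?Z] indicator_simps mult_1_right)
      next
        case False
        let ?D = "ball x ?R \<inter> ?S"
        have D: "?D \<in> sets borel" by auto
        have out: "x \<notin> ball z ?R" if "z \<in> ?bb" for z
          using False sq that by (auto simp: resampling_set_def)
        have "(\<integral>\<^sup>+Y. F (x, Y) \<partial>N) \<le> (\<integral>\<^sup>+Y. of_bool (hard r (Y - ?S)) * of_bool (Y \<inter> ?D \<noteq> {}) \<partial>N)"
        proof (intro nn_integral_mono)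
          fix Y
          have eq: "Y \<union> ({x} \<inter> unit_square) - ?S = insert x (Y - ?S)" using False sq by auto
          show "F (x, Y) \<le> of_bool (hard r (Y - ?S)) * of_bool (Y \<inter> ?D \<noteq> {})"
          proof (cases "F (x, Y) = 0")
            case nz: False
            then have h: "hard r (insert x (Y - ?S))" and "\<exists>y\<in>Y. y \<noteq> x \<and> dist x y < ?R"
              by (auto simp: F_def eq split: if_splits)
            then obtain y where y: "y \<in> Y" "y \<noteq> x" "dist x y < ?R" by blast
            \<comment> \<open>A close neighbour outside \<open>?S\<close> would contradict hardness,
              as \<open>x\<close> is outside as well; hence the neighbour lies in the resampled
              region.\<close>
            have "y \<in> ?S" using h y unfolding hard_iff by force
            moreover have "hard r (Y - ?S)" using h by (rule hard_subset) auto
            ultimately show ?thesis using y by (auto simp: F_def)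
          qed simp
        qed
        also have "\<dots> \<le> ennreal (c * area ?D) * ?Z"
          unfolding partition_function_def by (rule hard_hit_outside[OF S D]) auto
        also have "ennreal (c * area ?D) \<le> (\<Sum>z\<in>?bb. ?f z)"
        proof -
          have "ennreal (c * area ?D) = ennreal c * emeasure lborel (?D \<inter> unit_square)"
            using c_pos area_nonneg by (simp add: emeasure_area[OF D] ennreal_mult)
          also have "\<dots> \<le> ennreal c * emeasure lborel (\<Union>z\<in>?bb. ball x ?R \<inter> ball z ?R)"
            using fin by (intro mult_left_mono emeasure_mono) (auto simp: resampling_set_def)
          also have "\<dots> \<le> ennreal c * (\<Sum>z\<in>?bb. emeasure lborel (ball x ?R \<inter> ball z ?R))"
            using fin by (intro mult_left_mono emeasure_subadditive_finite) auto
          also have "\<dots> = (\<Sum>z\<in>?bb. ?f z)"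
            unfolding sum_distrib_left by (intro sum.cong refl) (use out in \<open>simp add: indicator_def\<close>)
          finally show ?thesis .
        qed
        finally have "(\<integral>\<^sup>+Y. F (x, Y) \<partial>N) \<le> (\<Sum>z\<in>?bb. ?f z) * ?Z"
          by (simp only: mult_right_mono zero_le)
        then show ?thesis using sq by (simp only: mult.commute[of ?Z] indicator_simps mult_1_right)
      qed
    qed simp
  qed simp
  also have "\<dots> = ennreal c * (?Z * (\<Sum>z\<in>?bb. ennreal (1 - exp (- ?u)) * emeasure lborel (ball z ?R)
      + ennreal c * (\<integral>\<^sup>+x\<in>- ball z ?R. emeasure lborel (ball x ?R \<inter> ball z ?R) \<partial>lborel)))"
  proof -
    have m1[measurable]: "(\<lambda>x. emeasure lborel (ball x ?R \<inter> ball z ?R) * indicator (- ball z ?R) x) \<in> borel_measurable borel" for z :: "real ^ 2"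
      by (intro borel_measurable_times_ennreal borel_measurable_lens_area borel_measurable_indicator) auto
    show ?thesis
      by (simp add: nn_integral_cmult nn_integral_sum nn_integral_add)
  qed
  also have "\<dots> \<le> ennreal c * (?Z * (\<Sum>z\<in>?bb. ennreal (1 - exp (- ?u)) * ennreal (pi * ?R\<^sup>2)
      + ennreal c * ennreal (143 / 100 * pi * ?R ^ 4)))"
    by (intro mult_left_mono sum_mono add_mono nn_integral_lens_outside R)
      (use R in \<open>auto simp: emeasure_lborel_ball\<close>)
  also have "\<dots> = ennreal contraction_factor * of_nat (card ?bb) * ?Z"
  proof -
    have u: "0 \<le> 1 - exp (- ?u)" using c_pos by simp
    have "ennreal c * (ennreal (1 - exp (- ?u)) * ennreal (pi * ?R\<^sup>2) + ennreal c * ennreal (143 / 100 * pi * ?R ^ 4))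
       = ennreal (c * ((1 - exp (- ?u)) * (pi * ?R\<^sup>2) + c * (143 / 100 * pi * ?R ^ 4)))"
      using c_pos u R by (simp add: ennreal_mult[symmetric] ennreal_plus[symmetric] del: ennreal_plus)
    also have "c * ((1 - exp (- ?u)) * (pi * ?R\<^sup>2) + c * (143 / 100 * pi * ?R ^ 4)) = contraction_factor"
      by (simp add: contraction_factor_def algebra_simps power2_eq_square)
    finally have eq: "ennreal c * (ennreal (1 - exp (- ?u)) * ennreal (pi * ?R\<^sup>2)
        + ennreal c * ennreal (143 / 100 * pi * ?R ^ 4)) = ennreal contraction_factor" .
    show ?thesis by (simp only: eq[symmetric] sum_constant mult_ac)
  qed
  finally show ?thesis .
qed

lemma expected_card: "(\<integral>\<^sup>+X. of_nat (card X) \<partial>N) = ennreal c"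
proof -
  have "(\<integral>\<^sup>+X. (\<Sum>x\<in>X. 1) \<partial>N) = ennreal c * (\<integral>\<^sup>+x\<in>unit_square. (\<integral>\<^sup>+Y. 1 \<partial>N) \<partial>lborel)"
    using mecke[of "\<lambda>_. 1"] by simp
  \<comment> \<open>A point of the box rules out the degenerate case in the formula for its
    content.\<close>
  moreover have "(0 :: real ^ 2) \<in> unit_square" by (simp add: mem_box_cart)
  then have "emeasure lborel (unit_square :: (real ^ 2) set) = 1"
    using emeasure_area[of UNIV] by (simp add: area_def content_cbox_if_cart split: if_splits)
  ultimately show ?thesis by (simp add: emeasure_space_1)
qed

end

section \<open>The chain of configurations\<close>

text \<open>Two points of \<open>X\<close> that violate hardness are both bad. Hence hardness off a
  fixed \<open>S\<close> is an event of the bad points alone, whatever the good points are.\<close>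

lemma hard_Diff_iff_bad_points: "hard r (X - S) \<longleftrightarrow> hard r (bad_points r X - S)"
proof
  show "hard r (X - S) \<Longrightarrow> hard r (bad_points r X - S)"
    by (erule hard_subset) (use bad_points_subset[of r X] in auto)
  assume h: "hard r (bad_points r X - S)"
  show "hard r (X - S)"
    unfolding hard_iff
  proof (intro ballI impI, rule ccontr)
    fix x y assume "x \<in> X - S" "y \<in> X - S" "x \<noteq> y" "\<not> 2 * r \<le> dist x y"
    moreover from this have "x \<in> bad_points r X" "y \<in> bad_points r X"
      by (force simp: bad_points_eq dist_commute)+
    ultimately show False using h by (auto simp: hard_iff)
  qed
qed

lemma resampling_set_subset: "resampling_set r X \<subseteq> unit_square"
  by (auto simp: resampling_set_def)

context hard_disks
begin

text \<open>The law of the next configuration when the current bad points are \<open>b\<close>: a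
  Poisson sample on the whole square, conditioned to be hard off the resampling set.\<close>

definition round_expectation :: "((real ^ 2) set \<Rightarrow> ennreal) \<Rightarrow> (real ^ 2) set \<Rightarrow> ennreal"
  where "round_expectation h b
    = (\<integral>\<^sup>+X. of_bool (hard r (X - resampling_set r b)) * h X \<partial>N) / partition_function b"

text \<open>The mean over the fresh points while the good points \<open>Y\<close> are kept; the
  fresh points are the restriction of a full Poisson sample to the resampling set.\<close>

definition refill_expectation :: "((real ^ 2) set \<Rightarrow> ennreal) \<Rightarrow> (real ^ 2) set \<times> (real ^ 2) set \<Rightarrow> ennreal"
  where "refill_expectation h = (\<lambda>(b, Y).
    \<integral>\<^sup>+X. h ((Y - resampling_set r b) \<union> (X \<inter> resampling_set r b)) \<partial>N)"

lemma measurable_refill_expectation [measurable]: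
  assumes [measurable]: "h \<in> borel_measurable configs"
  shows "refill_expectation h \<in> borel_measurable (configs \<Otimes>\<^sub>M configs)"
proof -
  have s[measurable]: "snd \<in> measurable ((configs \<Otimes>\<^sub>M configs) \<Otimes>\<^sub>M N) configs"
    by (subst measurable_cong_sets[OF refl sets_N[symmetric]]) (rule measurable_snd)
  have [measurable]: "(\<lambda>p. (snd (fst p) - resampling_set r (fst (fst p))) \<union> (snd p \<inter> resampling_set r (fst (fst p))))
      \<in> measurable ((configs \<Otimes>\<^sub>M configs) \<Otimes>\<^sub>M N) configs"
    by (intro measurable_config_Un measurable_config_Int_resampling_set s) measurable
  show ?thesis unfolding refill_expectation_def case_prod_beta by measurable
qed

text \<open>Refilling the resampling set leaves hardness off it untouched, so kept and fresh points
  superpose to one Poisson sample carrying the same weight.\<close>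

lemma hard_expectation_refill:
  assumes h[measurable]: "h \<in> borel_measurable configs" and b: "b \<in> space configs"
  shows "hard_expectation (refill_expectation h) b = round_expectation h b"
proof -
  let ?S = "resampling_set r b"
  have S: "?S \<in> sets borel" by (rule configs_resampling_borel[OF b])
  have [measurable]: "Measurable.pred configs (\<lambda>X. hard r (X - ?S))"
    by (intro pred_hard measurable_config_fixed measurable_ident_sets[OF refl] S)
  have m: "(\<lambda>X. of_bool (hard r (X - ?S)) * h X) \<in> borel_measurable configs" by measurable
  have "(\<integral>\<^sup>+Y. of_bool (hard r (Y - ?S)) * refill_expectation h (b, Y - ?S) \<partial>N)
     = (\<integral>\<^sup>+Y. \<integral>\<^sup>+X. of_bool (hard r ((Y - ?S) \<union> (X \<inter> ?S) - ?S)) * h ((Y - ?S) \<union> (X \<inter> ?S)) \<partial>N \<partial>N)"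
  proof (intro nn_integral_cong)
    fix Y
    have "(Y - ?S) \<union> (X \<inter> ?S) - ?S = Y - ?S" "Y - ?S - ?S = Y - ?S" for X by auto
    then show "of_bool (hard r (Y - ?S)) * refill_expectation h (b, Y - ?S)
      = (\<integral>\<^sup>+X. of_bool (hard r ((Y - ?S) \<union> (X \<inter> ?S) - ?S)) * h ((Y - ?S) \<union> (X \<inter> ?S)) \<partial>N)"
      by (cases "hard r (Y - ?S)") (simp_all add: refill_expectation_def)
  qed
  also have "\<dots> = (\<integral>\<^sup>+X. of_bool (hard r (X - ?S)) * h X \<partial>N)"
    by (rule superposition[OF S m])
  finally show ?thesis by (simp add: hard_expectation_def round_expectation_def)
qed

text \<open>The weight is expressed through the bad points and absorbed into \<open>h\<close> before
  \<open>bad_good_decomposition\<close> is applied; depending on the bad points only, it comes out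
  of \<open>hard_expectation\<close> unchanged. In this form the invariant passes through one
  round.\<close>

lemma round_expectation_bad_good:
  assumes h[measurable]: "h \<in> borel_measurable (configs \<Otimes>\<^sub>M configs)" and b: "b \<in> space configs"
  shows "round_expectation (\<lambda>X. h (bad_points r X, X - bad_points r X)) b
    = round_expectation (\<lambda>X. hard_expectation h (bad_points r X)) b"
proof -
  let ?S = "resampling_set r b"
  let ?g = "\<lambda>p. of_bool (hard r (fst p - ?S)) * h p"
  have S: "?S \<in> sets borel" by (rule configs_resampling_borel[OF b])
  have [measurable]: "Measurable.pred (configs \<Otimes>\<^sub>M configs) (\<lambda>p. hard r (fst p - ?S))"
    by (intro pred_hard measurable_config_fixed S) measurable
  have g: "?g \<in> borel_measurable (configs \<Otimes>\<^sub>M configs)" by measurable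
  have "hard_expectation ?g b' = of_bool (hard r (b' - ?S)) * hard_expectation h b'" for b'
    by (cases "hard r (b' - ?S)") (simp_all add: hard_expectation_def)
  with bad_good_decomposition[OF g]
  have bg: "(\<integral>\<^sup>+X. of_bool (hard r (bad_points r X - ?S)) * h (bad_points r X, X - bad_points r X) \<partial>N)
      = (\<integral>\<^sup>+X. of_bool (hard r (bad_points r X - ?S)) * hard_expectation h (bad_points r X) \<partial>N)"
    by (simp only: fst_conv)
  have "(\<integral>\<^sup>+X. of_bool (hard r (X - ?S)) * k X \<partial>N)
      = (\<integral>\<^sup>+X. of_bool (hard r (bad_points r X - ?S)) * k X \<partial>N)" for k :: "(real ^ 2) set \<Rightarrow> ennreal"
  proof (intro nn_integral_cong)
    fix X
    show "of_bool (hard r (X - ?S)) * k X = of_bool (hard r (bad_points r X - ?S)) * k X"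
      by (simp only: hard_Diff_iff_bad_points[of r X])
  qed
  then show ?thesis unfolding round_expectation_def bg by (simp only: bg)
qed

lemma round_expectation_bad_points_le:
  assumes b: "b \<in> space configs"
  shows "round_expectation (\<lambda>X. of_nat (card (bad_points r X))) b
    \<le> ennreal contraction_factor * of_nat (card (bad_points r b))"
proof -
  let ?Z = "partition_function b"
  have "?Z \<noteq> \<top>" using partition_function_le_1[of b] by (auto simp: top_unique)
  then have "?Z \<noteq> 0" "?Z < \<top>" using partition_function_pos[OF b] by (simp_all add: less_top)
  have "round_expectation (\<lambda>X. of_nat (card (bad_points r X))) b
      \<le> ennreal contraction_factor * of_nat (card (bad_points r b)) * ?Z / ?Z"
    unfolding round_expectation_def by (intro divide_right_mono_ennreal expected_bad_points_le b)
  also have "\<dots> = ennreal contraction_factor * of_nat (card (bad_points r b))"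
    using \<open>?Z \<noteq> 0\<close> \<open>?Z < \<top>\<close> by (intro mult_divide_eq_ennreal) simp_all
  finally show ?thesis .
qed

end

section \<open>Laws of the random run\<close>

locale positive_partial_rejection_sampling = partial_rejection_sampling +
  assumes lam_pos: "0 < lam" and r_pos: "0 < r"
begin

text \<open>The initial law serves as the reference process: the conditional law of every fresh
  sample is a restriction of it.\<close>

sublocale law0: hard_disks "disk_intensity lam r" "distr M configs (P 0)" r
  using lam_pos r_pos initial by unfold_locales (auto simp: disk_intensity_def)

abbreviation "N \<equiv> distr M configs (P 0)"

lemma P_space: "\<omega> \<in> space M \<Longrightarrow> P t \<omega> \<in> space configs"
  by (rule measurable_space[OF P_measurable])

lemma bad_points_P_space: "\<omega> \<in> space M \<Longrightarrow> bad_points r (P t \<omega>) \<in> space configs"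
  by (rule measurable_space[OF measurable_bad_points[OF P_measurable]])

lemma history_P:
  assumes "A \<in> sets configs"
  shows "P t -` A \<inter> space M \<in> sets (history M P Q t)"
  unfolding history_def using assms
  by (subst sets_measure_of) (auto intro!: sigma_sets.Basic)

text \<open>By uniqueness the conditional law of \<open>Q t\<close> is \<open>N\<close> restricted
  to the resampling set of \<open>P t\<close>, so on \<open>M \<Otimes>\<^sub>M N\<close> an
  independent sample cut to that set imitates \<open>Q t\<close>. Of the history only the events
  about \<open>P t\<close> enter.\<close>

lemma joint_law:
  "distr M (configs \<Otimes>\<^sub>M configs) (\<lambda>\<omega>. (P t \<omega>, Q t \<omega>))
    = distr (M \<Otimes>\<^sub>M N) (configs \<Otimes>\<^sub>M configs)
        (\<lambda>p. (P t (fst p), snd p \<inter> resampling_set r (P t (fst p))))" (is "?L = ?R")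
proof -
  obtain \<kappa> where \<kappa>: "has_cond_distr M (history M P Q t) configs (Q t) \<kappa>"
    and pp: "\<And>\<omega>. \<omega> \<in> space M \<Longrightarrow> poisson_process (disk_intensity lam r) (resampling_set r (P t \<omega>)) (\<kappa> \<omega>)"
    using fresh[of t] by blast
  have S: "resampling_set r (P t \<omega>) \<in> sets borel" if "\<omega> \<in> space M" for \<omega>
    by (rule law0.configs_resampling_borel[OF P_space[OF that]])
  have \<kappa>_eq: "\<kappa> \<omega> = distr N configs (\<lambda>X. X \<inter> resampling_set r (P t \<omega>))" if "\<omega> \<in> space M" for \<omega>
  proof (rule poisson_process_unique[OF pp[OF that]])
    show "poisson_process (disk_intensity lam r) (resampling_set r (P t \<omega>)) (distr N configs (\<lambda>X. X \<inter> resampling_set r (P t \<omega>)))"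
      using poisson_process_restrict[OF initial S[OF that]] resampling_set_subset[of r "P t \<omega>"]
      by (simp add: inf.absorb2)
  qed
  have m1: "(\<lambda>\<omega>. (P t \<omega>, Q t \<omega>)) \<in> measurable M (configs \<Otimes>\<^sub>M configs)"
    using P_measurable Q_measurable by measurable
  have f: "(\<lambda>p. P t (fst p)) \<in> measurable (M \<Otimes>\<^sub>M N) configs"
    using P_measurable by measurable
  have s: "snd \<in> measurable (M \<Otimes>\<^sub>M N) configs"
    by (subst measurable_cong_sets[OF refl law0.sets_N[symmetric]]) (rule measurable_snd)
  have m2: "(\<lambda>p. (P t (fst p), snd p \<inter> resampling_set r (P t (fst p)))) \<in> measurable (M \<Otimes>\<^sub>M N) (configs \<Otimes>\<^sub>M configs)"
    by (intro measurable_Pair f measurable_config_Int_resampling_set s)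
  interpret L: prob_space ?L by (rule prob_space_distr[OF m1])
  show ?thesis
  proof (rule measure_eqI_generator_eq[OF Int_stable_pair_measure_generator pair_measure_closed,
        where A="\<lambda>_. space configs \<times> space configs"])
    fix X assume "X \<in> {a \<times> b |a b. a \<in> sets configs \<and> b \<in> sets configs}"
    then obtain A B where X: "X = A \<times> B" and AB: "A \<in> sets configs" "B \<in> sets configs" by auto
    have "emeasure ?L X = emeasure M ((P t -` A \<inter> space M) \<inter> (Q t -` B \<inter> space M))"
      using AB by (subst emeasure_distr[OF m1]) (auto simp: X intro!: arg_cong[where f="emeasure M"])
    also have "\<dots> = (\<integral>\<^sup>+\<omega>\<in>P t -` A \<inter> space M. emeasure (\<kappa> \<omega>) B \<partial>M)"
      using \<kappa> AB history_P[OF AB(1)] by (auto simp: has_cond_distr_def)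
    also have "\<dots> = (\<integral>\<^sup>+\<omega>. emeasure N (Pair \<omega> -` ((\<lambda>p. (P t (fst p), snd p \<inter> resampling_set r (P t (fst p)))) -` X \<inter> space (M \<Otimes>\<^sub>M N))) \<partial>M)"
    proof (intro nn_integral_cong)
      fix \<omega> assume \<omega>: "\<omega> \<in> space M"
      have mS: "(\<lambda>X. X \<inter> resampling_set r (P t \<omega>)) \<in> measurable N configs"
        by (intro measurable_config_fixed measurable_ident_sets S \<omega>) simp
      have eq: "Pair \<omega> -` ((\<lambda>p. (P t (fst p), snd p \<inter> resampling_set r (P t (fst p)))) -` X \<inter> space (M \<Otimes>\<^sub>M N))
          = (if P t \<omega> \<in> A then (\<lambda>X. X \<inter> resampling_set r (P t \<omega>)) -` B \<inter> space N else {})"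
        by (rule set_eqI) (simp add: X space_pair_measure \<omega> conj_ac)
      have "emeasure (\<kappa> \<omega>) B = emeasure N ((\<lambda>X. X \<inter> resampling_set r (P t \<omega>)) -` B \<inter> space N)"
        unfolding \<kappa>_eq[OF \<omega>] by (rule emeasure_distr[OF mS AB(2)])
      then show "emeasure (\<kappa> \<omega>) B * indicator (P t -` A \<inter> space M) \<omega>
        = emeasure N (Pair \<omega> -` ((\<lambda>p. (P t (fst p), snd p \<inter> resampling_set r (P t (fst p)))) -` X \<inter> space (M \<Otimes>\<^sub>M N)))"
        unfolding eq using \<omega> by (simp add: indicator_def)
    qed
    also have "\<dots> = emeasure (M \<Otimes>\<^sub>M N) ((\<lambda>p. (P t (fst p), snd p \<inter> resampling_set r (P t (fst p)))) -` X \<inter> space (M \<Otimes>\<^sub>M N))"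
      by (intro law0.emeasure_pair_measure_alt[symmetric] measurable_sets[OF m2]) (use AB X in auto)
    also have "\<dots> = emeasure ?R X"
      by (intro emeasure_distr[OF m2, symmetric]) (use AB X in auto)
    finally show "emeasure ?L X = emeasure ?R X" .
  qed (auto simp: sets_pair_measure space_pair_measure)
qed

text \<open>The terminated case fits the same formula: a hard configuration has an empty resampling
  set, so the refill returns it unchanged.\<close>

lemma next_expectation:
  assumes h[measurable]: "h \<in> borel_measurable configs"
  shows "(\<integral>\<^sup>+\<omega>. h (P (Suc t) \<omega>) \<partial>M)
    = (\<integral>\<^sup>+\<omega>. law0.refill_expectation h (bad_points r (P t \<omega>), P t \<omega> - bad_points r (P t \<omega>)) \<partial>M)"
proof -
  define g :: "(real ^ 2) set \<times> (real ^ 2) set \<Rightarrow> ennreal" where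
    "g = (\<lambda>p. if hard r (fst p) then h (fst p) else h ((fst p - resampling_set r (fst p)) \<union> snd p))"
  have [measurable]: "Measurable.pred (configs \<Otimes>\<^sub>M configs) (\<lambda>p. hard r (fst p))"
    by (rule pred_hard) simp
  have [measurable]: "(\<lambda>p. (fst p - resampling_set r (fst p)) \<union> snd p) \<in> measurable (configs \<Otimes>\<^sub>M configs) configs"
    by (intro measurable_config_Un measurable_config_Int_resampling_set) simp_all
  have g: "g \<in> borel_measurable (configs \<Otimes>\<^sub>M configs)" unfolding g_def by measurable
  have m1: "(\<lambda>\<omega>. (P t \<omega>, Q t \<omega>)) \<in> measurable M (configs \<Otimes>\<^sub>M configs)"
    using P_measurable Q_measurable by measurable
  have f: "(\<lambda>p. P t (fst p)) \<in> measurable (M \<Otimes>\<^sub>M N) configs"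
    using P_measurable by measurable
  have s: "snd \<in> measurable (M \<Otimes>\<^sub>M N) configs"
    by (subst measurable_cong_sets[OF refl law0.sets_N[symmetric]]) (rule measurable_snd)
  have m2: "(\<lambda>p. (P t (fst p), snd p \<inter> resampling_set r (P t (fst p)))) \<in> measurable (M \<Otimes>\<^sub>M N) (configs \<Otimes>\<^sub>M configs)"
    by (intro measurable_Pair f measurable_config_Int_resampling_set s)
  have "(\<integral>\<^sup>+\<omega>. h (P (Suc t) \<omega>) \<partial>M) = (\<integral>\<^sup>+\<omega>. g (P t \<omega>, Q t \<omega>) \<partial>M)"
    by (intro nn_integral_cong) (simp add: resample g_def hard_def)
  also have "\<dots> = (\<integral>\<^sup>+p. g p \<partial>distr M (configs \<Otimes>\<^sub>M configs) (\<lambda>\<omega>. (P t \<omega>, Q t \<omega>)))"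
    by (rule nn_integral_distr[symmetric, OF m1]) (simp add: g)
  also have "\<dots> = (\<integral>\<^sup>+p. g (P t (fst p), snd p \<inter> resampling_set r (P t (fst p))) \<partial>(M \<Otimes>\<^sub>M N))"
    unfolding joint_law by (rule nn_integral_distr[OF m2]) (simp add: g)
  also have "\<dots> = (\<integral>\<^sup>+\<omega>. \<integral>\<^sup>+X. g (P t \<omega>, X \<inter> resampling_set r (P t \<omega>)) \<partial>N \<partial>M)"
    using law0.nn_integral_fst[OF measurable_compose[OF m2 g]] by simp
  also have "\<dots> = (\<integral>\<^sup>+\<omega>. law0.refill_expectation h (bad_points r (P t \<omega>), P t \<omega> - bad_points r (P t \<omega>)) \<partial>M)"
  proof (intro nn_integral_cong)
    fix \<omega> assume \<omega>: "\<omega> \<in> space M"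
    let ?S = "resampling_set r (P t \<omega>)"
    have sq: "P t \<omega> \<subseteq> unit_square" using P_space[OF \<omega>, of t] by (simp add: space_configs)
    have "P t \<omega> - bad_points r (P t \<omega>) - ?S = P t \<omega> - ?S"
      using Int_resampling_set[OF sq r_pos] by auto
    moreover have "g (P t \<omega>, X \<inter> ?S) = h ((P t \<omega> - ?S) \<union> (X \<inter> ?S))" for X
    proof (cases "hard r (P t \<omega>)")
      case True
      then have "?S = {}" by (simp add: resampling_set_def hard_iff_bad_points)
      then show ?thesis using True by (simp add: g_def)
    qed (simp add: g_def)
    ultimately show "(\<integral>\<^sup>+X. g (P t \<omega>, X \<inter> ?S) \<partial>N)
      = law0.refill_expectation h (bad_points r (P t \<omega>), P t \<omega> - bad_points r (P t \<omega>))"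
      by (simp add: law0.refill_expectation_def)
  qed
  finally show ?thesis .
qed

text \<open>Given the bad points, the good points of \<open>P t\<close> are a hard configuration outside the resampling set:
  this invariant is what makes one round of resampling a function of the bad points alone.\<close>

lemma good_points_conditionally_hard:
  shows "h \<in> borel_measurable (configs \<Otimes>\<^sub>M configs) \<Longrightarrow>
    (\<integral>\<^sup>+\<omega>. h (bad_points r (P t \<omega>), P t \<omega> - bad_points r (P t \<omega>)) \<partial>M)
      = (\<integral>\<^sup>+\<omega>. law0.hard_expectation h (bad_points r (P t \<omega>)) \<partial>M)"
    (is "_ \<Longrightarrow> ?I t h")
    and round_expectation_next: "k \<in> borel_measurable configs \<Longrightarrow>
    (\<integral>\<^sup>+\<omega>. k (P (Suc t) \<omega>) \<partial>M) = (\<integral>\<^sup>+\<omega>. law0.round_expectation k (bad_points r (P t \<omega>)) \<partial>M)"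
    (is "_ \<Longrightarrow> ?J t k")
proof -
  have bg: "(\<lambda>X. (bad_points r X, X - bad_points r X)) \<in> measurable configs (configs \<Otimes>\<^sub>M configs)"
    by (intro measurable_Pair measurable_config_Diff measurable_bad_points) simp_all
  have bm: "(\<lambda>X. bad_points r X) \<in> measurable configs configs"
    by (intro measurable_bad_points) simp
  \<comment> \<open>The invariant at time \<open>t\<close> yields the law at time
    \<open>t + 1\<close>; the induction below feeds that law back into the invariant.\<close>
  have next_law: "?J t k" if I: "\<And>h. h \<in> borel_measurable (configs \<Otimes>\<^sub>M configs) \<Longrightarrow> ?I t h"
    and k: "k \<in> borel_measurable configs" for t k
  proof -
    have "(\<integral>\<^sup>+\<omega>. k (P (Suc t) \<omega>) \<partial>M)
        = (\<integral>\<^sup>+\<omega>. law0.hard_expectation (law0.refill_expectation k) (bad_points r (P t \<omega>)) \<partial>M)"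
      unfolding next_expectation[OF k] by (rule I[OF law0.measurable_refill_expectation[OF k]])
    also have "\<dots> = (\<integral>\<^sup>+\<omega>. law0.round_expectation k (bad_points r (P t \<omega>)) \<partial>M)"
      by (intro nn_integral_cong law0.hard_expectation_refill k bad_points_P_space)
    finally show ?thesis .
  qed
  have inv: "h \<in> borel_measurable (configs \<Otimes>\<^sub>M configs) \<Longrightarrow> ?I t h" for t h
  proof (induction t arbitrary: h)
    case 0
    have "(\<integral>\<^sup>+X. h (bad_points r X, X - bad_points r X) \<partial>N)
       = (\<integral>\<^sup>+\<omega>. h (bad_points r (P 0 \<omega>), P 0 \<omega> - bad_points r (P 0 \<omega>)) \<partial>M)"
      using measurable_compose[OF bg 0] by (intro nn_integral_distr P_measurable) simp
    moreover have "(\<integral>\<^sup>+X. law0.hard_expectation h (bad_points r X) \<partial>N)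
        = (\<integral>\<^sup>+\<omega>. law0.hard_expectation h (bad_points r (P 0 \<omega>)) \<partial>M)"
      using measurable_compose[OF bm law0.measurable_hard_expectation[OF 0]]
      by (intro nn_integral_distr P_measurable) simp
    ultimately show ?case using law0.bad_good_decomposition[OF 0] by simp
  next
    case (Suc t)
    have "(\<integral>\<^sup>+\<omega>. h (bad_points r (P (Suc t) \<omega>), P (Suc t) \<omega> - bad_points r (P (Suc t) \<omega>)) \<partial>M)
        = (\<integral>\<^sup>+\<omega>. law0.round_expectation (\<lambda>X. h (bad_points r X, X - bad_points r X)) (bad_points r (P t \<omega>)) \<partial>M)"
      by (rule next_law[OF Suc.IH measurable_compose[OF bg Suc.prems]])
    also have "\<dots> = (\<integral>\<^sup>+\<omega>. law0.round_expectation (\<lambda>X. law0.hard_expectation h (bad_points r X)) (bad_points r (P t \<omega>)) \<partial>M)"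
      by (intro nn_integral_cong law0.round_expectation_bad_good Suc.prems bad_points_P_space)
    \<comment> \<open>\<open>next_law\<close> is now read from right to left, for the mean
      \<open>law0.hard_expectation h\<close> as a function of the new bad points.\<close>
    also have "\<dots> = (\<integral>\<^sup>+\<omega>. law0.hard_expectation h (bad_points r (P (Suc t) \<omega>)) \<partial>M)"
      by (rule next_law[OF Suc.IH measurable_compose[OF bm law0.measurable_hard_expectation[OF Suc.prems]], symmetric])
    finally show ?case .
  qed
  show "h \<in> borel_measurable (configs \<Otimes>\<^sub>M configs) \<Longrightarrow> ?I t h" by (rule inv)
  show "k \<in> borel_measurable configs \<Longrightarrow> ?J t k" by (rule next_law[OF inv])
qed

lemma measurable_card_bad_points: "(\<lambda>X. of_nat (card (bad_points r X)) :: ennreal) \<in> borel_measurable configs"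
proof -
  have "(\<lambda>X. card (bad_points r X \<inter> UNIV)) \<in> measurable configs (count_space UNIV)"
    by (rule measurable_compose[OF _ measurable_card_Int]) (auto intro!: measurable_bad_points)
  then have [measurable]: "(\<lambda>X. card (bad_points r X)) \<in> measurable configs (count_space UNIV)" by simp
  show ?thesis by measurable
qed

lemma expected_bad_points:
  "(\<integral>\<^sup>+\<omega>. of_nat (card (bad_points r (P t \<omega>))) \<partial>M)
    \<le> ennreal law0.contraction_factor ^ t * ennreal (disk_intensity lam r)"
proof (induction t)
  case 0
  have "(\<integral>\<^sup>+\<omega>. of_nat (card (bad_points r (P 0 \<omega>))) \<partial>M) = (\<integral>\<^sup>+X. of_nat (card (bad_points r X)) \<partial>N)"
    by (intro nn_integral_distr[symmetric] P_measurable) (simp add: measurable_card_bad_points)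
  also have "\<dots> \<le> (\<integral>\<^sup>+X. of_nat (card X) \<partial>N)"
    by (intro nn_integral_mono of_nat_mono card_mono bad_points_subset law0.space_N_D(1))
  also have "\<dots> = ennreal (disk_intensity lam r)" by (rule law0.expected_card)
  finally show ?case by simp
next
  case (Suc t)
  have m: "(\<lambda>\<omega>. of_nat (card (bad_points r (P t \<omega>))) :: ennreal) \<in> borel_measurable M"
    by (rule measurable_compose[OF P_measurable measurable_card_bad_points])
  have "(\<integral>\<^sup>+\<omega>. of_nat (card (bad_points r (P (Suc t) \<omega>))) \<partial>M)
      = (\<integral>\<^sup>+\<omega>. law0.round_expectation (\<lambda>X. of_nat (card (bad_points r X))) (bad_points r (P t \<omega>)) \<partial>M)"
    by (rule round_expectation_next[OF measurable_card_bad_points])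
  also have "\<dots> \<le> (\<integral>\<^sup>+\<omega>. ennreal law0.contraction_factor * of_nat (card (bad_points r (P t \<omega>))) \<partial>M)"
    using law0.round_expectation_bad_points_le[OF bad_points_P_space]
    by (intro nn_integral_mono) simp
  also have "\<dots> = ennreal law0.contraction_factor * (\<integral>\<^sup>+\<omega>. of_nat (card (bad_points r (P t \<omega>))) \<partial>M)"
    by (rule nn_integral_cmult[OF m])
  also have "\<dots> \<le> ennreal law0.contraction_factor * (ennreal law0.contraction_factor ^ t * ennreal (disk_intensity lam r))"
    by (intro mult_left_mono Suc.IH) simp
  finally show ?case by (simp add: mult.assoc)
qed

text \<open>The radius cancels, so the rate of contraction is uniform in \<open>r\<close>; the
  radius enters only through the initial number of points.\<close>

lemma contraction_factor_eq:
  "law0.contraction_factor = 4 * lam * (1 - exp (- (4 * lam))) + 572 / 25 * lam\<^sup>2 / pi"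
proof -
  have "disk_intensity lam r * pi * (2 * r)\<^sup>2 = 4 * lam"
    using r_pos by (simp add: disk_intensity_def power2_eq_square)
  moreover have "143 / 100 * (disk_intensity lam r)\<^sup>2 * pi * (2 * r) ^ 4 = 572 / 25 * lam\<^sup>2 / pi"
    using r_pos by (simp add: disk_intensity_def power2_eq_square power4_eq_xxxx field_simps)
  ultimately show ?thesis by (simp only: law0.contraction_factor_def)
qed

end

text \<open>The rounds are the times before the first hard configuration, and at each of these the
  summand is 1. A run that never becomes hard gives \<infinity> on both sides.\<close>

lemma rounds_le_suminf:
  "ennreal_of_enat (rounds r P \<omega>) \<le> (\<Sum>t. of_bool (\<not> hard r (P t \<omega>)))"
proof (cases "\<exists>t. hard r (P t \<omega>)")
  case True
  define n where "n = (LEAST t. hard r (P t \<omega>))"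
  have n: "hard r (P n \<omega>)" "t < n \<Longrightarrow> \<not> hard r (P t \<omega>)" for t
    using True by (auto simp: n_def intro: LeastI dest: not_less_Least)
  have "rounds r P \<omega> \<le> enat n"
    unfolding rounds_def using n(1) by (intro Inf_lower) (auto simp: hard_def)
  then have "ennreal_of_enat (rounds r P \<omega>) \<le> ennreal_of_enat (enat n)"
    by (simp only: ennreal_of_enat_le_iff)
  also have "\<dots> = (\<Sum>t<n. of_bool (\<not> hard r (P t \<omega>)))"
    using n(2) by simp
  also have "\<dots> \<le> (\<Sum>t. of_bool (\<not> hard r (P t \<omega>)))" by (rule sum_le_suminf) auto
  finally show ?thesis .
next
  case False
  then have "of_bool (\<not> hard r (P t \<omega>)) = (1 :: ennreal)" for t by simp
  then have "(\<Sum>t. of_bool (\<not> hard r (P t \<omega>)) :: ennreal) = \<top>"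
    by (simp add: nn_integral_count_space_nat[symmetric])
  then show ?thesis by simp
qed

section \<open>The number of rounds\<close>

lemma pi_ge_3: "3 \<le> pi"
  using sin_x_le_x[of "pi / 6"] by (simp add: sin_30)

text \<open>Both terms increase with \<open>lam\<close> and are evaluated at \<open>0.2345\<close>:
  the first is at most \<open>0.938 * 0.6155 < 0.5774\<close>, the second, with \<open>3\<close> in
  place of \<open>pi\<close>, is below \<open>0.4195\<close>.\<close>

lemma contraction_constant:
  fixes lam :: real
  assumes "0 < lam" "lam \<le> 2345 / 10000"
  shows "4 * lam * (1 - exp (- (4 * lam))) + 572 / 25 * lam\<^sup>2 / pi \<le> 499 / 500"
proof -
  let ?u = "938 / 1000 :: real"
  \<comment> \<open>\<open>0.9706\<close> is a lower bound for \<open>1 - 0.938 / 32\<close>. Taking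
    a 32nd power makes the inequality \<open>1 + x \<le> exp x\<close> sharp enough to bound
    \<open>exp (- 0.938)\<close> from below.\<close>
  have "(3845 / 10000 :: real) \<le> (9706 / 10000) ^ 32" by (simp add: power_divide)
  also have "\<dots> \<le> exp (- ?u / 32) ^ 32"
    using exp_ge_add_one_self[of "- ?u / 32"] by (intro power_mono) auto
  also have "\<dots> = exp (- ?u)" by (simp add: exp_of_nat_mult[symmetric])
  finally have e: "3845 / 10000 \<le> exp (- ?u)" .
  have "exp (- ?u) \<le> exp (- (4 * lam))" using assms by simp
  then have "1 - exp (- (4 * lam)) \<le> 6155 / 10000" using e by linarith
  then have "4 * lam * (1 - exp (- (4 * lam))) \<le> ?u * (6155 / 10000)"
    using assms by (intro mult_mono) auto
  moreover have "572 / 25 * lam\<^sup>2 / pi \<le> 572 / 25 * (2345 / 10000)\<^sup>2 / 3"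
    using assms pi_ge_3 by (intro frac_le mult_mono power_mono) auto
  ultimately show ?thesis by (simp add: power2_eq_square)
qed

text \<open>The first \<open>m\<close> terms are bounded by 1 each; from \<open>m\<close> on the
  constant \<open>C\<close> has been used up and a plain geometric series remains. With
  \<open>C\<close> of order \<open>1 / r\<^sup>2\<close> a logarithmic \<open>m\<close> is
  enough.\<close>

lemma suminf_geometric_capped_le:
  fixes p :: "nat \<Rightarrow> ennreal"
  assumes p1: "\<And>t. p t \<le> 1" and p2: "\<And>t. p t \<le> ennreal (q ^ t * C)"
    and q: "0 < q" "q < 1" and m: "q ^ m * C \<le> 1"
  shows "(\<Sum>t. p t) \<le> ennreal (real m + 1 / (1 - q))"
proof -
  have "(\<Sum>t. p t) = (\<Sum>t. p (t + m)) + (\<Sum>t<m. p t)"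
    by (rule suminf_offset) simp
  also have "\<dots> \<le> (\<Sum>t. ennreal (q ^ t)) + (\<Sum>t<m. 1)"
  proof (intro add_mono suminf_le sum_mono p1)
    fix t
    have "p (t + m) \<le> ennreal (q ^ (t + m) * C)" by (rule p2)
    also have "\<dots> \<le> ennreal (q ^ t)"
      using mult_left_mono[OF m, of "q ^ t"] q by (intro ennreal_leI) (simp add: power_add mult.assoc)
    finally show "p (t + m) \<le> ennreal (q ^ t)" .
  qed auto
  also have "(\<Sum>t. ennreal (q ^ t)) = ennreal (1 / (1 - q))"
    using q by (intro suminf_ennreal_eq geometric_sums) auto
  also have "ennreal (1 / (1 - q)) + (\<Sum>t<m. 1) = ennreal (real m + 1 / (1 - q))"
    using q by (simp add: ennreal_of_nat_eq_real_of_nat ennreal_plus[symmetric] add.commute del: ennreal_plus)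
  finally show ?thesis .
qed

lemma expected_rounds_le:
  assumes prs: "partial_rejection_sampling M lam r P Q"
    and lam: "0 < lam" "lam \<le> 2345 / 10000" and r: "0 < r" "r < exp (- 1)"
  shows "(\<integral>\<^sup>+\<omega>. ennreal_of_enat (rounds r P \<omega>) \<partial>M) \<le> ennreal ((2 / ln (500 / 499) + 501) * ln (1 / r))"
proof -
  interpret partial_rejection_sampling M lam r P Q by (rule prs)
  interpret positive_partial_rejection_sampling M lam r P Q
    by unfold_locales (use lam r in auto)
  let ?q = "499 / 500 :: real" and ?c = "disk_intensity lam r" and ?l = "ln (1 / r)"
  \<comment> \<open>The bound \<open>exp (- 1)\<close> on the radius makes \<open>?l\<close> exceed
    1, so that additive constants can be absorbed into a multiple of it.\<close>
  have "ln r < ln (exp (- 1))" using r by (subst ln_less_cancel_iff) auto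
  then have l: "1 < ?l" using r by (simp add: ln_div)
  define p where "p t = (\<integral>\<^sup>+\<omega>. of_bool (\<not> hard r (P t \<omega>)) \<partial>M :: ennreal)" for t
  have c: "0 \<le> ?c" using lam r by (simp add: disk_intensity_def)
  have "pi * r\<^sup>2 \<ge> lam * r\<^sup>2" using lam pi_ge_3 by (intro mult_right_mono) auto
  then have c_le: "?c \<le> 1 / r\<^sup>2" using r lam by (simp add: disk_intensity_def field_simps)
  have \<kappa>: "law0.contraction_factor \<le> ?q"
    unfolding contraction_factor_eq by (rule contraction_constant[OF lam])
  have p_1: "p t \<le> 1" for t
  proof -
    have "p t \<le> (\<integral>\<^sup>+\<omega>. 1 \<partial>M)" unfolding p_def by (intro nn_integral_mono) auto
    then show ?thesis by (simp add: emeasure_space_1)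
  qed
  have p_q: "p t \<le> ennreal (?q ^ t * ?c)" for t
  proof -
    \<comment> \<open>Markov's inequality: a configuration that is not hard has at least one bad
      point.\<close>
    have "p t \<le> (\<integral>\<^sup>+\<omega>. of_nat (card (bad_points r (P t \<omega>))) \<partial>M)"
      unfolding p_def
    proof (intro nn_integral_mono)
      fix \<omega> assume "\<omega> \<in> space M"
      then have "finite (bad_points r (P t \<omega>))"
        using bad_points_P_space[of \<omega> t] by (simp add: space_configs)
      then show "of_bool (\<not> hard r (P t \<omega>)) \<le> (of_nat (card (bad_points r (P t \<omega>))) :: ennreal)"
        by (cases "hard r (P t \<omega>)")
          (auto simp: hard_iff_bad_points card_gt_0_iff Suc_le_eq dest: of_nat_mono[where 'a=ennreal])
    qed
    also have "\<dots> \<le> ennreal law0.contraction_factor ^ t * ennreal ?c" by (rule expected_bad_points)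
    also have "\<dots> \<le> ennreal ?q ^ t * ennreal ?c"
      by (intro mult_right_mono power_mono ennreal_leI \<kappa>) auto
    also have "\<dots> = ennreal (?q ^ t * ?c)" using c by (simp add: ennreal_power ennreal_mult)
    finally show ?thesis .
  qed
  \<comment> \<open>The least \<open>m\<close> with \<open>2 * ?l \<le> m * ln (500 / 499)\<close>,
    which is what \<open>?q ^ m \<le> r\<^sup>2\<close> requires.\<close>
  define m where "m = nat \<lceil>2 * ?l / ln (500 / 499)\<rceil>"
  have ln_pos: "0 < ln (500 / 499 :: real)" by simp
  have quot: "0 \<le> 2 * ?l / ln (500 / 499)" using l ln_pos by (intro divide_nonneg_pos) auto
  have m: "2 * ?l / ln (500 / 499) \<le> real m" "real m \<le> 2 * ?l / ln (500 / 499) + 1"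
    using quot unfolding m_def by linarith+
  have "?q ^ m * ?c \<le> 1"
  proof -
    have "2 * ?l \<le> real m * ln (500 / 499)" using m(1) ln_pos by (simp add: pos_divide_le_eq)
    moreover have "ln ?q = - ln (500 / 499)" by (simp add: ln_div)
    moreover have "ln r = - ?l" using r by (simp add: ln_div)
    ultimately have "ln (?q ^ m) \<le> ln (r\<^sup>2)" using r by (simp add: ln_realpow)
    then have "?q ^ m \<le> r\<^sup>2" using r by (subst (asm) ln_le_cancel_iff) auto
    then have "?q ^ m * ?c \<le> r\<^sup>2 * (1 / r\<^sup>2)" using c_le c by (intro mult_mono) auto
    then show ?thesis using r by simp
  qed
  from suminf_geometric_capped_le[OF p_1 p_q _ _ this]
  \<comment> \<open>\<open>500\<close> is \<open>1 / (1 - ?q)\<close>; together with the 1 lost in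
    rounding up \<open>m\<close> it yields the \<open>501\<close> of the final bound.\<close>
  have sum_le: "(\<Sum>t. p t) \<le> ennreal (real m + 500)" by simp
  have "(\<integral>\<^sup>+\<omega>. ennreal_of_enat (rounds r P \<omega>) \<partial>M) \<le> (\<integral>\<^sup>+\<omega>. (\<Sum>t. of_bool (\<not> hard r (P t \<omega>))) \<partial>M)"
    by (intro nn_integral_mono rounds_le_suminf)
  also have "\<dots> = (\<Sum>t. p t)"
    unfolding p_def
  proof (rule nn_integral_suminf)
    fix t
    note [measurable] = pred_hard[OF P_measurable[of t], of r]
    show "(\<lambda>\<omega>. of_bool (\<not> hard r (P t \<omega>)) :: ennreal) \<in> borel_measurable M" by measurable
  qed
  also have "\<dots> \<le> ennreal (real m + 500)" by (rule sum_le)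
  also have "\<dots> \<le> ennreal ((2 / ln (500 / 499) + 501) * ?l)"
  proof (rule ennreal_leI)
    have "real m + 500 \<le> 2 * ?l / ln (500 / 499) + 501" using m(2) by simp
    also have "\<dots> \<le> 2 * ?l / ln (500 / 499) + 501 * ?l" using l by simp
    finally show "real m + 500 \<le> (2 / ln (500 / 499) + 501) * ?l" by (simp add: algebra_simps)
  qed
  finally show ?thesis .
qed

theorem theorem2:
  shows "\<exists>lam_bar::real. lam_bar > 0.2344 \<and>
    (\<forall>lam. 0 < lam \<and> lam \<le> lam_bar \<longrightarrow>
      (\<exists>K r0. K > 0 \<and> r0 \<in> {0<..<1} \<and>
        (\<forall>r. 0 < r \<and> r < r0 \<longrightarrow>
          (\<forall>(M :: 'w measure) P Q. partial_rejection_sampling M lam r P Q \<longrightarrow>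
            (\<integral>\<^sup>+\<omega>. ennreal_of_enat (rounds r P \<omega>) \<partial>M) \<le> ennreal (K * ln (1 / r))))))"
proof (rule exI[of _ "2345 / 10000 :: real"], intro conjI allI impI)
  show "(0.2344 :: real) < 2345 / 10000" by simp
  fix lam :: real assume lam: "0 < lam \<and> lam \<le> 2345 / 10000"
  \<comment> \<open>Both \<open>K\<close> and \<open>r0 = exp (- 1)\<close> are the same for all
    \<open>lam\<close> in the range, since the contraction factor is at most
    \<open>499 / 500\<close> throughout.\<close>
  have "0 < ln (500 / 499 :: real)" by simp
  then have "0 < 2 / ln (500 / 499 :: real) + 501" by (intro add_pos_pos divide_pos_pos) auto
  moreover have "exp (- 1 :: real) \<in> {0<..<1}" by simp
  ultimately show "\<exists>K r0. K > 0 \<and> r0 \<in> {0<..<1} \<and>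
        (\<forall>r. 0 < r \<and> r < r0 \<longrightarrow>
          (\<forall>(M :: 'w measure) P Q. partial_rejection_sampling M lam r P Q \<longrightarrow>
            (\<integral>\<^sup>+\<omega>. ennreal_of_enat (rounds r P \<omega>) \<partial>M) \<le> ennreal (K * ln (1 / r))))"
    using expected_rounds_le lam by blast
qed

end
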